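(* The restriction $\zeta_U$ to $U$ of any supercharacter $\zeta$ of $U_m(q)$ decomposes as a sum of supercharacters of $U$.
   Context: Let $p\ge 3$ be a prime, $q=p^e$ ($e\ge 1$), $\mathbb{F}_q$ the field with $q$ elements, and $n\ge 1$. Let $G$ be one of $Sp_{2n}(q)$ (symplectic case), $O_{2n}(q)$ (even orthogonal case), $O_{2n+1}(q)$ (odd orthogonal case); put $m=2n$ in the first two cases and $m=2n+1$ in the third. Let $U_m(q)$ be the group of unipotent upper-triangular $m\times m$ matrices over $\mathbb{F}_q$, and $U=G\cap U_m(q)$, a Sylow $p$-subgroup of $G$. Explicitly, with $J$ the $n\times n$ matrix with 1's on the anti-diagonal and 0's elsewhere, $U$ consists of all block matrices $\begin{pmatrix} x & xu & xz \\ 0 & I_r & -u^TJ \\ 0 & 0 & Jx^{-T}J\end{pmatrix}$ with $x\in U_n(q)$, $u$ an $n\times r$ matrix and $z$ an $n\times n$ matrix over $\mathbb{F}_q$, where: $r=0$ and $Jz^T-zJ=0$ in the symplectic case; $r=0$ and $Jz^T+zJ=0$ in the even orthogonal case; $r=1$ and $Jz^T+zJ=-uu^T$ in the odd orthogonal case. Rows and columns of $m\times m$ matrices are indexed, in order, by $1,\dots,n,-n,\dots,-1$ if $m=2n$ and by $1,\dots,n,0,-n,\dots,-1$ if $m=2n+1$; this order is denoted $\prec$, so $1\prec\cdots\prec n\prec 0\prec -n\prec\cdots\prec -1$. Fix a nontrivial linear character $\vartheta\colon\mathbb{F}_q^+\to\mathbb{C}^\times$. Supercharacters of $U_m(q)$: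 for indices $i\prec j$ and $r\in\mathbb{F}_q^\times$, $\zeta_{i,j,r}$ is the character of $U_m(q)$ induced from the linear character $x\mapsto\vartheta(rx_{i,j})$ of $U_{i,j}=\{x\in U_m(q):x_{i,k}=0,\ i\prec k\prec j\}$. A set $\mathcal{D}$ of pairs $(i,j)$ with $i\prec j$ is basic if it contains at most one entry from each row and at most one from each column. The supercharacters of $U_m(q)$ are the products $\zeta_{\mathcal{D},\varphi}=\prod_{(i,j)\in\mathcal{D}}\zeta_{i,j,\varphi(i,j)}$ for $\mathcal{D}$ basic and $\varphi\colon\mathcal{D}\to\mathbb{F}_q^\times$ a map (the trivial character if $\mathcal{D}=\emptyset$). Supercharacters of $U$: $\Phi=\{\varepsilon_i\pm\varepsilon_j:1\le i<j\le n\}\cup\Phi'$, with $\Phi'=\{2\varepsilon_i:1\le i\le n\}$ (symplectic), $\Phi'=\emptyset$ (even orthogonal), $\Phi'=\{\varepsilon_i:1\le i\le n\}$ (odd orthogonal), where $\varepsilon_1,\dots,\varepsilon_n$ are the coordinate functions on the diagonal torus. For $i<j$, $\mathcal{E}(\varepsilon_i-\varepsilon_j)=\{(i,j),(-j,-i)\}$, $\mathcal{E}(\varepsilon_i+\varepsilon_j)=\{(i,-j),(j,-i)\}$; $\mathcal{E}(2\varepsilon_i)=\{(i,-i)\}$ (symplectic); $\mathcal{E}(\varepsilon_i)=\{(i,0),(0,-i)\}$ (odd orthogonal). For each $\alpha\in\Phi$ there is exactly one $(i,j)\in\mathcal{E}(\alpha)$ with $1\le i\le n$ and $i\prec j\preceq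 -i$. $D\subseteq\Phi$ is a basic subset if $\mathcal{E}(D)=\bigcup_{\alpha\in D}\mathcal{E}(\alpha)$ is basic. For $i<j$, $U_{\varepsilon_i-\varepsilon_j}=\{x\in U: x_{i,k}=0,\ i<k<j\}$; $U_{\varepsilon_i+\varepsilon_j}=\{x\in U:x_{i,k}=x_{j,l}=0,\ i<k\le n,\ j\prec l\preceq 0\}$; and for $\alpha=2\varepsilon_i$ (symplectic) or $\alpha=\varepsilon_i$ (odd orthogonal), $U_\alpha=\{x\in U:x_{i,k}=0,\ i<k\le n\}$. For $\alpha\in\Phi$, $r\in\mathbb{F}_q^\times$, $\lambda_{\alpha,r}(x)=\vartheta(rx_{i,j})$ (with $(i,j)$ the distinguished entry of $\mathcal{E}(\alpha)$) is a linear character of $U_\alpha$, and $\xi_{\alpha,r}=(\lambda_{\alpha,r})^U$ (induced character). For a basic $D\subseteq\Phi$ and $\phi\colon D\to\mathbb{F}_q^\times$, the supercharacter is $\xi_{D,\phi}=\prod_{\alpha\in D}\xi_{\alpha,\phi(\alpha)}$ (the trivial character $1_U$ if $D=\emptyset$). "A sum of supercharacters" means a linear combination of supercharacters with nonnegative integer coefficients. *)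

theory Defs
  imports
    Complex_Main
    "HOL-Algebra.Group"
    "HOL-Library.FuncSet"
    "HOL-Computational_Algebra.Primes"
    "Jordan_Normal_Form.Matrix"
begin

text \<open>
  Characters are represented by their values.  For a finite group \<open>G\<close> and a subgroup \<open>H\<close>
  the usual formula for the character of \<open>G\<close> induced from a character of \<open>H\<close> is
  \<open>(1/|H|) \<Sum>\<^sub>y \<chi>\<degree>(y g y\<^sup>-\<^sup>1)\<close>, where \<open>\<chi>\<degree>\<close> is \<open>\<chi>\<close> extended by zero outside \<open>H\<close>.
  Only its values for \<open>g \<in> carrier G\<close> are meaningful.
\<close>

definition induced_char ::
    "('g, 'b) monoid_scheme \<Rightarrow> 'g set \<Rightarrow> ('g \<Rightarrow> complex) \<Rightarrow> 'g \<Rightarrow> complex" where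
  "induced_char G H \<chi> g =
     (\<Sum>y \<in> {y \<in> carrier G. y \<otimes>\<^bsub>G\<^esub> g \<otimes>\<^bsub>G\<^esub> inv\<^bsub>G\<^esub> y \<in> H}. \<chi> (y \<otimes>\<^bsub>G\<^esub> g \<otimes>\<^bsub>G\<^esub> inv\<^bsub>G\<^esub> y))
       / of_nat (card H)"

definition nontrivial_additive_char :: "('a :: field \<Rightarrow> complex) \<Rightarrow> bool" where
  "nontrivial_additive_char \<theta> \<longleftrightarrow>
     (\<forall>x. \<theta> x \<noteq> 0) \<and> (\<forall>x y. \<theta> (x + y) = \<theta> x * \<theta> y) \<and> (\<exists>x. \<theta> x \<noteq> 1)"

datatype family = Symplectic | Even_Orthogonal | Odd_Orthogonal

definition middle :: "family \<Rightarrow> nat" where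
  "middle t = (if t = Odd_Orthogonal then 1 else 0)"

definition dimn :: "family \<Rightarrow> nat \<Rightarrow> nat" where
  "dimn t n = 2 * n + middle t"

definition unitriangular_group :: "nat \<Rightarrow> 'a :: field mat monoid" where
  "unitriangular_group m =
     \<lparr>carrier = {x \<in> carrier_mat m m. upper_triangular x \<and> (\<forall>i < m. x $$ (i, i) = 1)},
      mult = (*), one = 1\<^sub>m m\<rparr>"

definition antidiag_mat :: "nat \<Rightarrow> 'a :: field mat" where
  "antidiag_mat n = mat n n (\<lambda>(i, j). if i + j + 1 = n then 1 else 0)"

text \<open>
  The intersection \<open>U\<close> of \<open>Sp\<^sub>2\<^sub>n(q)\<close>, \<open>O\<^sub>2\<^sub>n(q)\<close> or \<open>O\<^sub>2\<^sub>n\<^sub>+\<^sub>1(q)\<close> with the unitriangular group is given by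
  its explicit elements: the block matrices with rows \<open>(x, xu, xz)\<close>, \<open>(0, 1, - u\<^sup>T J)\<close>, \<open>(0, 0, J x\<^sup>-\<^sup>T J)\<close>, for \<open>u\<close> of
  size \<open>n \<times> r\<close> and \<open>r = middle t\<close>.  For \<open>r = 0\<close> the middle block row and column are empty.
\<close>

definition U_block :: "nat \<Rightarrow> nat \<Rightarrow> 'a :: field mat \<Rightarrow> 'a mat \<Rightarrow> 'a mat \<Rightarrow> 'a mat" where
  "U_block n r x u z =
     four_block_mat
       (four_block_mat x (x * u) (0\<^sub>m r n) (1\<^sub>m r))
       (four_block_mat (x * z) (0\<^sub>m n 0) (- (transpose_mat u * antidiag_mat n)) (0\<^sub>m r 0))
       (0\<^sub>m n (n + r))
       (antidiag_mat n * transpose_mat (inv\<^bsub>unitriangular_group n\<^esub> x) * antidiag_mat n)"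

definition U_cond :: "family \<Rightarrow> nat \<Rightarrow> 'a :: field mat \<Rightarrow> 'a mat \<Rightarrow> bool" where
  "U_cond t n u z \<longleftrightarrow>
     (let J = antidiag_mat n in
      case t of
        Symplectic \<Rightarrow> J * transpose_mat z - z * J = 0\<^sub>m n n
      | Even_Orthogonal \<Rightarrow> J * transpose_mat z + z * J = 0\<^sub>m n n
      | Odd_Orthogonal \<Rightarrow> J * transpose_mat z + z * J = - (u * transpose_mat u))"

definition U_group :: "family \<Rightarrow> nat \<Rightarrow> 'a :: field mat monoid" where
  "U_group t n =
     \<lparr>carrier = {U_block n (middle t) x u z | x u z.
         x \<in> carrier (unitriangular_group n) \<and>
         u \<in> carrier_mat n (middle t) \<and> z \<in> carrier_mat n n \<and> U_cond t n u z},
      mult = (*), one = 1\<^sub>m (dimn t n)\<rparr>"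

definition indices :: "family \<Rightarrow> nat \<Rightarrow> int set" where
  "indices t n = {k. 1 \<le> \<bar>k\<bar> \<and> \<bar>k\<bar> \<le> int n} \<union> (if t = Odd_Orthogonal then {0} else {})"

text \<open>
  The order \<open>1, 2, \<dots>, 0, \<dots>, -2, -1\<close>, on all integers at once, so that it does not depend on \<open>n\<close>.
\<close>

definition prec :: "int \<Rightarrow> int \<Rightarrow> bool" (infix "\<prec>" 50) where
  "i \<prec> j \<longleftrightarrow> sgn j < sgn i \<or> (sgn i = sgn j \<and> i < j)"

abbreviation prec_eq :: "int \<Rightarrow> int \<Rightarrow> bool" (infix "\<preceq>" 50) where
  "i \<preceq> j \<equiv> i \<prec> j \<or> i = j"

text \<open>The (0-based) position of a signed index; matrices of the library are indexed from 0.\<close>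

definition pos :: "family \<Rightarrow> nat \<Rightarrow> int \<Rightarrow> nat" where
  "pos t n k = (if k > 0 then nat (k - 1) else if k = 0 then n else nat (int (dimn t n) + k))"

definition entry :: "family \<Rightarrow> nat \<Rightarrow> 'a mat \<Rightarrow> int \<Rightarrow> int \<Rightarrow> 'a" where
  "entry t n x i j = x $$ (pos t n i, pos t n j)"

definition basic :: "(int \<times> int) set \<Rightarrow> bool" where
  "basic D \<longleftrightarrow> inj_on fst D \<and> inj_on snd D"

definition U_entry :: "family \<Rightarrow> nat \<Rightarrow> int \<Rightarrow> int \<Rightarrow> 'a :: field mat set" where
  "U_entry t n i j =
     {x \<in> carrier (unitriangular_group (dimn t n)).
        \<forall>k \<in> indices t n. i \<prec> k \<and> k \<prec> j \<longrightarrow> entry t n x i k = 0}"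

definition zeta ::
    "family \<Rightarrow> nat \<Rightarrow> ('a :: field \<Rightarrow> complex) \<Rightarrow> int \<Rightarrow> int \<Rightarrow> 'a \<Rightarrow> 'a mat \<Rightarrow> complex" where
  "zeta t n \<theta> i j r =
     induced_char (unitriangular_group (dimn t n)) (U_entry t n i j)
       (\<lambda>x. \<theta> (r * entry t n x i j))"

definition entries :: "family \<Rightarrow> nat \<Rightarrow> (int \<times> int) set" where
  "entries t n = {(i, j). i \<in> indices t n \<and> j \<in> indices t n \<and> i \<prec> j}"

definition zeta_prod ::
    "family \<Rightarrow> nat \<Rightarrow> ('a :: field \<Rightarrow> complex) \<Rightarrow> (int \<times> int) set \<Rightarrow> (int \<times> int \<Rightarrow> 'a)
       \<Rightarrow> 'a mat \<Rightarrow> complex" where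
  "zeta_prod t n \<theta> D \<phi> x = (\<Prod>(i, j) \<in> D. zeta t n \<theta> i j (\<phi> (i, j)) x)"

definition supercharacters_unitriangular ::
    "family \<Rightarrow> nat \<Rightarrow> ('a :: field \<Rightarrow> complex) \<Rightarrow> ('a mat \<Rightarrow> complex) set" where
  "supercharacters_unitriangular t n \<theta> =
     {zeta_prod t n \<theta> D \<phi> | D \<phi>. D \<subseteq> entries t n \<and> basic D \<and> \<phi> \<in> D \<rightarrow>\<^sub>E - {0}}"

text \<open>
  \<open>Minus i j\<close>, \<open>Plus i j\<close>, \<open>Twice i\<close>, \<open>Single i\<close> stand for the roots
  \<open>\<epsilon>\<^sub>i - \<epsilon>\<^sub>j\<close>, \<open>\<epsilon>\<^sub>i + \<epsilon>\<^sub>j\<close>, \<open>2 \<epsilon>\<^sub>i\<close>, \<open>\<epsilon>\<^sub>i\<close>.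
\<close>

datatype root = Minus int int | Plus int int | Twice int | Single int

definition roots :: "family \<Rightarrow> nat \<Rightarrow> root set" where
  "roots t n =
     {Minus i j | i j. 1 \<le> i \<and> i < j \<and> j \<le> int n} \<union>
     {Plus i j | i j. 1 \<le> i \<and> i < j \<and> j \<le> int n} \<union>
     (case t of
        Symplectic \<Rightarrow> {Twice i | i. 1 \<le> i \<and> i \<le> int n}
      | Even_Orthogonal \<Rightarrow> {}
      | Odd_Orthogonal \<Rightarrow> {Single i | i. 1 \<le> i \<and> i \<le> int n})"

fun root_entries :: "root \<Rightarrow> (int \<times> int) set" where
  "root_entries (Minus i j) = {(i, j), (- j, - i)}"
| "root_entries (Plus i j) = {(i, - j), (j, - i)}"
| "root_entries (Twice i) = {(i, - i)}"
| "root_entries (Single i) = {(i, 0), (0, - i)}"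

fun root_entry :: "root \<Rightarrow> int \<times> int" where
  "root_entry (Minus i j) = (i, j)"
| "root_entry (Plus i j) = (i, - j)"
| "root_entry (Twice i) = (i, - i)"
| "root_entry (Single i) = (i, 0)"

lemma root_entry_unique:
  assumes "\<alpha> \<in> roots t n"
  shows "(i, j) \<in> root_entries \<alpha> \<and> 1 \<le> i \<and> i \<le> int n \<and> i \<prec> j \<and> j \<preceq> - i
           \<longleftrightarrow> (i, j) = root_entry \<alpha>"
  using assms by (cases \<alpha>) (auto simp: roots_def prec_def sgn_if split: family.splits if_splits)

definition basic_roots :: "root set \<Rightarrow> bool" where
  "basic_roots D \<longleftrightarrow> basic (\<Union>\<alpha> \<in> D. root_entries \<alpha>)"

text \<open>
  In the case \<open>Plus i j\<close> the condition \<open>l \<preceq> 0\<close> reduces to \<open>l \<le> n\<close> when 0 is not an index.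
\<close>

fun U_root :: "family \<Rightarrow> nat \<Rightarrow> root \<Rightarrow> 'a :: field mat set" where
  "U_root t n (Minus i j) =
     {x \<in> carrier (U_group t n). \<forall>k. i < k \<and> k < j \<longrightarrow> entry t n x i k = 0}"
| "U_root t n (Plus i j) =
     {x \<in> carrier (U_group t n).
        (\<forall>k. i < k \<and> k \<le> int n \<longrightarrow> entry t n x i k = 0) \<and>
        (\<forall>l \<in> indices t n. j \<prec> l \<and> l \<preceq> 0 \<longrightarrow> entry t n x j l = 0)}"
| "U_root t n (Twice i) =
     {x \<in> carrier (U_group t n). \<forall>k. i < k \<and> k \<le> int n \<longrightarrow> entry t n x i k = 0}"
| "U_root t n (Single i) =
     {x \<in> carrier (U_group t n). \<forall>k. i < k \<and> k \<le> int n \<longrightarrow> entry t n x i k = 0}"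

definition root_char ::
    "family \<Rightarrow> nat \<Rightarrow> ('a :: field \<Rightarrow> complex) \<Rightarrow> root \<Rightarrow> 'a \<Rightarrow> 'a mat \<Rightarrow> complex" where
  "root_char t n \<theta> \<alpha> r x = (case root_entry \<alpha> of (i, j) \<Rightarrow> \<theta> (r * entry t n x i j))"

definition xi ::
    "family \<Rightarrow> nat \<Rightarrow> ('a :: field \<Rightarrow> complex) \<Rightarrow> root \<Rightarrow> 'a \<Rightarrow> 'a mat \<Rightarrow> complex" where
  "xi t n \<theta> \<alpha> r = induced_char (U_group t n) (U_root t n \<alpha>) (root_char t n \<theta> \<alpha> r)"

definition xi_prod ::
    "family \<Rightarrow> nat \<Rightarrow> ('a :: field \<Rightarrow> complex) \<Rightarrow> root set \<Rightarrow> (root \<Rightarrow> 'a) \<Rightarrow> 'a mat \<Rightarrow> complex" where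
  "xi_prod t n \<theta> D \<phi> x = (\<Prod>\<alpha> \<in> D. xi t n \<theta> \<alpha> (\<phi> \<alpha>) x)"

definition supercharacters_U ::
    "family \<Rightarrow> nat \<Rightarrow> ('a :: field \<Rightarrow> complex) \<Rightarrow> ('a mat \<Rightarrow> complex) set" where
  "supercharacters_U t n \<theta> =
     {xi_prod t n \<theta> D \<phi> | D \<phi>. D \<subseteq> roots t n \<and> basic_roots D \<and> \<phi> \<in> D \<rightarrow>\<^sub>E - {0}}"

lemma finite_roots: "finite (roots t n)"
proof -
  have "roots t n \<subseteq> case_prod Minus ` ({1..int n} \<times> {1..int n}) \<union>
          case_prod Plus ` ({1..int n} \<times> {1..int n}) \<union> Twice ` {1..int n} \<union> Single ` {1..int n}"
    by (auto simp: roots_def image_iff split: family.splits)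
  then show ?thesis
    by (rule finite_subset) auto
qed

text \<open>Sums over the set of supercharacters are therefore genuine finite sums.\<close>

lemma finite_supercharacters_U:
  fixes \<theta> :: "'a :: {field, finite} \<Rightarrow> complex"
  shows "finite (supercharacters_U t n \<theta>)"
proof -
  have "supercharacters_U t n \<theta> \<subseteq>
          case_prod (xi_prod t n \<theta>) ` (SIGMA D : Pow (roots t n). D \<rightarrow>\<^sub>E - {0})"
    by (force simp: supercharacters_U_def image_iff)
  moreover have "finite (SIGMA D : Pow (roots t n). D \<rightarrow>\<^sub>E - {0 :: 'a})"
    by (intro finite_SigmaI finite_PiE) (auto simp: finite_roots intro: finite_subset[OF _ finite_roots])
  ultimately show ?thesis
    by (meson finite_imageI finite_subset)
qed

definition is_sum_of_supercharacters ::
    "family \<Rightarrow> nat \<Rightarrow> ('a :: field \<Rightarrow> complex) \<Rightarrow> ('a mat \<Rightarrow> complex) \<Rightarrow> bool" where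
  "is_sum_of_supercharacters t n \<theta> f \<longleftrightarrow>
     (\<exists>c :: ('a mat \<Rightarrow> complex) \<Rightarrow> nat. \<forall>x \<in> carrier (U_group t n).
        f x = (\<Sum>\<chi> \<in> supercharacters_U t n \<theta>. of_nat (c \<chi>) * \<chi> x))"

end

theory Submission
  imports Defs "HOL-Number_Theory.Residues" "Jordan_Normal_Form.Determinant" "HOL-Library.Multiset"
begin

text \<open>
  The value \<open>\<zeta>\<^sub>i\<^sub>,\<^sub>j\<^sub>,\<^sub>r(x)\<close> is the sum of \<open>\<theta> (r (v x)\<^sub>j)\<close> over the row vectors \<open>v\<close> with leading entry
  \<open>v\<^sub>i = 1\<close> that \<open>x\<close> fixes in all columns before \<open>j\<close>.  Subtracting one such vector from another turns the
  product of two characters \<open>\<zeta>\<^sub>i\<^sub>,\<^sub>j\<^sub>,\<^sub>r\<close>, \<open>\<zeta>\<^sub>i\<^sub>,\<^sub>k\<^sub>,\<^sub>s\<close> in the same row, \<open>j \<preceq> k\<close>, into \<open>\<zeta>\<^sub>i\<^sub>,\<^sub>k\<^sub>,\<^sub>s\<close> (into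
  \<open>\<zeta>\<^sub>i\<^sub>,\<^sub>k\<^sub>,\<^sub>r\<^sub>+\<^sub>s\<close> if \<open>j = k\<close>) times \<open>1 + \<Sum> \<zeta>\<^sub>l\<^sub>,\<^sub>j\<^sub>,\<^sub>t\<close>, summed over \<open>i \<prec> l \<prec> j\<close> and \<open>t \<noteq> 0\<close>.  This lowers the
  total height.  On \<open>U\<close> the invariant form identifies \<open>\<zeta>\<^sub>i\<^sub>,\<^sub>j\<^sub>,\<^sub>r\<close> with \<open>\<zeta>\<^sub>-\<^sub>j\<^sub>,\<^sub>-\<^sub>i\<^sub>,\<^sub>\<plusminus>\<^sub>r\<close>, and with \<open>\<xi>\<^sub>\<alpha>\<^sub>,\<^sub>\<plusminus>\<^sub>r\<close>
  if \<open>(i, j) \<in> \<E>(\<alpha>)\<close> and \<open>j \<noteq> - i\<close>.  So every pair of roots violating basicness can be replaced, and the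
  process ends with supercharacters of \<open>U\<close>.

  The entries \<open>(i, - i)\<close> are exceptional.  In the orthogonal cases the quadratic form forces
  \<open>(v x)\<^sub>-\<^sub>i = 0\<close>, so that \<open>\<zeta>\<^sub>i\<^sub>,\<^sub>-\<^sub>i\<^sub>,\<^sub>r\<close> does not depend on \<open>r\<close> on \<open>U\<close>.  In the symplectic case there is a
  symmetric bilinear form \<open>\<beta>\<close> on the fixed vectors in the first half of the coordinates such that
  \<open>\<xi>\<close> for \<open>2 \<epsilon>\<^sub>i\<close> sums \<open>\<theta> (r \<beta>(v, v))\<close> and \<open>\<zeta>\<^sub>i\<^sub>,\<^sub>-\<^sub>j\<^sub>,\<^sub>r\<close> sums \<open>\<theta> (r \<beta>(v, w))\<close>; all products
  involving \<open>2 \<epsilon>\<^sub>i\<close> are then rewritten by completing squares.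
\<close>

section \<open>Elementary characters as sums over fixed vectors\<close>

text \<open>Rows enter because left multiplication by an element of \<open>U_entry t n i j\<close>
  leaves row \<open>i\<close> unchanged before column \<open>j\<close>: truncated rows label the
  cosets, and conjugating \<open>x\<close> into the subgroup means that the label is fixed by
  \<open>x\<close>. On \<open>U\<close> rows can be prescribed freely only in their first half; the
  rest is tied to the other rows by the form. This is the obstacle: the subgroup of a root
  \<epsilon> + \<epsilon>' constrains two half rows, so its \<xi> does not have the shape of the row
  formula for \<zeta>. The bridge is to split fixed vectors at an arbitrary column into a row part
  and a column part (\<open>mixed\<close>) and to turn columns into rows by the form. Splitting
  right after \<open>i\<close> gives the symmetry between \<open>(i, j)\<close> and
  \<open>(- j, - i)\<close>; splitting in the middle gives the pairing of two half rows that \<xi>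
  computes.

  The weight of a root adds the heights of all its entries. An ordinary root thus counts twice the
  height of an entry, but the root of \<open>(i, - i)\<close> only once. The expansion of \<zeta> at
  \<open>(i, - i)\<close> into two factors fits into the difference.\<close>

text \<open>
  Matrices are functions of two indices below \<open>m\<close>, and vectors are functions vanishing outside their
  range.  \<open>leadr m X i a c\<close> consists of the row vectors supported on \<open>{i..<c}\<close> with entry \<open>a\<close> at \<open>i\<close>
  that are fixed by the upper left \<open>c \<times> c\<close> block; for \<open>a = 0\<close> these are the fixed vectors supported
  strictly after \<open>i\<close>.  \<open>leadc m X c j a\<close> is the analogue for columns and the lower right block.
\<close>

definition act :: "nat \<Rightarrow> (nat \<Rightarrow> nat \<Rightarrow> 'a :: field) \<Rightarrow> (nat \<Rightarrow> 'a) \<Rightarrow> nat \<Rightarrow> 'a" where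
  "act m X v k = (\<Sum>l<m. v l * X l k)"

definition coact :: "nat \<Rightarrow> (nat \<Rightarrow> nat \<Rightarrow> 'a :: field) \<Rightarrow> (nat \<Rightarrow> 'a) \<Rightarrow> nat \<Rightarrow> 'a" where
  "coact m X u k = (\<Sum>l<m. X k l * u l)"

definition leadr :: "nat \<Rightarrow> (nat \<Rightarrow> nat \<Rightarrow> 'a :: field) \<Rightarrow> nat \<Rightarrow> 'a \<Rightarrow> nat \<Rightarrow> (nat \<Rightarrow> 'a) set" where
  "leadr m X i a c =
     {v. (\<forall>k. k < i \<or> c \<le> k \<longrightarrow> v k = 0) \<and> v i = a \<and> (\<forall>k<c. act m X v k = v k)}"

definition leadc :: "nat \<Rightarrow> (nat \<Rightarrow> nat \<Rightarrow> 'a :: field) \<Rightarrow> nat \<Rightarrow> nat \<Rightarrow> 'a \<Rightarrow> (nat \<Rightarrow> 'a) set" where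
  "leadc m X c j a =
     {u. (\<forall>k. k < c \<or> j < k \<longrightarrow> u k = 0) \<and> u j = a \<and> (\<forall>k. c \<le> k \<and> k < m \<longrightarrow> coact m X u k = u k)}"

text \<open>\<open>Zs m \<theta> X i j r\<close> is \<open>\<zeta>\<^sub>i\<^sub>,\<^sub>j\<^sub>,\<^sub>r(X)\<close> with 0-based positions \<open>i\<close>, \<open>j\<close>; the value 0 is allowed for \<open>r\<close>.\<close>

definition Zs ::
    "nat \<Rightarrow> ('a :: field \<Rightarrow> complex) \<Rightarrow> (nat \<Rightarrow> nat \<Rightarrow> 'a) \<Rightarrow> nat \<Rightarrow> nat \<Rightarrow> 'a \<Rightarrow> complex" where
  "Zs m \<theta> X i j r = (\<Sum>v\<in>leadr m X i 1 j. \<theta> (r * act m X v j))"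

section \<open>Finiteness and affine structure of the sets of fixed vectors\<close>

lemma finite_vsupp:
  fixes A :: "nat set"
  assumes "finite A"
  shows "finite {v :: nat \<Rightarrow> 'a :: {zero, finite}. \<forall>k. k \<notin> A \<longrightarrow> v k = 0}"
proof -
  have "inj_on (\<lambda>v. restrict v A) {v :: nat \<Rightarrow> 'a. \<forall>k. k \<notin> A \<longrightarrow> v k = 0}"
  proof (rule inj_onI)
    fix v w :: "nat \<Rightarrow> 'a"
    assume v: "v \<in> {v. \<forall>k. k \<notin> A \<longrightarrow> v k = 0}" and w: "w \<in> {v. \<forall>k. k \<notin> A \<longrightarrow> v k = 0}"
      and "restrict v A = restrict w A"
    then have "v k = w k" for k
      by (cases "k \<in> A") (auto dest: fun_cong[of _ _ k])
    then show "v = w" by auto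
  qed
  moreover have "(\<lambda>v. restrict v A) ` {v :: nat \<Rightarrow> 'a. \<forall>k. k \<notin> A \<longrightarrow> v k = 0} \<subseteq> A \<rightarrow>\<^sub>E UNIV"
    by auto
  moreover have "finite (A \<rightarrow>\<^sub>E (UNIV :: 'a set))"
    using assms by (intro finite_PiE) auto
  ultimately show ?thesis
    by (meson finite_imageD finite_subset)
qed

lemma finite_leadr [simp, intro]: "finite (leadr m X i (a :: 'a :: {field, finite}) c)"
  by (rule finite_subset[OF _ finite_vsupp[of "{..<c}"]]) (auto simp: leadr_def)

lemma finite_leadc [simp, intro]: "finite (leadc m X c j (a :: 'a :: {field, finite}))"
  by (rule finite_subset[OF _ finite_vsupp[of "{..j}"]]) (auto simp: leadc_def)

lemma act_comb: "act m X (\<lambda>k. \<alpha> * v k + \<beta> * w k) k = \<alpha> * act m X v k + \<beta> * act m X w k"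
  by (simp add: act_def sum_distrib_left sum.distrib algebra_simps)

lemma act_add: "act m X (\<lambda>k. v k + w k) k = act m X v k + act m X w k"
  by (simp add: act_def sum.distrib algebra_simps)

lemma act_scale: "act m X (\<lambda>k. \<alpha> * v k) k = \<alpha> * act m X v k"
  by (simp add: act_def sum_distrib_left algebra_simps)

lemma act_zero [simp]: "act m X (\<lambda>_. 0) k = 0"
  by (simp add: act_def)

lemma leadr_comb:
  assumes "v \<in> leadr m X i a c" and "w \<in> leadr m X i b c"
  shows "(\<lambda>k. \<alpha> * v k + \<beta> * w k) \<in> leadr m X i (\<alpha> * a + \<beta> * b) c"
  using assms by (auto simp: leadr_def act_comb)

lemma leadr_add:
  assumes "v \<in> leadr m X i a c" and "w \<in> leadr m X i b c"
  shows "(\<lambda>k. v k + w k) \<in> leadr m X i (a + b) c"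
  using leadr_comb[OF assms, of 1 1] by simp

lemma leadr_diff:
  assumes "v \<in> leadr m X i a c" and "w \<in> leadr m X i b c"
  shows "(\<lambda>k. v k - w k) \<in> leadr m X i (a - b) c"
  using leadr_comb[OF assms, of 1 "-1"] by simp

lemma leadr_scale:
  assumes "v \<in> leadr m X i a c"
  shows "(\<lambda>k. \<alpha> * v k) \<in> leadr m X i (\<alpha> * a) c"
  using leadr_comb[OF assms assms, of \<alpha> 0] by simp

lemma leadr_zero [simp]: "(\<lambda>_. 0) \<in> leadr m X i 0 c"
  by (auto simp: leadr_def)

lemma leadr_later:
  assumes "v \<in> leadr m X j a c" and "i < j"
  shows "v \<in> leadr m X i 0 c"
  using assms by (auto simp: leadr_def)

text \<open>Fixed vectors with different leading entries are translates of each other by any known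
  fixed vector. For \<open>b = a\<close> the sum runs over differences, which have leading entry
  0.\<close>

lemma sum_leadr_shift:
  assumes "w \<in> leadr m X i b c"
  shows "(\<Sum>v\<in>leadr m X i a c. F v) = (\<Sum>d\<in>leadr m X i (a - b) c. F (\<lambda>k. w k + d k))"
  by (rule sum.reindex_bij_witness[where i = "\<lambda>d k. w k + d k" and j = "\<lambda>v k. v k - w k"])
     (use leadr_add[OF assms, of _ "a - b"] leadr_diff[OF _ assms] in auto)

lemma sum_leadr_scale:
  assumes "(t :: 'a :: field) \<noteq> 0"
  shows "(\<Sum>v\<in>leadr m X i t c. F v) = (\<Sum>v\<in>leadr m X i 1 c. F (\<lambda>k. t * v k))"
  by (rule sum.reindex_bij_witness[where i = "\<lambda>v k. t * v k" and j = "\<lambda>v k. inverse t * v k"])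
     (use leadr_scale[of _ m X i 1 c t] leadr_scale[of _ m X i t c "inverse t"] assms
       in \<open>auto simp: field_simps\<close>)

lemma leadr_zero_last:
  assumes "c \<le> Suc i"
  shows "leadr m X i 0 c = {\<lambda>_. 0}"
proof -
  have "v k = 0" if "v \<in> leadr m X i 0 c" for v k
    using that assms by (cases "k < i"; cases "k = i") (auto simp: leadr_def)
  then show ?thesis by auto
qed

lemma sum_leadr_zero_step:
  assumes "Suc i < c"
  shows "(\<Sum>d\<in>leadr m X i 0 c. F d) =
    (\<Sum>d\<in>leadr m X (Suc i) 0 c. F d)
      + (\<Sum>t\<in>UNIV - {0}. \<Sum>d\<in>leadr m X (Suc i) (t :: 'a :: {field, finite}) c. F d)"
proof -
  have eq: "leadr m X i 0 c = (\<Union>t\<in>UNIV. leadr m X (Suc i) t c)"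
    by (auto simp: leadr_def less_Suc_eq)
  have "(\<Sum>d\<in>leadr m X i 0 c. F d) = (\<Sum>t\<in>UNIV. \<Sum>d\<in>leadr m X (Suc i) t c. F d)"
    unfolding eq by (rule sum.UNION_disjoint; (simp; fail)?) (auto simp: leadr_def)
  also have "\<dots> = (\<Sum>d\<in>leadr m X (Suc i) 0 c. F d)
      + (\<Sum>t\<in>UNIV - {0}. \<Sum>d\<in>leadr m X (Suc i) t c. F d)"
    by (rule sum.remove) auto
  finally show ?thesis .
qed

text \<open>A nonzero vector is classified by the position \<open>l\<close> and the value
  \<open>t\<close> of its first nonzero entry. All later sums over \<open>l\<close> and
  \<open>t \<noteq> 0\<close> arise here.\<close>

lemma sum_leadr_zero:
  assumes "i < c"
  shows "(\<Sum>d\<in>leadr m X i 0 c. F d) = F (\<lambda>_. 0) +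
    (\<Sum>l\<in>{i<..<c}. \<Sum>t\<in>UNIV - {0}. \<Sum>d\<in>leadr m X l (t :: 'a :: {field, finite}) c. F d)"
  using assms
proof (induction "c - i" arbitrary: i)
  case (Suc d)
  show ?case
  proof (cases "Suc i = c")
    case True
    moreover from True have "{i<..<c} = {}" by auto
    ultimately show ?thesis by (simp add: leadr_zero_last)
  next
    case False
    with Suc.prems have "Suc i < c" by simp
    then have "{i<..<c} = insert (Suc i) {Suc i<..<c}" by auto
    then show ?thesis
      using Suc.hyps(1)[of "Suc i"] Suc.hyps(2) \<open>Suc i < c\<close>
      by (simp add: sum_leadr_zero_step algebra_simps)
  qed
qed simp

section \<open>Character sums over the field and the row formula\<close>

locale additive_char =
  fixes \<theta> :: "'a :: {field, finite} \<Rightarrow> complex"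
  assumes nontriv: "nontrivial_additive_char \<theta>"
begin

lemma char_add: "\<theta> (x + y) = \<theta> x * \<theta> y"
  using nontriv by (simp add: nontrivial_additive_char_def)

lemma char_zero [simp]: "\<theta> 0 = 1"
  using char_add[of 0 0] nontriv by (simp add: nontrivial_additive_char_def)

lemma char_sum_zero: "(\<Sum>a\<in>UNIV. \<theta> a) = 0"
proof -
  obtain b where b: "\<theta> b \<noteq> 1"
    using nontriv by (auto simp: nontrivial_additive_char_def)
  have "(\<Sum>a\<in>UNIV. \<theta> a) = (\<Sum>a\<in>UNIV. \<theta> (b + a))"
    by (rule sum.reindex_bij_witness[where i = "\<lambda>a. b + a" and j = "\<lambda>a. a - b"]) auto
  also have "\<dots> = \<theta> b * (\<Sum>a\<in>UNIV. \<theta> a)"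
    by (simp add: char_add sum_distrib_left)
  finally show ?thesis using b by auto
qed

lemma char_sum: "(\<Sum>a\<in>UNIV. \<theta> (a * c)) = (if c = 0 then of_nat (card (UNIV :: 'a set)) else 0)"
proof (cases "c = 0")
  case False
  have "(\<Sum>a\<in>UNIV. \<theta> (a * c)) = (\<Sum>a\<in>UNIV. \<theta> a)"
    by (rule sum.reindex_bij_witness[where i = "\<lambda>a. a / c" and j = "\<lambda>a. a * c"])
       (use False in auto)
  then show ?thesis using False char_sum_zero by simp
qed auto

end

locale unitri = additive_char \<theta> for \<theta> :: "'a :: {field, finite} \<Rightarrow> complex" +
  fixes m :: nat and X :: "nat \<Rightarrow> nat \<Rightarrow> 'a"
  assumes diag: "k < m \<Longrightarrow> X k k = 1"
    and low: "l < k \<Longrightarrow> k < m \<Longrightarrow> X k l = 0"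
begin

abbreviation "L \<equiv> leadr m X"
abbreviation "A \<equiv> act m X"
abbreviation "Z \<equiv> Zs m \<theta> X"

lemma act_trunc:
  assumes "k < c" and "c \<le> m"
  shows "A (\<lambda>l. if l < c then v l else 0) k = A v k"
  unfolding act_def
proof (rule sum.cong)
  fix l assume "l \<in> {..<m}"
  then show "(if l < c then v l else 0) * X l k = v l * X l k"
    using assms low[of k l] by auto
qed simp

text \<open>Column \<open>c\<close> of \<open>X\<close> ends with a 1 in row \<open>c\<close>, so
  cutting a vector just before \<open>c\<close> loses exactly \<open>v c\<close>. If the vector is
  fixed in column \<open>c\<close>, the result is 0.\<close>

lemma act_trunc_next:
  assumes "c < m"
  shows "A (\<lambda>l. if l < c then v l else 0) c = A v c - v c"
proof -
  have "A v c = (\<Sum>l<m. (if l < c then v l else 0) * X l c + (if l = c then v c else 0))"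
    unfolding act_def
  proof (rule sum.cong)
    fix l assume "l \<in> {..<m}"
    then show "v l * X l c = (if l < c then v l else 0) * X l c + (if l = c then v c else 0)"
      using low[of c l] diag[of l] by (cases "l < c"; cases "l = c") auto
  qed simp
  also have "\<dots> = A (\<lambda>l. if l < c then v l else 0) c + v c"
    using assms by (simp add: act_def sum.distrib)
  finally show ?thesis by simp
qed

lemma leadr_trunc:
  assumes "v \<in> L i a c" and "j \<le> c" and "i < j" and "c \<le> m"
  shows "(\<lambda>l. if l < j then v l else 0) \<in> L i a j"
  using assms by (auto simp: leadr_def act_trunc)

lemma act_trunc_fixed:
  assumes "v \<in> L i a c" and "j < c" and "c \<le> m"
  shows "A (\<lambda>l. if l < j then v l else 0) j = 0"
  using assms by (subst act_trunc_next) (auto simp: leadr_def)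

text \<open>The contribution of the differences of two fixed vectors with the same leading entry:
  the cofactor that remains when two characters share row \<open>i\<close>.\<close>

definition Es :: "nat \<Rightarrow> nat \<Rightarrow> 'a \<Rightarrow> complex" where
  "Es i j r = (\<Sum>d\<in>L i 0 j. \<theta> (r * A d j))"

lemma Es_expand:
  assumes "i < j"
  shows "Es i j r = 1 + (\<Sum>l\<in>{i<..<j}. \<Sum>t\<in>UNIV - {0}. Z l j (r * t))"
proof -
  have "(\<Sum>d\<in>L l t j. \<theta> (r * A d j)) = Z l j (r * t)" if "t \<noteq> 0" for l t
    unfolding sum_leadr_scale[OF that] by (simp add: Zs_def act_scale mult.assoc)
  then show ?thesis
    using assms by (simp add: Es_def sum_leadr_zero)
qed

text \<open>A fixed vector reaching beyond column \<open>j\<close> can be cut at \<open>j\<close>,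
  and its image then vanishes at \<open>j\<close>. Taken as base point it contributes no phase, so
  that only differences remain.\<close>

lemma Zs_eq_Es:
  assumes "i < j" and "j < k" and "k \<le> m" and "w \<in> L i 1 k"
  shows "Z i j r = Es i j r"
proof -
  let ?w = "\<lambda>l. if l < j then w l else 0"
  have w: "?w \<in> L i 1 j"
    using assms by (intro leadr_trunc) auto
  have "A ?w j = 0"
    using assms by (intro act_trunc_fixed) auto
  then show ?thesis
    unfolding Zs_def Es_def by (subst sum_leadr_shift[OF w]) (simp only: act_add diff_self add_0)
qed

text \<open>Each summand of \<open>Z i k s\<close> provides the vector beyond column
  \<open>j\<close> that \<open>Zs_eq_Es\<close> requires; if there is none, both sides are
  0.\<close>

lemma Zs_mult_longer:
  assumes "i < j" and "j < k" and "k < m"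
  shows "Z i j r * Z i k s = Z i k s * Es i j r"
proof -
  have "Z i j r * Z i k s = (\<Sum>w\<in>L i 1 k. Z i j r * \<theta> (s * A w k))"
    unfolding Zs_def[of _ _ _ _ k] by (rule sum_distrib_left)
  also have "\<dots> = (\<Sum>w\<in>L i 1 k. Es i j r * \<theta> (s * A w k))"
    using Zs_eq_Es[OF assms(1,2)] assms(3) by (intro sum.cong) auto
  finally show ?thesis
    unfolding Zs_def[of _ _ _ _ k] by (simp add: sum_distrib_left mult.commute)
qed

text \<open>The base point \<open>w\<close> may now have any value at \<open>j\<close>; its phase
  merges with that of the second character into the parameter \<open>r + s\<close>, which may be
  0.\<close>

lemma Zs_mult_same: "Z i j r * Z i j s = Z i j (r + s) * Es i j r"
proof -
  have shift: "Z i j r = \<theta> (r * A w j) * Es i j r" if "w \<in> L i 1 j" for w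
    unfolding Zs_def Es_def
    by (subst sum_leadr_shift[OF that])
       (simp only: act_add diff_self distrib_left char_add sum_distrib_left)
  have "Z i j r * Z i j s = (\<Sum>w\<in>L i 1 j. \<theta> (s * A w j) * Z i j r)"
    unfolding Zs_def[of _ _ _ _ _ s] by (simp add: sum_distrib_left mult.commute)
  also have "\<dots> = (\<Sum>w\<in>L i 1 j. \<theta> ((r + s) * A w j) * Es i j r)"
    by (intro sum.cong refl) (simp add: shift char_add distrib_right)
  finally show ?thesis
    unfolding Zs_def[of _ _ _ _ _ "r + s"] by (simp add: sum_distrib_right)
qed

end

section \<open>Column vectors and the splitting of fixed vectors\<close>

lemma coact_add: "coact m X (\<lambda>k. v k + w k) k = coact m X v k + coact m X w k"
  by (simp add: coact_def sum.distrib algebra_simps)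

lemma coact_point: "c < m \<Longrightarrow> coact m X (\<lambda>l. if l = c then b else 0) k = X k c * b"
  by (simp add: coact_def if_distrib cong: if_cong)

lemma act_point: "c < m \<Longrightarrow> act m X (\<lambda>l. if l = c then b else 0) k = b * X c k"
  by (simp add: act_def if_distrib if_distribR cong: if_cong)

lemma act_coact: "(\<Sum>k<m. v k * coact m X u k) = (\<Sum>k<m. act m X v k * u k)"
  unfolding act_def coact_def sum_distrib_left sum_distrib_right
  by (subst sum.swap) (simp add: mult.assoc)

context unitri
begin

abbreviation "B \<equiv> coact m X"
abbreviation "C \<equiv> leadc m X"

lemma leadr_first:
  assumes "i < m"
  shows "L i a (Suc i) = {\<lambda>l. if l = i then a else 0}"
proof -
  have "L i a (Suc i) \<subseteq> {\<lambda>l. if l = i then a else 0}"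
    by (auto simp: leadr_def fun_eq_iff not_less_eq less_Suc_eq_le Suc_le_eq linorder_neq_iff)
  moreover have "(\<lambda>l. if l = i then a else 0) \<in> L i a (Suc i)"
    using assms diag[of i] low[of _ i] by (auto simp: leadr_def act_point less_Suc_eq)
  ultimately show ?thesis by auto
qed

lemma leadc_first:
  assumes "j < m"
  shows "C j j a = {\<lambda>l. if l = j then a else 0}"
proof -
  have "C j j a \<subseteq> {\<lambda>l. if l = j then a else 0}"
    by (auto simp: leadc_def fun_eq_iff linorder_neq_iff)
  moreover have "(\<lambda>l. if l = j then a else 0) \<in> C j j a"
    using assms diag[of j] low[of j] by (auto simp: leadc_def coact_point)
  ultimately show ?thesis by auto
qed

text \<open>Dropping the last coordinate of a row vector: its value is free, since it only occurs
  in the fixed point equation of its own column, where it cancels.\<close>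

lemma leadr_Suc:
  assumes "i < c" and "c < m"
  shows "bij_betw (\<lambda>(v, a) l. if l = c then a else v l)
    ({v \<in> L i b c. A v c = 0} \<times> UNIV) (L i b (Suc c))"
proof -
  have eq: "A (\<lambda>l. if l = c then a else v l) k = A v k + a * X c k" if "v \<in> L i b c" for v a k
  proof -
    have "v c = 0" using that by (simp add: leadr_def)
    then have "(\<lambda>l. if l = c then a else v l) = (\<lambda>l. v l + (if l = c then a else 0))"
      by auto
    then show ?thesis using assms by (simp only: act_add act_point)
  qed
  show ?thesis
  proof (rule bij_betw_byWitness[where f' = "\<lambda>v. (\<lambda>l. if l < c then v l else 0, v c)"])
    show "\<forall>a\<in>{v \<in> L i b c. A v c = 0} \<times> UNIV.
        (\<lambda>v. (\<lambda>l. if l < c then v l else 0, v c)) ((\<lambda>(v, a) l. if l = c then a else v l) a) = a"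
      by (auto simp: leadr_def fun_eq_iff)
    show "\<forall>a'\<in>L i b (Suc c).
        (\<lambda>(v, a) l. if l = c then a else v l) (\<lambda>l. if l < c then a' l else 0, a' c) = a'"
      by (auto simp: leadr_def fun_eq_iff)
    show "(\<lambda>(v, a) l. if l = c then a else v l) ` ({v \<in> L i b c. A v c = 0} \<times> UNIV)
        \<subseteq> L i b (Suc c)"
    proof clarsimp
      fix v a assume v: "v \<in> L i b c" "A v c = 0"
      have vc: "v c = 0" using v by (simp add: leadr_def)
      show "(\<lambda>l. if l = c then a else v l) \<in> L i b (Suc c)"
        using v assms low[of _ c] diag[of c] eq[OF v(1)]
        by (auto simp: leadr_def less_Suc_eq)
    qed
    show "(\<lambda>v. (\<lambda>l. if l < c then v l else 0, v c)) ` L i b (Suc c)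
        \<subseteq> {v \<in> L i b c. A v c = 0} \<times> UNIV"
      using assms leadr_trunc[of _ i b "Suc c" c] act_trunc_fixed[of _ i b "Suc c" c] by auto
  qed
qed

text \<open>For columns the free coordinate is the topmost one: the rows of \<open>X\<close> below
  \<open>c\<close> have a zero in column \<open>c\<close>, and in the equation at \<open>c\<close>
  it cancels because \<open>X c c = 1\<close>.\<close>

lemma leadc_Suc:
  assumes "Suc c \<le> j" and "j < m"
  shows "bij_betw (\<lambda>(u, a) l. if l = c then a else u l)
    ({u \<in> C (Suc c) j b. B u c = 0} \<times> UNIV) (C c j b)"
proof -
  have eq: "B (\<lambda>l. if l = c then a else u l) k = B u k + X k c * a" if "u c = 0" for u a k
  proof -
    have "(\<lambda>l. if l = c then a else u l) = (\<lambda>l. u l + (if l = c then a else 0))"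
      using that by auto
    then show ?thesis using assms by (simp only: coact_add coact_point)
  qed
  have eq': "B (\<lambda>l. if l = c then 0 else u l) k = B u k - X k c * u c" for u k
  proof -
    have "u = (\<lambda>l. if l = c then u c else (if l = c then 0 else u l))" by auto
    then have "B u k = B (\<lambda>l. if l = c then u c else (if l = c then 0 else u l)) k" by simp
    also have "\<dots> = B (\<lambda>l. if l = c then 0 else u l) k + X k c * u c" by (rule eq) simp
    finally show ?thesis by simp
  qed
  show ?thesis
  proof (rule bij_betw_byWitness[where f' = "\<lambda>u. (\<lambda>l. if l = c then 0 else u l, u c)"])
    show "\<forall>a\<in>{u \<in> C (Suc c) j b. B u c = 0} \<times> UNIV.
        (\<lambda>u. (\<lambda>l. if l = c then 0 else u l, u c)) ((\<lambda>(u, a) l. if l = c then a else u l) a) = a"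
      by (auto simp: leadc_def fun_eq_iff)
    show "\<forall>a'\<in>C c j b.
        (\<lambda>(u, a) l. if l = c then a else u l) (\<lambda>l. if l = c then 0 else a' l, a' c) = a'"
      by (auto simp: fun_eq_iff)
    show "(\<lambda>(u, a) l. if l = c then a else u l) ` ({u \<in> C (Suc c) j b. B u c = 0} \<times> UNIV)
        \<subseteq> C c j b"
    proof clarsimp
      fix u a assume u: "u \<in> C (Suc c) j b" "B u c = 0"
      have uc: "u c = 0" using u by (simp add: leadc_def)
      show "(\<lambda>l. if l = c then a else u l) \<in> C c j b"
        using u assms low[of c] diag[of c]
        by (auto simp: leadc_def eq[of u, OF uc] le_eq_less_or_eq[of c] Suc_le_eq)
    qed
    show "(\<lambda>u. (\<lambda>l. if l = c then 0 else u l, u c)) ` C c j b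
        \<subseteq> {u \<in> C (Suc c) j b. B u c = 0} \<times> UNIV"
      using assms low[of c] diag[of c]
      by (auto simp: leadc_def eq' le_eq_less_or_eq[of c] Suc_le_eq)
  qed
qed

text \<open>Orthogonality of characters: the sum over all \<open>t\<close> is the field size times
  the number of \<open>v\<close> with \<open>A v c = 0\<close>. These \<open>v\<close> are the ones
  that extend through column \<open>c\<close>, each in as many ways as there are field
  elements.\<close>

lemma card_leadr_Suc:
  assumes "i < c" and "c < m"
  shows "of_nat (card (L i 1 (Suc c))) = (\<Sum>t\<in>UNIV. Z i c t)"
proof -
  have "(\<Sum>t\<in>UNIV. Z i c t) = (\<Sum>v\<in>L i 1 c. \<Sum>t\<in>UNIV. \<theta> (t * A v c))"
    unfolding Zs_def by (rule sum.swap)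
  also have "\<dots> = (\<Sum>v\<in>{v \<in> L i 1 c. A v c = 0}. of_nat (card (UNIV :: 'a set)))"
    unfolding char_sum by (rule sum.inter_filter[symmetric]) simp
  also have "\<dots> = of_nat (card ({v \<in> L i 1 c. A v c = 0} \<times> (UNIV :: 'a set)))"
    by (simp add: card_cartesian_product)
  also have "\<dots> = of_nat (card (L i 1 (Suc c)))"
    using bij_betw_same_card[OF leadr_Suc[OF assms]] by simp
  finally show ?thesis by simp
qed

lemma Zs_zero: "Z i j 0 = of_nat (card (L i 1 j))"
  by (simp add: Zs_def)

text \<open>Telescoping of \<open>card_leadr_Suc\<close>, starting from the single vector supported
  at \<open>i\<close>. It expresses the parameter 0, which belongs to no supercharacter, by nonzero
  ones.\<close>

lemma Zs_zero_expand:
  assumes "i < j" and "j \<le> m"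
  shows "Z i j 0 = 1 + (\<Sum>l\<in>{i<..<j}. \<Sum>t\<in>UNIV - {0}. Z i l t)"
  using assms
proof (induction j)
  case (Suc j)
  show ?case
  proof (cases "i = j")
    case True
    then have "{i<..<Suc j} = {}" by auto
    with True Suc.prems show ?thesis
      by (simp add: Zs_zero leadr_first)
  next
    case False
    then have "{i<..<Suc j} = insert j {i<..<j}" using Suc.prems by auto
    moreover have "Z i (Suc j) 0 = Z i j 0 + (\<Sum>t\<in>UNIV - {0}. Z i j t)"
      using False Suc.prems card_leadr_Suc[of i j]
      by (simp add: Zs_zero[of i "Suc j"] sum.remove[of UNIV 0])
    ultimately show ?thesis
      using Suc False by (simp add: algebra_simps)
  qed
qed simp

text \<open>The fixed vectors may be split at any \<open>c\<close> into a row part and a column part; \<open>c = j\<close> is the row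
  formula defining \<open>Zs\<close>, and \<open>c = i + 1\<close> is its column analogue.\<close>

definition mixed :: "nat \<Rightarrow> nat \<Rightarrow> 'a \<Rightarrow> nat \<Rightarrow> complex" where
  "mixed i j r c = (\<Sum>v\<in>L i 1 c. \<Sum>u\<in>C c j r. \<theta> (\<Sum>k<m. v k * B u k))"

text \<open>The free coordinate at \<open>c\<close> belongs to the row vector on one side and to the
  column vector on the other. Summing over it imposes on the opposite vector the condition at
  \<open>c\<close> by orthogonality, so both sides are the field size times the same sum
  \<open>S\<close>.\<close>

lemma mixed_Suc:
  assumes "i < c" and "Suc c \<le> j" and "j < m"
  shows "mixed i j r (Suc c) = mixed i j r c"
proof -
  let ?L = "{v \<in> L i 1 c. A v c = 0}" and ?C = "{u \<in> C (Suc c) j r. B u c = 0}"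
  let ?q = "of_nat (card (UNIV :: 'a set)) :: complex"
  define S where "S = (\<Sum>v\<in>?L. \<Sum>u\<in>?C. \<theta> (\<Sum>k<m. v k * B u k))"
  have c: "c < m" using assms by simp
  have "mixed i j r (Suc c) = (\<Sum>(v, a)\<in>?L \<times> UNIV. \<Sum>u\<in>C (Suc c) j r.
      \<theta> (\<Sum>k<m. (if k = c then a else v k) * B u k))"
    unfolding mixed_def sum.reindex_bij_betw[OF leadr_Suc[OF assms(1) c], symmetric]
    by (simp add: case_prod_unfold)
  also have "\<dots> = (\<Sum>(v, a)\<in>?L \<times> UNIV. \<Sum>u\<in>C (Suc c) j r.
      \<theta> (\<Sum>k<m. v k * B u k) * \<theta> (a * B u c))"
  proof (intro sum.cong refl, clarify, rule sum.cong)
    fix v a u assume "v \<in> L i 1 c"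
    then have "v c = 0" by (simp add: leadr_def)
    then have "(\<Sum>k<m. (if k = c then a else v k) * B u k) =
        (\<Sum>k<m. v k * B u k + (if k = c then a * B u k else 0))"
      by (intro sum.cong) auto
    then show "\<theta> (\<Sum>k<m. (if k = c then a else v k) * B u k) =
        \<theta> (\<Sum>k<m. v k * B u k) * \<theta> (a * B u c)"
      using c by (simp add: sum.distrib char_add)
  qed simp
  also have "\<dots> = (\<Sum>v\<in>?L. \<Sum>u\<in>C (Suc c) j r. \<theta> (\<Sum>k<m. v k * B u k) * (\<Sum>a\<in>UNIV. \<theta> (a * B u c)))"
    unfolding sum.cartesian_product[symmetric]
    by (intro sum.cong refl, subst sum.swap) (simp add: sum_distrib_left)
  also have "\<dots> = (\<Sum>v\<in>?L. \<Sum>u\<in>C (Suc c) j r. if B u c = 0 then \<theta> (\<Sum>k<m. v k * B u k) * ?q else 0)"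
    by (intro sum.cong refl) (simp add: char_sum)
  also have "\<dots> = S * ?q"
    unfolding S_def sum_distrib_right by (intro sum.cong refl sum.inter_filter[symmetric]) simp
  finally have 1: "mixed i j r (Suc c) = S * ?q" .
  \<comment> \<open>The pairing is rewritten with \<open>X\<close> acting on the row, so that the
    free coordinate \<open>a\<close> of the column multiplies \<open>A v c\<close>.\<close>
  have "mixed i j r c = (\<Sum>v\<in>L i 1 c. \<Sum>(u, a)\<in>?C \<times> UNIV.
      \<theta> (\<Sum>k<m. A v k * (if k = c then a else u k)))"
    unfolding mixed_def act_coact sum.reindex_bij_betw[OF leadc_Suc[OF assms(2,3)], symmetric]
    by (simp add: case_prod_unfold)
  also have "\<dots> = (\<Sum>v\<in>L i 1 c. \<Sum>(u, a)\<in>?C \<times> UNIV. \<theta> (\<Sum>k<m. v k * B u k) * \<theta> (a * A v c))"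
  proof (intro sum.cong refl, clarify)
    fix v a u assume "u \<in> C (Suc c) j r"
    then have "u c = 0" by (simp add: leadc_def)
    then have "(\<Sum>k<m. A v k * (if k = c then a else u k)) =
        (\<Sum>k<m. A v k * u k + (if k = c then a * A v k else 0))"
      by (intro sum.cong) auto
    then show "\<theta> (\<Sum>k<m. A v k * (if k = c then a else u k)) =
        \<theta> (\<Sum>k<m. v k * B u k) * \<theta> (a * A v c)"
      using c by (simp add: sum.distrib char_add act_coact)
  qed
  also have "\<dots> = (\<Sum>v\<in>L i 1 c. \<Sum>u\<in>?C. \<theta> (\<Sum>k<m. v k * B u k) * (\<Sum>a\<in>UNIV. \<theta> (a * A v c)))"
    unfolding sum.cartesian_product[symmetric] by (simp add: sum_distrib_left)
  also have "\<dots> = (\<Sum>v\<in>L i 1 c. if A v c = 0 then (\<Sum>u\<in>?C. \<theta> (\<Sum>k<m. v k * B u k)) * ?q else 0)"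
    by (intro sum.cong refl) (simp add: char_sum sum_distrib_right)
  also have "\<dots> = S * ?q"
    unfolding S_def sum_distrib_right[of _ ?L] by (intro sum.inter_filter[symmetric]) simp
  finally show ?thesis using 1 by simp
qed

lemma Zs_mixed:
  assumes "i < c" and "c \<le> j" and "j < m"
  shows "Z i j r = mixed i j r c"
proof -
  have "mixed i j r j = mixed i j r c"
    using assms(2)
  proof (induction rule: inc_induct)
    case (step k)
    then show ?case using assms mixed_Suc[of i k j r] by simp
  qed simp
  moreover have "Z i j r = mixed i j r j"
  proof -
    have "(\<Sum>k<m. w k * (if k = j then r else 0)) = r * w j" for w :: "nat \<Rightarrow> 'a"
      using assms(3) by (simp add: if_distrib cong: if_cong)
    then show ?thesis
      using assms(3) by (simp add: mixed_def Zs_def leadc_first act_coact)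
  qed
  ultimately show ?thesis by (rule trans[rotated])
qed

end

section \<open>Matrices preserving a form\<close>

lemma sum_reflect: "(\<Sum>k<m. f k) = (\<Sum>k<m. f (m - 1 - k))" for m :: nat
  by (rule sum.reindex_bij_witness[where i = "\<lambda>k. m - 1 - k" and j = "\<lambda>k. m - 1 - k"]) auto

text \<open>The assumption \<open>form\<close> is the matrix equation X F X^T = F for the
  antidiagonal matrix F with entries \<open>s k\<close>.\<close>

locale isometry = unitri +
  fixes s :: "nat \<Rightarrow> 'a"
  assumes sign: "k < m \<Longrightarrow> s k * s k = 1"
    and form: "\<lbrakk>a < m; b < m\<rbrakk> \<Longrightarrow>
      (\<Sum>k<m. X a k * s k * X b (m - 1 - k)) = (if a + b + 1 = m then s a else 0)"
begin

definition bf :: "(nat \<Rightarrow> 'a) \<Rightarrow> (nat \<Rightarrow> 'a) \<Rightarrow> 'a" where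
  "bf v w = (\<Sum>k<m. v k * s k * w (m - 1 - k))"

lemma bf_act: "bf (A v) (A w) = bf v w"
proof -
  have "bf (A v) (A w) =
      (\<Sum>k<m. \<Sum>a<m. \<Sum>b<m. v a * w b * (X a k * s k * X b (m - 1 - k)))"
    unfolding bf_def act_def
    by (simp add: sum_distrib_left sum_distrib_right algebra_simps)
       (subst sum.swap, simp)
  also have "\<dots> = (\<Sum>a<m. \<Sum>b<m. v a * w b * (\<Sum>k<m. X a k * s k * X b (m - 1 - k)))"
    unfolding sum_distrib_left
    by (rule trans[OF sum.swap], rule sum.cong[OF refl], rule sum.swap)
  also have "\<dots> = (\<Sum>a<m. \<Sum>b<m. if b = m - 1 - a then v a * w b * s a else 0)"
    by (intro sum.cong refl, subst form) auto
  also have "\<dots> = bf v w"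
    unfolding bf_def by (intro sum.cong refl) (simp add: mult.assoc mult.left_commute mult.commute)
  finally show ?thesis .
qed

lemma bf_add_right: "bf v (\<lambda>k. w k + w' k) = bf v w + bf v w'"
  by (simp add: bf_def sum.distrib algebra_simps)

lemma bf_diff_right: "bf v (\<lambda>k. w k - w' k) = bf v w - bf v w'"
  by (simp add: bf_def sum_subtractf algebra_simps)

lemma bf_row_act:
  assumes "a < m"
  shows "bf (X a) (A w) = s a * w (m - 1 - a)"
proof -
  let ?e = "\<lambda>l. if l = a then 1 else 0 :: 'a"
  have "A ?e = X a"
    using assms by (simp add: act_point fun_eq_iff)
  then have "bf (X a) (A w) = bf (A ?e) (A w)"
    by simp
  also have "\<dots> = bf ?e w"
    by (rule bf_act)
  also have "\<dots> = s a * w (m - 1 - a)"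
    using assms by (simp add: bf_def if_distrib if_distribR cong: if_cong)
  finally show ?thesis .
qed

text \<open>Chosen so that \<open>bf v (dual u)\<close> is the ordinary product of the row
  \<open>v\<close> with the column \<open>u\<close>.\<close>

definition dual :: "(nat \<Rightarrow> 'a) \<Rightarrow> nat \<Rightarrow> 'a" where
  "dual u k = (if k < m then s (m - 1 - k) * u (m - 1 - k) else 0)"

lemma coact_dual: "B u k = bf (X k) (dual u)"
  unfolding coact_def bf_def
  by (rule sum.cong) (auto simp: dual_def sign mult.assoc simp flip: mult.assoc[of "s _"])

text \<open>Since \<open>X\<close> preserves the form, pairing row \<open>k\<close> with
  \<open>A (dual u)\<close> gives back \<open>u k\<close>. So the defect of \<open>u\<close> as a
  fixed column is the defect of \<open>dual u\<close> as a fixed row, seen through the rows of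
  \<open>X\<close>.\<close>

lemma coact_dual_defect:
  assumes "k < m"
  shows "B u k = u k - bf (X k) (\<lambda>l. A (dual u) l - dual u l)"
  using assms bf_row_act[of k "dual u"]
  by (simp add: coact_dual bf_diff_right) (simp add: dual_def sign flip: mult.assoc)

lemma bf_row_vanish:
  assumes "a < m" and "\<And>k. k < m - 1 - a \<Longrightarrow> \<rho> k = 0"
  shows "bf (X a) \<rho> = s a * \<rho> (m - 1 - a)"
proof -
  have "bf (X a) \<rho> = (\<Sum>k<m. if k = a then s a * \<rho> (m - 1 - a) else 0)"
    unfolding bf_def
  proof (rule sum.cong)
    fix k assume k: "k \<in> {..<m}"
    consider "k < a" | "k = a" | "k > a" by linarith
    then show "X a k * s k * \<rho> (m - 1 - k) = (if k = a then s a * \<rho> (m - 1 - a) else 0)"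
      using assms(1) k low diag assms(2)[of "m - 1 - k"] by cases auto
  qed simp
  then show ?thesis using assms(1) by simp
qed

text \<open>The relation between the two defects is triangular: once the row defect is known to
  vanish before \<open>k\<close>, row \<open>m - 1 - k\<close> of \<open>X\<close> sees just its
  value at \<open>k\<close>. Hence the equations from \<open>c\<close> on for the column match those
  before \<open>m - c\<close> for the row.\<close>

lemma leadc_iff_dual:
  assumes "c \<le> j" and "j < m" and "\<And>k. k < c \<or> j < k \<Longrightarrow> u k = 0"
  shows "(\<forall>k. c \<le> k \<and> k < m \<longrightarrow> B u k = u k) \<longleftrightarrow> (\<forall>k < m - c. A (dual u) k = dual u k)"
proof -
  define \<rho> where "\<rho> = (\<lambda>l. A (dual u) l - dual u l)"
  have B: "B u k = u k \<longleftrightarrow> bf (X k) \<rho> = 0" if "k < m" for k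
    using coact_dual_defect[OF that] by (auto simp: \<rho>_def)
  have s: "s k \<noteq> 0" if "k < m" for k
    using sign[OF that] by auto
  have "(\<forall>k. c \<le> k \<and> k < m \<longrightarrow> bf (X k) \<rho> = 0) \<longleftrightarrow> (\<forall>k < m - c. \<rho> k = 0)"
  proof
    assume *: "\<forall>k. c \<le> k \<and> k < m \<longrightarrow> bf (X k) \<rho> = 0"
    show "\<forall>k < m - c. \<rho> k = 0"
    proof (intro allI impI)
      fix k show "k < m - c \<Longrightarrow> \<rho> k = 0"
      proof (induction k rule: less_induct)
        case (less k)
        then show ?case
          using bf_row_vanish[of "m - 1 - k" \<rho>] *[rule_format, of "m - 1 - k"] s[of "m - 1 - k"]
          by auto
      qed
    qed
  next
    assume "\<forall>k < m - c. \<rho> k = 0"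
    then show "\<forall>k. c \<le> k \<and> k < m \<longrightarrow> bf (X k) \<rho> = 0"
      using bf_row_vanish[of _ \<rho>] by auto
  qed
  then show ?thesis using B by (auto simp: \<rho>_def)
qed

lemma dual_dual: "k < m \<Longrightarrow> s k * dual u (m - Suc k) = u k"
  by (simp add: dual_def sign flip: mult.assoc)

lemma sum_leadc_dual:
  assumes "c \<le> j" and "j < m"
  shows "(\<Sum>u\<in>C c j r. F (dual u)) = (\<Sum>w\<in>L (m - 1 - j) (s j * r) (m - c). F w)"
proof (rule sum.reindex_bij_witness[where j = dual
      and i = "\<lambda>w k. if k < m then s k * w (m - 1 - k) else 0"])
  fix u assume u: "u \<in> C c j r"
  then have supp: "k < c \<or> j < k \<Longrightarrow> u k = 0" for k
    by (auto simp: leadc_def)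
  show "(\<lambda>k. if k < m then s k * dual u (m - 1 - k) else 0) = u"
    using supp assms by (auto simp: dual_dual fun_eq_iff)
  have "\<forall>k < m - c. A (dual u) k = dual u k"
    using leadc_iff_dual[of c j u, OF assms supp] u by (auto simp: leadc_def)
  then show "dual u \<in> L (m - 1 - j) (s j * r) (m - c)"
    using u assms by (auto simp: leadr_def leadc_def dual_def)
next
  fix w assume w: "w \<in> L (m - 1 - j) (s j * r) (m - c)"
  let ?u = "\<lambda>k. if k < m then s k * w (m - 1 - k) else 0"
  show d: "dual ?u = w"
    using w assms by (auto simp: dual_def fun_eq_iff leadr_def sign simp flip: mult.assoc)
  have supp: "k < c \<or> j < k \<Longrightarrow> ?u k = 0" for k
    using w assms by (auto simp: leadr_def)
  have "\<forall>k. c \<le> k \<and> k < m \<longrightarrow> B ?u k = ?u k"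
    using leadc_iff_dual[of c j ?u, OF assms supp] w by (auto simp: leadr_def d)
  moreover have "?u j = r"
    using w assms by (auto simp: leadr_def sign simp flip: mult.assoc)
  ultimately show "?u \<in> C c j r"
    using supp by (auto simp: leadc_def)
qed simp

text \<open>With the splitting right after \<open>i\<close>, the row part is the unit vector at
  \<open>i\<close> and the sum runs over columns. The factor \<open>s j\<close> is in the leading
  entry of the dual vector, \<open>s i\<close> comes from row \<open>i\<close>, and the minus sign
  from the defect formula.\<close>

lemma Zs_dual:
  assumes "i < j" and "j < m" and "r \<noteq> 0"
  shows "Z i j r = Z (m - 1 - j) (m - 1 - i) (- (s i * s j * r))"
proof -
  have nz: "s j * r \<noteq> 0"
    using sign[of j] assms by auto
  have "Z i j r = (\<Sum>u\<in>C (Suc i) j r. \<theta> (B u i))"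
    using assms
    by (simp add: Zs_mixed[of i "Suc i"] mixed_def leadr_first if_distribR cong: if_cong)
       (simp add: if_distrib if_distribR cong: if_cong)
  also have "\<dots> = (\<Sum>u\<in>C (Suc i) j r. \<theta> (- (s i * A (dual u) (m - 1 - i))))"
  proof (intro sum.cong refl)
    fix u assume u: "u \<in> C (Suc i) j r"
    then have supp: "k < Suc i \<or> j < k \<Longrightarrow> u k = 0" for k
      by (auto simp: leadc_def)
    have "A (dual u) k - dual u k = 0" if "k < m - 1 - i" for k
      using leadc_iff_dual[of "Suc i" j u, OF _ _ supp] u that assms by (auto simp: leadc_def)
    then have "B u i = u i - s i * (A (dual u) (m - 1 - i) - dual u (m - 1 - i))"
      using assms by (subst coact_dual_defect) (auto simp: bf_row_vanish)
    moreover have "u i = 0" "dual u (m - 1 - i) = 0"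
      using supp[of i] assms by (auto simp: dual_def)
    ultimately show "\<theta> (B u i) = \<theta> (- (s i * A (dual u) (m - 1 - i)))"
      by simp
  qed
  also have "\<dots> = (\<Sum>w\<in>L (m - 1 - j) (s j * r) (m - Suc i). \<theta> (- (s i * A w (m - 1 - i))))"
    using assms by (intro sum_leadc_dual[where F = "\<lambda>w. \<theta> (- (s i * A w (m - 1 - i)))"]) auto
  also have "\<dots> = Z (m - 1 - j) (m - 1 - i) (- (s i * s j * r))"
    unfolding sum_leadr_scale[OF nz] act_scale using assms
    by (simp add: Zs_def mult.assoc)
  finally show ?thesis .
qed

text \<open>The part of the form that pairs \<open>v X\<close> from column \<open>n\<close> on with
  the first \<open>m - n\<close> coordinates of \<open>w\<close>. The sign is left out, since it is
  constant on these columns wherever \<open>bq\<close> is used.\<close>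

definition bq :: "nat \<Rightarrow> (nat \<Rightarrow> 'a) \<Rightarrow> (nat \<Rightarrow> 'a) \<Rightarrow> 'a" where
  "bq n v w = (\<Sum>k\<in>{n..<m}. A v k * w (m - 1 - k))"

text \<open>Splitting at \<open>n\<close> and dualizing the column part gives a second row vector
  that starts at \<open>m - 1 - j\<close> and is cut at \<open>m - n\<close>. Rescaling its leading
  entry \<open>s j * r\<close> to 1 brings in the sign \<open>\<sigma>\<close> a second time, and
  \<open>\<sigma> * \<sigma> = 1\<close>.\<close>

lemma Zs_pair:
  assumes "i < n" and "n \<le> j" and "j < m" and "r \<noteq> 0"
    and \<sigma>: "\<And>k. n \<le> k \<Longrightarrow> k < m \<Longrightarrow> s k = \<sigma>"
  shows "Z i j r = (\<Sum>v\<in>L i 1 n. \<Sum>w\<in>L (m - 1 - j) 1 (m - n). \<theta> (r * bq n v w))"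
proof -
  have "\<sigma> * \<sigma> = 1" using sign[of j] \<sigma>[of j] assms by simp
  then have nz: "s j * r \<noteq> 0" using assms \<sigma>[of j] by auto
  have "(\<Sum>u\<in>C n j r. \<theta> (\<Sum>k<m. v k * B u k)) =
      (\<Sum>w\<in>L (m - 1 - j) 1 (m - n). \<theta> (r * bq n v w))" for v
  proof -
    have "(\<Sum>k<m. v k * B u k) = \<sigma> * bq n v (dual u)" if "u \<in> C n j r" for u
    proof -
      have "(\<Sum>k<m. A v k * u k) = (\<Sum>k\<in>{n..<m}. A v k * u k)"
        using that by (intro sum.mono_neutral_right) (auto simp: leadc_def)
      also have "\<dots> = (\<Sum>k\<in>{n..<m}. \<sigma> * (A v k * dual u (m - 1 - k)))"
      proof (intro sum.cong refl)
        fix k assume "k \<in> {n..<m}"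
        then show "A v k * u k = \<sigma> * (A v k * dual u (m - 1 - k))"
          using dual_dual[of k u] \<sigma>[of k] by (simp add: mult.left_commute)
      qed
      finally show ?thesis by (simp add: act_coact bq_def sum_distrib_left)
    qed
    then have "(\<Sum>u\<in>C n j r. \<theta> (\<Sum>k<m. v k * B u k)) = (\<Sum>u\<in>C n j r. \<theta> (\<sigma> * bq n v (dual u)))"
      by simp
    also have "\<dots> = (\<Sum>w\<in>L (m - 1 - j) (s j * r) (m - n). \<theta> (\<sigma> * bq n v w))"
      using assms by (intro sum_leadc_dual[where F = "\<lambda>w. \<theta> (\<sigma> * bq n v w)"]) auto
    also have "\<dots> = (\<Sum>w\<in>L (m - 1 - j) 1 (m - n). \<theta> (\<sigma> * bq n v (\<lambda>k. s j * r * w k)))"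
      by (rule sum_leadr_scale[OF nz])
    also have "\<dots> = (\<Sum>w\<in>L (m - 1 - j) 1 (m - n). \<theta> (r * bq n v w))"
    proof (intro sum.cong refl)
      fix w
      have "\<sigma> * bq n v (\<lambda>k. s j * r * w k) = \<sigma> * (\<sigma> * r * bq n v w)"
        using \<sigma>[of j] assms by (simp add: bq_def sum_distrib_left algebra_simps)
      also have "\<dots> = \<sigma> * \<sigma> * (r * bq n v w)"
        by (simp only: mult.assoc)
      finally show "\<theta> (\<sigma> * bq n v (\<lambda>k. s j * r * w k)) = \<theta> (r * bq n v w)"
        by (simp add: \<open>\<sigma> * \<sigma> = 1\<close>)
    qed
    finally show ?thesis .
  qed
  then show ?thesis
    using assms by (simp add: Zs_mixed[of i n] mixed_def)
qed

text \<open>The quadratic form of \<open>v\<close> and of \<open>v X\<close> differ by twice the entry \<open>(v X)\<^sub>-\<^sub>i\<close>.\<close>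

lemma Zs_middle_orthogonal:
  assumes "\<And>k. s k = 1" and "(2 :: 'a) \<noteq> 0" and "2 * i + 1 < m"
  shows "Z i (m - 1 - i) r = Z i (m - 1 - i) 0"
proof -
  have "A v (m - 1 - i) = 0" if v: "v \<in> L i 1 (m - 1 - i)" for v
  proof -
    define \<rho> where "\<rho> k = A v k - v k" for k
    have A: "A v = (\<lambda>k. v k + \<rho> k)" by (simp add: \<rho>_def)
    have \<rho>: "\<rho> k = 0" if "k < m - 1 - i" for k
      using v that by (auto simp: \<rho>_def leadr_def)
    have sym: "bf w w' = bf w' w" for w w'
      unfolding bf_def by (subst sum_reflect) (simp add: assms mult.commute)
    have "bf (A v) (A v) = bf v v + 2 * bf v \<rho> + bf \<rho> \<rho>"
      unfolding A bf_add_right sym[of "\<lambda>k. v k + \<rho> k"] by (simp add: sym algebra_simps)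
    moreover have "bf \<rho> \<rho> = 0"
      unfolding bf_def
    proof (intro sum.neutral ballI)
      fix k assume "k \<in> {..<m}"
      then have "k < m - 1 - i \<or> m - 1 - k < m - 1 - i"
        using assms(3) by auto
      then show "\<rho> k * s k * \<rho> (m - 1 - k) = 0"
        using \<rho> by auto
    qed
    moreover have "bf v \<rho> = (\<Sum>k<m. if k = i then \<rho> (m - 1 - i) else 0)"
      unfolding bf_def
    proof (rule sum.cong)
      fix k assume "k \<in> {..<m}"
      then show "v k * s k * \<rho> (m - 1 - k) = (if k = i then \<rho> (m - 1 - i) else 0)"
        using v \<rho>[of "m - 1 - k"] assms by (cases rule: linorder_cases[of k i]) (auto simp: leadr_def)
    qed simp
    ultimately have "2 * \<rho> (m - 1 - i) = 0"
      using assms(3) by (simp add: bf_act)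
    then show ?thesis
      using v assms by (auto simp: \<rho>_def leadr_def)
  qed
  then show ?thesis by (simp add: Zs_def)
qed

end

context isometry
begin

lemma bq_comb_left: "bq n (\<lambda>k. v k + c * w k) x = bq n v x + c * bq n w x"
  by (simp add: bq_def act_add act_scale sum.distrib sum_distrib_left algebra_simps)

lemma bq_comb_right: "bq n x (\<lambda>k. v k + c * w k) = bq n x v + c * bq n x w"
  by (simp add: bq_def sum.distrib sum_distrib_left algebra_simps)

lemma bq_zero [simp]: "bq n v (\<lambda>_. 0) = 0" "bq n (\<lambda>_. 0) v = 0"
  by (simp_all add: bq_def)

lemma bq_scale: "bq n (\<lambda>k. c * v k) w = c * bq n v w" "bq n w (\<lambda>k. c * v k) = c * bq n w v"
  using bq_comb_left[of n "\<lambda>_. 0" c v w] bq_comb_right[of n w "\<lambda>_. 0" c v] by auto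

lemma sum_leadr_translate:
  assumes "e \<in> L i 0 c"
  shows "(\<Sum>v\<in>L i a c. F v) = (\<Sum>v\<in>L i a c. F (\<lambda>k. v k + b * e k))"
  using sum_leadr_shift[OF leadr_scale[OF assms, of b], of F a] by (simp add: add.commute)

text \<open>The factor 1 gives the translated vector the shape in which \<open>bq_comb_left\<close>
  and \<open>bq_comb_right\<close> expand.\<close>

lemma sum_leadr_difference:
  "(\<Sum>v\<in>L i 1 c. \<Sum>w\<in>L i 1 c. F v w) = (\<Sum>d\<in>L i 0 c. \<Sum>v\<in>L i 1 c. F v (\<lambda>k. v k + 1 * d k))"
proof -
  have "(\<Sum>w\<in>L i 1 c. F v w) = (\<Sum>d\<in>L i 0 c. F v (\<lambda>k. v k + 1 * d k))" if "v \<in> L i 1 c" for v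
    by (subst sum_leadr_shift[OF that]) simp
  then have "(\<Sum>v\<in>L i 1 c. \<Sum>w\<in>L i 1 c. F v w)
      = (\<Sum>v\<in>L i 1 c. \<Sum>d\<in>L i 0 c. F v (\<lambda>k. v k + 1 * d k))"
    by (rule sum.cong[OF refl])
  also have "\<dots> = (\<Sum>d\<in>L i 0 c. \<Sum>v\<in>L i 1 c. F v (\<lambda>k. v k + 1 * d k))"
    by (rule sum.swap)
  finally show ?thesis .
qed

end

section \<open>The symplectic case\<close>

locale symplectic_isometry = isometry +
  fixes n :: nat
  assumes m: "m = 2 * n"
    and s: "s k = (if k < n then 1 else - 1)"
    and two: "(2 :: 'a) \<noteq> 0"
begin

abbreviation "\<beta> \<equiv> bq n"

lemma four: "(4 :: 'a) \<noteq> 0"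
  using no_zero_divisors[OF two two] by simp

text \<open>Vectors supported in the first half are orthogonal, hence so are their images under
  \<open>X\<close>. The two halves of this vanishing sum are \<open>\<beta> w v\<close> and
  \<open>- \<beta> v w\<close>: the sign change of the alternating form in the middle makes
  \<open>\<beta>\<close> symmetric.\<close>

lemma bq_sym:
  assumes v: "v \<in> L i a n" and w: "w \<in> L j b n"
  shows "\<beta> w v = \<beta> v w"
proof -
  have "(\<Sum>k<m. v k * s k * w (m - 1 - k)) = 0"
  proof (intro sum.neutral ballI)
    fix k assume "k \<in> {..<m}"
    then have "n \<le> k \<or> n \<le> m - 1 - k" by (auto simp: m)
    then show "v k * s k * w (m - 1 - k) = 0"
      using v w by (auto simp: leadr_def)
  qed
  then have "0 = bf (A v) (A w)"
    by (simp add: bf_act) (simp add: bf_def)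
  also have "\<dots> = (\<Sum>k\<in>{..<n}. v k * A w (m - 1 - k)) + (\<Sum>k\<in>{n..<m}. - (A v k * w (m - 1 - k)))"
  proof -
    have "{..<m} = {..<n} \<union> {n..<m}" by (auto simp: m)
    then have "bf (A v) (A w) = (\<Sum>k\<in>{..<n}. A v k * s k * A w (m - 1 - k))
        + (\<Sum>k\<in>{n..<m}. A v k * s k * A w (m - 1 - k))"
      unfolding bf_def by (simp add: sum.union_disjoint ivl_disj_int)
    also have "(\<Sum>k\<in>{..<n}. A v k * s k * A w (m - 1 - k)) = (\<Sum>k\<in>{..<n}. v k * A w (m - 1 - k))"
      using v by (intro sum.cong) (auto simp: s leadr_def)
    also have "(\<Sum>k\<in>{n..<m}. A v k * s k * A w (m - 1 - k)) =
        (\<Sum>k\<in>{n..<m}. - (A v k * w (m - 1 - k)))"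
      using w by (intro sum.cong) (auto simp: s leadr_def m)
    finally show ?thesis .
  qed
  also have "(\<Sum>k\<in>{..<n}. v k * A w (m - 1 - k)) = \<beta> w v"
    unfolding bq_def
    by (rule sum.reindex_bij_witness[where i = "\<lambda>k. m - 1 - k" and j = "\<lambda>k. m - 1 - k"])
       (auto simp: m)
  finally show ?thesis by (simp add: sum_negf bq_def)
qed

definition Q :: "nat \<Rightarrow> 'a \<Rightarrow> complex" where
  "Q i r = (\<Sum>v\<in>L i 1 n. \<theta> (r * \<beta> v v))"

text \<open>The cofactor left by completing a square, playing the part that \<open>Es\<close> has
  for linear phases.\<close>

definition T :: "nat \<Rightarrow> 'a \<Rightarrow> complex" where
  "T i r = (\<Sum>d\<in>L i 0 n. \<theta> (r * \<beta> d d))"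

text \<open>Scaling to leading entry 1 multiplies the quadratic form by \<open>t * t\<close>, so the
  parameters stay in the square class of \<open>r\<close>.\<close>

lemma T_expand:
  assumes "i < n"
  shows "T i r = 1 + (\<Sum>l\<in>{i<..<n}. \<Sum>t\<in>UNIV - {0}. Q l (r * (t * t)))"
proof -
  have "(\<Sum>d\<in>L l t n. \<theta> (r * \<beta> d d)) = Q l (r * (t * t))" if "t \<noteq> 0" for l t
    unfolding sum_leadr_scale[OF that] Q_def by (simp add: bq_scale mult.assoc)
  then show ?thesis
    unfolding T_def sum_leadr_zero[OF assms] by simp
qed

lemma Z_plus:
  assumes "i < n" and "j < n" and "r \<noteq> 0"
  shows "Z i (m - 1 - j) r = (\<Sum>v\<in>L i 1 n. \<Sum>w\<in>L j 1 n. \<theta> (r * \<beta> v w))"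
  using assms by (subst Zs_pair[where n = n and \<sigma> = "-1"]) (auto simp: m s)

text \<open>The difference \<open>d = 0\<close> contributes the number of vectors \<open>u\<close>,
  which is \<open>Z j n 0\<close>.\<close>

lemma sum_pair_expand:
  assumes "i < n" and "j < n" and "r \<noteq> 0"
  shows "(\<Sum>d\<in>L i 0 n. \<Sum>u\<in>L j 1 n. \<theta> (r * \<beta> d u)) =
    Z j n 0 + (\<Sum>l\<in>{i<..<n}. \<Sum>t\<in>UNIV - {0}. Z l (m - 1 - j) (r * t))"
proof -
  have "(\<Sum>d\<in>L l t n. \<Sum>u\<in>L j 1 n. \<theta> (r * \<beta> d u)) = Z l (m - 1 - j) (r * t)"
    if "t \<noteq> 0" "l < n" for l t
    unfolding sum_leadr_scale[OF that(1)]
    using that assms by (subst Z_plus) (auto simp: bq_scale mult.assoc)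
  then show ?thesis
    unfolding sum_leadr_zero[OF assms(1)] by (simp add: Zs_zero)
qed

text \<open>Polarization: both half vectors start at \<open>i\<close>, and \<beta>(v, v + d) becomes
  \<beta>(v, v) - \<beta>(d, d)/4 after \<open>v\<close> is replaced by v - d/2.\<close>

lemma Zs_middle_symplectic:
  assumes "i < n" and "r \<noteq> 0"
  shows "Z i (m - 1 - i) r = Q i r * T i (- (r / 4))"
proof -
  define h where "h = (1 / 2 :: 'a)"
  have h: "2 * h = 1" using two by (simp add: h_def)
  have quarter: "r / 4 = r * h * h" using two four by (simp add: h_def divide_simps)
  have "Z i (m - 1 - i) r = (\<Sum>d\<in>L i 0 n. \<Sum>v\<in>L i 1 n. \<theta> (r * \<beta> v (\<lambda>k. v k + 1 * d k)))"
    unfolding Z_plus[OF assms(1,1,2)] by (rule sum_leadr_difference)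
  also have "\<dots> = (\<Sum>d\<in>L i 0 n. \<Sum>v\<in>L i 1 n. \<theta> (r * \<beta> v v) * \<theta> (- (r / 4) * \<beta> d d))"
  proof (rule sum.cong[OF refl])
    fix d assume d: "d \<in> L i 0 n"
    let ?w = "\<lambda>v k. v k + (- h) * d k"
    have "r * \<beta> (?w v) (\<lambda>k. ?w v k + 1 * d k) = r * \<beta> v v + (- (r / 4)) * \<beta> d d"
      if v: "v \<in> L i 1 n" for v
    proof -
      have "\<beta> d v = \<beta> v d" by (rule bq_sym[OF v d])
      \<comment> \<open>Of \<open>h\<close> only \<open>2 * h = 1\<close> is used: the difference of
        both sides is a multiple of \<open>2 * h - 1\<close>, a pure ring identity. The completions
        of squares below are checked in the same way.\<close>
      then have "r * \<beta> (?w v) (\<lambda>k. ?w v k + 1 * d k) - (r * \<beta> v v + (- (r / 4)) * \<beta> d d)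
          = (2 * h - 1) * (r * h * \<beta> d d - r * \<beta> v d)"
        unfolding bq_comb_left bq_comb_right quarter by (simp add: algebra_simps)
      then show ?thesis
        using h by (simp only: diff_self mult_zero_left right_minus_eq)
    qed
    then show "(\<Sum>v\<in>L i 1 n. \<theta> (r * \<beta> v (\<lambda>k. v k + 1 * d k))) =
        (\<Sum>v\<in>L i 1 n. \<theta> (r * \<beta> v v) * \<theta> (- (r / 4) * \<beta> d d))"
      by (subst sum_leadr_translate[OF d, where b = "- h"]) (simp only: char_add cong: sum.cong)
  qed
  also have "\<dots> = Q i r * T i (- (r / 4))"
    unfolding Q_def T_def sum_product by (rule sum.swap)
  finally show ?thesis .
qed

text \<open>With the second vector written as v + d, the cross term in a \<beta>(v, v) + b \<beta>(v
  + d, v + d) disappears under the shift of \<open>v\<close> by - (b/(a + b)) d.\<close>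

lemma Q_mult_same:
  assumes "a + b \<noteq> 0"
  shows "Q i a * Q i b = Q i (a + b) * T i (a * b / (a + b))"
proof -
  define c where "c = b / (a + b)"
  have c: "c * (a + b) = b" "a * b / (a + b) = a * c"
    using assms by (simp_all add: c_def)
  have "Q i a * Q i b = (\<Sum>d\<in>L i 0 n. \<Sum>v\<in>L i 1 n.
      \<theta> (a * \<beta> v v + b * \<beta> (\<lambda>k. v k + 1 * d k) (\<lambda>k. v k + 1 * d k)))"
    unfolding Q_def sum_product char_add[symmetric] by (rule sum_leadr_difference)
  also have "\<dots> = (\<Sum>d\<in>L i 0 n. \<Sum>v\<in>L i 1 n.
      \<theta> ((a + b) * \<beta> v v) * \<theta> (a * b / (a + b) * \<beta> d d))"
  proof (rule sum.cong[OF refl])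
    fix d assume d: "d \<in> L i 0 n"
    let ?w = "\<lambda>v k. v k + (- c) * d k"
    have "a * \<beta> (?w v) (?w v) + b * \<beta> (\<lambda>k. ?w v k + 1 * d k) (\<lambda>k. ?w v k + 1 * d k)
        = (a + b) * \<beta> v v + a * b / (a + b) * \<beta> d d" if v: "v \<in> L i 1 n" for v
    proof -
      have "\<beta> d v = \<beta> v d" by (rule bq_sym[OF v d])
      then have "a * \<beta> (?w v) (?w v) + b * \<beta> (\<lambda>k. ?w v k + 1 * d k) (\<lambda>k. ?w v k + 1 * d k)
          - ((a + b) * \<beta> v v + a * b / (a + b) * \<beta> d d)
          = (c * (a + b) - b) * (c * \<beta> d d - \<beta> d d - 2 * \<beta> v d)"
        unfolding bq_comb_left bq_comb_right c(2) by (simp add: algebra_simps)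
      then show ?thesis
        using c(1) by (simp only: diff_self mult_zero_left right_minus_eq)
    qed
    then show "(\<Sum>v\<in>L i 1 n. \<theta> (a * \<beta> v v + b * \<beta> (\<lambda>k. v k + 1 * d k) (\<lambda>k. v k + 1 * d k))) =
        (\<Sum>v\<in>L i 1 n. \<theta> ((a + b) * \<beta> v v) * \<theta> (a * b / (a + b) * \<beta> d d))"
      by (subst sum_leadr_translate[OF d, where b = "- c"]) (simp only: char_add cong: sum.cong)
  qed
  also have "\<dots> = Q i (a + b) * T i (a * b / (a + b))"
    unfolding Q_def T_def sum_product by (rule sum.swap)
  finally show ?thesis .
qed

text \<open>For opposite parameters the squares of \<open>v\<close> cancel. Shifting
  \<open>v\<close> by - d/2 also removes \<beta>(d, d), and the phase left is bilinear in
  \<open>d\<close> and \<open>v\<close>; hence characters \<open>Z\<close> appear instead of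
  \<open>Q\<close>.\<close>

lemma Q_mult_opposite:
  assumes "i < n" and "a \<noteq> 0"
  shows "Q i a * Q i (- a) =
    Z i n 0 + (\<Sum>l\<in>{i<..<n}. \<Sum>t\<in>UNIV - {0}. Z l (m - 1 - i) (- (2 * a) * t))"
proof -
  define h where "h = (1 / 2 :: 'a)"
  have h: "2 * h = 1" using two by (simp add: h_def)
  have "Q i a * Q i (- a) = (\<Sum>d\<in>L i 0 n. \<Sum>v\<in>L i 1 n.
      \<theta> (a * \<beta> v v + (- a) * \<beta> (\<lambda>k. v k + 1 * d k) (\<lambda>k. v k + 1 * d k)))"
    unfolding Q_def sum_product char_add[symmetric] by (rule sum_leadr_difference)
  also have "\<dots> = (\<Sum>d\<in>L i 0 n. \<Sum>v\<in>L i 1 n. \<theta> (- (2 * a) * \<beta> d v))"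
  proof (rule sum.cong[OF refl])
    fix d assume d: "d \<in> L i 0 n"
    let ?w = "\<lambda>v k. v k + (- h) * d k"
    have "a * \<beta> (?w v) (?w v) + (- a) * \<beta> (\<lambda>k. ?w v k + 1 * d k) (\<lambda>k. ?w v k + 1 * d k)
        = - (2 * a) * \<beta> d v" if v: "v \<in> L i 1 n" for v
    proof -
      have "\<beta> d v = \<beta> v d" by (rule bq_sym[OF v d])
      then have "a * \<beta> (?w v) (?w v) + (- a) * \<beta> (\<lambda>k. ?w v k + 1 * d k) (\<lambda>k. ?w v k + 1 * d k)
          - (- (2 * a) * \<beta> d v) = (2 * h - 1) * (a * \<beta> d d)"
        unfolding bq_comb_left bq_comb_right by (simp add: algebra_simps)
      then show ?thesis
        using h by (simp only: diff_self mult_zero_left right_minus_eq)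
    qed
    then show "(\<Sum>v\<in>L i 1 n. \<theta> (a * \<beta> v v + (- a) * \<beta> (\<lambda>k. v k + 1 * d k) (\<lambda>k. v k + 1 * d k))) =
        (\<Sum>v\<in>L i 1 n. \<theta> (- (2 * a) * \<beta> d v))"
      by (subst sum_leadr_translate[OF d, where b = "- h"]) (simp only: cong: sum.cong)
  qed
  also have "\<dots> = Z i n 0 + (\<Sum>l\<in>{i<..<n}. \<Sum>t\<in>UNIV - {0}. Z l (m - 1 - i) (- (2 * a) * t))"
    using assms two by (intro sum_pair_expand) auto
  finally show ?thesis .
qed

text \<open>A summand of \<open>Q i r\<close> is a fixed vector that reaches the middle, hence
  beyond \<open>k\<close>, so \<open>Zs_eq_Es\<close> applies. Without such vectors both sides are
  0.\<close>

lemma Q_mult_Z_short: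
  assumes "i < k" and "k < n"
  shows "Q i r * Z i k s' = Q i r * Es i k s'"
proof (cases "L i 1 n = {}")
  case False
  then show ?thesis using Zs_eq_Es[OF assms, of _ s'] m by auto
qed (simp add: Q_def)

text \<open>The phase is r \<beta>(v, v) + q \<beta>(v + d, u). Shifting \<open>v\<close> by -
  (q/(2r)) u removes q \<beta>(v, u), and shifting \<open>d\<close> by (q/(4r)) u removes the
  \<beta>(u, u) thereby created. Both shifts are allowed because \<open>u\<close> starts after
  \<open>i\<close>.\<close>

lemma Q_mult_Z_long:
  assumes "i < j" and "j < n" and "r \<noteq> 0" and "q \<noteq> 0"
  shows "Q i r * Z i (m - 1 - j) q =
    Q i r * (Z j n 0 + (\<Sum>l\<in>{i<..<n}. \<Sum>t\<in>UNIV - {0}. Z l (m - 1 - j) (q * t)))"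
proof -
  have i: "i < n" using assms by simp
  define h c where "h = (1 / 2 :: 'a)" and "c = q / (2 * r)"
  have h: "2 * h = 1" and c: "2 * r * c = q"
    using two assms by (simp_all add: h_def c_def)
  have "Q i r * Z i (m - 1 - j) q = (\<Sum>v\<in>L i 1 n. \<Sum>w\<in>L i 1 n. \<Sum>u\<in>L j 1 n.
      \<theta> (r * \<beta> v v + q * \<beta> w u))"
    unfolding Z_plus[OF i assms(2,4)] Q_def sum_product
    by (simp only: char_add sum_distrib_left)
  also have "\<dots> = (\<Sum>d\<in>L i 0 n. \<Sum>u\<in>L j 1 n. \<Sum>v\<in>L i 1 n.
      \<theta> (r * \<beta> v v + q * \<beta> (\<lambda>k. v k + 1 * d k) u))"
    unfolding sum_leadr_difference by (rule sum.cong[OF refl], rule sum.swap)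
  also have "\<dots> = (\<Sum>u\<in>L j 1 n. \<Sum>d\<in>L i 0 n. \<Sum>v\<in>L i 1 n.
      \<theta> (r * \<beta> v v + q * \<beta> (\<lambda>k. v k + 1 * d k) u))"
    by (rule sum.swap)
  also have "\<dots> = (\<Sum>u\<in>L j 1 n. \<Sum>d\<in>L i 0 n. \<Sum>v\<in>L i 1 n. \<theta> (r * \<beta> v v) * \<theta> (q * \<beta> d u))"
  proof (rule sum.cong[OF refl])
    fix u assume u: "u \<in> L j 1 n"
    then have u0: "u \<in> L i 0 n" using assms(1) by (rule leadr_later)
    let ?c = "- c" and ?c' = "c * h"
    let ?w = "\<lambda>v k. v k + ?c * u k" and ?e = "\<lambda>d k. d k + ?c' * u k"
    have eq: "r * \<beta> (?w v) (?w v) + q * \<beta> (\<lambda>k. ?w v k + 1 * ?e d k) u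
        = r * \<beta> v v + q * \<beta> d u" if v: "v \<in> L i 1 n" for v d
    proof -
      have "\<beta> u v = \<beta> v u" by (rule bq_sym[OF v u])
      then have "r * \<beta> (?w v) (?w v) + q * \<beta> (\<lambda>k. ?w v k + 1 * ?e d k) u
          - (r * \<beta> v v + q * \<beta> d u)
          = (2 * r * c - q) * (h * c * \<beta> u u - \<beta> v u)
            + (2 * h - 1) * (q * c * \<beta> u u - r * c * c * \<beta> u u)"
        unfolding bq_comb_left bq_comb_right by (simp add: algebra_simps)
      then show ?thesis
        using h c by (simp only: diff_self mult_zero_left add_0_left right_minus_eq)
    qed
    have "(\<Sum>d\<in>L i 0 n. \<Sum>v\<in>L i 1 n. \<theta> (r * \<beta> v v + q * \<beta> (\<lambda>k. v k + 1 * d k) u)) =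
      (\<Sum>d\<in>L i 0 n. \<Sum>v\<in>L i 1 n. \<theta> (r * \<beta> v v + q * \<beta> (\<lambda>k. v k + 1 * ?e d k) u))"
      by (rule sum_leadr_translate[OF u0, where b = ?c'])
    also have "\<dots> = (\<Sum>d\<in>L i 0 n. \<Sum>v\<in>L i 1 n.
        \<theta> (r * \<beta> (?w v) (?w v) + q * \<beta> (\<lambda>k. ?w v k + 1 * ?e d k) u))"
      by (rule sum.cong[OF refl], rule sum_leadr_translate[OF u0, where b = ?c])
    also have "\<dots> = (\<Sum>d\<in>L i 0 n. \<Sum>v\<in>L i 1 n. \<theta> (r * \<beta> v v) * \<theta> (q * \<beta> d u))"
      by (simp only: eq char_add cong: sum.cong)
    finally show "(\<Sum>d\<in>L i 0 n. \<Sum>v\<in>L i 1 n. \<theta> (r * \<beta> v v + q * \<beta> (\<lambda>k. v k + 1 * d k) u)) =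
      (\<Sum>d\<in>L i 0 n. \<Sum>v\<in>L i 1 n. \<theta> (r * \<beta> v v) * \<theta> (q * \<beta> d u))" .
  qed
  also have "\<dots> = Q i r * (\<Sum>u\<in>L j 1 n. \<Sum>d\<in>L i 0 n. \<theta> (q * \<beta> d u))"
    unfolding Q_def by (simp add: sum_distrib_left sum_distrib_right)
  also have "(\<Sum>u\<in>L j 1 n. \<Sum>d\<in>L i 0 n. \<theta> (q * \<beta> d u)) =
      Z j n 0 + (\<Sum>l\<in>{i<..<n}. \<Sum>t\<in>UNIV - {0}. Z l (m - 1 - j) (q * t))"
    using assms by (subst sum.swap, subst sum_pair_expand) auto
  finally show ?thesis .
qed

text \<open>By symmetry \<beta>(w + d, w + d) = \<beta>(w + 2d, w) + \<beta>(d, d). The first term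
  is linear in its left argument, so the free vector \<open>v\<close> in q \<beta>(v, w) absorbs it
  through a shift by - (r/q)(w + 2d). The shift is legitimate since \<open>w + 2d\<close> starts at
  \<open>i\<close>, after \<open>j\<close>.\<close>

lemma Q_mult_Z_column:
  assumes "j < i" and "i < n" and "q \<noteq> 0"
  shows "Q i r * Z j (m - 1 - i) q = Z j (m - 1 - i) q * T i r"
proof -
  have j: "j < n" using assms by simp
  define c where "c = r / q"
  have c: "c * q = r" using assms by (simp add: c_def)
  have "Q i r * Z j (m - 1 - i) q = (\<Sum>w\<in>L i 1 n. \<Sum>u\<in>L i 1 n. \<Sum>v\<in>L j 1 n.
      \<theta> (r * \<beta> u u + q * \<beta> v w))"
    unfolding Z_plus[OF j assms(2,3)] Q_def sum.swap[of _ "L i 1 n" "L j 1 n"]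
    unfolding sum_product char_add
    unfolding sum_distrib_left by (rule sum.swap)
  also have "\<dots> = (\<Sum>d\<in>L i 0 n. \<Sum>w\<in>L i 1 n. \<Sum>v\<in>L j 1 n.
      \<theta> (r * \<beta> (\<lambda>k. w k + 1 * d k) (\<lambda>k. w k + 1 * d k) + q * \<beta> v w))"
    by (rule sum_leadr_difference)
  also have "\<dots> = (\<Sum>d\<in>L i 0 n. \<Sum>w\<in>L i 1 n. \<Sum>v\<in>L j 1 n.
      \<theta> (r * \<beta> d d) * \<theta> (q * \<beta> v w))"
  proof (rule sum.cong[OF refl], rule sum.cong[OF refl])
    fix d w assume d: "d \<in> L i 0 n" and w: "w \<in> L i 1 n"
    let ?e = "\<lambda>k. w k + 2 * d k" and ?c = "- c"
    have "?e \<in> L i 1 n" using leadr_comb[OF w d, of 1 2] by simp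
    then have e: "?e \<in> L j 0 n" using assms(1) by (rule leadr_later)
    have eq: "r * \<beta> (\<lambda>k. w k + 1 * d k) (\<lambda>k. w k + 1 * d k) + q * \<beta> (\<lambda>k. v k + ?c * ?e k) w
        = r * \<beta> d d + q * \<beta> v w" for v
    proof -
      have "\<beta> d w = \<beta> w d" by (rule bq_sym[OF w d])
      then have "r * \<beta> (\<lambda>k. w k + 1 * d k) (\<lambda>k. w k + 1 * d k) + q * \<beta> (\<lambda>k. v k + ?c * ?e k) w
          - (r * \<beta> d d + q * \<beta> v w) = (c * q - r) * (- \<beta> w w - 2 * \<beta> w d)"
        unfolding bq_comb_left bq_comb_right by (simp add: algebra_simps)
      then show ?thesis
        using c by (simp only: diff_self mult_zero_left right_minus_eq)
    qed
    show "(\<Sum>v\<in>L j 1 n. \<theta> (r * \<beta> (\<lambda>k. w k + 1 * d k) (\<lambda>k. w k + 1 * d k) + q * \<beta> v w)) =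
        (\<Sum>v\<in>L j 1 n. \<theta> (r * \<beta> d d) * \<theta> (q * \<beta> v w))"
      by (subst sum_leadr_translate[OF e, where b = ?c]) (simp only: eq char_add)
  qed
  also have "\<dots> = T i r * Z j (m - 1 - i) q"
    unfolding Z_plus[OF j assms(2,3)] T_def sum.swap[of _ "L i 1 n" "L j 1 n"]
    unfolding sum_product by (simp only: sum_distrib_left)
  finally show ?thesis by (simp add: mult.commute)
qed

end

section \<open>The groups\<close>

lemma finite_carrier_mat: "finite (carrier_mat m m' :: 'a :: finite mat set)"
proof -
  have "carrier_mat m m' \<subseteq> (\<lambda>f. mat m m' f) ` (({..<m} \<times> {..<m'}) \<rightarrow>\<^sub>E (UNIV :: 'a set))"
  proof
    fix x :: "'a mat" assume "x \<in> carrier_mat m m'"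
    then have "x = mat m m' (restrict (\<lambda>p. x $$ p) ({..<m} \<times> {..<m'}))"
      by (intro eq_matI) auto
    then show "x \<in> (\<lambda>f. mat m m' f) ` (({..<m} \<times> {..<m'}) \<rightarrow>\<^sub>E UNIV)"
      by (rule image_eqI[where f = "mat m m'"]) simp
  qed
  then show ?thesis
    by (rule finite_subset) (auto intro!: finite_PiE)
qed

lemma det_nonzero_inverse:
  fixes x :: "'a :: field mat"
  assumes "x \<in> carrier_mat m m" and "det x \<noteq> 0"
  obtains y where "y \<in> carrier_mat m m" and "x * y = 1\<^sub>m m" and "y * x = 1\<^sub>m m"
proof -
  have "x \<in> Units (ring_mat TYPE('a) m ())"
    using assms by (rule det_non_zero_imp_unit)
  then show ?thesis
    using that by (auto simp: Units_def ring_mat_def)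
qed

text \<open>Inverses come for free: right multiplication by an invertible matrix permutes a finite
  closed set.\<close>

lemma finite_matrix_group:
  fixes S :: "'a :: field mat set"
  assumes "finite S" and S: "S \<subseteq> carrier_mat m m" and det: "\<And>x. x \<in> S \<Longrightarrow> det x \<noteq> 0"
    and closed: "\<And>x y. x \<in> S \<Longrightarrow> y \<in> S \<Longrightarrow> x * y \<in> S" and one: "1\<^sub>m m \<in> S"
  shows "group \<lparr>carrier = S, mult = (*), one = 1\<^sub>m m\<rparr>"
proof (rule groupI; simp)
  fix x y z assume "x \<in> S" "y \<in> S" "z \<in> S"
  then show "x * y * z = x * (y * z)"
    using S by (intro assoc_mult_mat[of _ m m _ m _ m]) blast+
next
  fix x assume "x \<in> S"
  then have "x \<in> carrier_mat m m" using S by blast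
  then show "1\<^sub>m m * x = x" by simp
next
  fix x assume x: "x \<in> S"
  have xc: "x \<in> carrier_mat m m" using x S by blast
  obtain x' where x': "x' \<in> carrier_mat m m" "x * x' = 1\<^sub>m m"
    by (rule det_nonzero_inverse[OF xc det[OF x]])
  have "inj_on (\<lambda>y. y * x) S"
  proof (rule inj_onI)
    fix y z assume yz: "y \<in> S" "z \<in> S" "y * x = z * x"
    have "w * x * x' = w" if "w \<in> S" for w
    proof -
      have w: "w \<in> carrier_mat m m" using that S by blast
      show ?thesis by (simp only: assoc_mult_mat[OF w xc x'(1)] x'(2) right_mult_one_mat[OF w])
    qed
    from this[OF yz(1)] this[OF yz(2)] yz(3) show "y = z" by metis
  qed
  then have "(\<lambda>y. y * x) ` S = S"
    using \<open>finite S\<close> closed[OF _ x] by (intro endo_inj_surj) blast+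
  then show "\<exists>y\<in>S. y * x = 1\<^sub>m m"
    using one by (metis imageE)
qed (use closed one in auto)

abbreviation Um :: "nat \<Rightarrow> 'a :: field mat set" where
  "Um m \<equiv> carrier (unitriangular_group m)"

lemma Um_iff:
  "x \<in> Um m \<longleftrightarrow> x \<in> carrier_mat m m \<and> (\<forall>i<m. x $$ (i, i) = 1) \<and>
     (\<forall>i<m. \<forall>j<i. x $$ (i, j) = 0)"
  by (auto simp: unitriangular_group_def upper_triangular_def)

lemma Um_carrier: "x \<in> Um m \<Longrightarrow> x \<in> carrier_mat m m"
  by (simp add: Um_iff)

lemma mat_mult_index:
  assumes "x \<in> carrier_mat p m" and "y \<in> carrier_mat m q" and "i < p" and "j < q"
  shows "(x * y) $$ (i, j) = (\<Sum>k<m. x $$ (i, k) * y $$ (k, j))"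
  using assms by (auto simp: scalar_prod_def lessThan_atLeast0)

lemma Um_mult:
  assumes x: "x \<in> Um m" and y: "y \<in> Um m"
  shows "x * y \<in> Um m"
proof -
  have eq: "(x * y) $$ (i, j) = (\<Sum>k<m. if k = i then y $$ (i, j) else 0)" if "i < m" "j \<le> i" for i j
  proof -
    have "x $$ (i, k) * y $$ (k, j) = (if k = i then y $$ (i, j) else 0)" if "k < m" for k
      using x y \<open>i < m\<close> \<open>j \<le> i\<close> that by (cases k i rule: linorder_cases) (auto simp: Um_iff)
    then show ?thesis
      using that x y by (simp add: mat_mult_index[OF Um_carrier Um_carrier])
  qed
  show ?thesis
    using x y by (auto simp: Um_iff eq simp del: index_mult_mat(1))
qed

lemma Um_one: "1\<^sub>m m \<in> Um m"
  by (auto simp: Um_iff)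

lemma Um_det: "x \<in> Um m \<Longrightarrow> det x \<noteq> 0"
  by (subst det_upper_triangular[of _ m])
     (auto simp: Um_iff upper_triangular_def prod_list_zero_iff diag_mat_def)

lemma Um_group: "group (unitriangular_group m :: 'a :: {field, finite} mat monoid)"
proof -
  have "group \<lparr>carrier = Um m :: 'a mat set, mult = (*), one = 1\<^sub>m m\<rparr>"
    by (rule finite_matrix_group)
       (auto intro: Um_mult Um_one Um_carrier dest: Um_det intro: finite_subset[OF _ finite_carrier_mat])
  then show ?thesis by (simp add: unitriangular_group_def)
qed

lemma Um_inv:
  fixes x :: "'a :: {field, finite} mat"
  assumes "x \<in> Um m"
  shows "inv\<^bsub>unitriangular_group m\<^esub> x \<in> Um m"
    and "x * inv\<^bsub>unitriangular_group m\<^esub> x = 1\<^sub>m m"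
    and "inv\<^bsub>unitriangular_group m\<^esub> x * x = 1\<^sub>m m"
  using group.inv_closed[OF Um_group assms] group.r_inv[OF Um_group assms]
    group.l_inv[OF Um_group assms]
  by (simp_all add: unitriangular_group_def)

section \<open>The invariant form and its unitriangular isometries\<close>

definition form_sign :: "family \<Rightarrow> nat \<Rightarrow> nat \<Rightarrow> 'a :: field" where
  "form_sign t n k = (if t = Symplectic \<and> n \<le> k then - 1 else 1)"

definition form_mat :: "family \<Rightarrow> nat \<Rightarrow> 'a :: field mat" where
  "form_mat t n = mat (dimn t n) (dimn t n)
     (\<lambda>(i, j). if i + j + 1 = dimn t n then form_sign t n i else 0)"

text \<open>\<open>U\<close> described by an equation instead of by blocks, which makes closure
  under products immediate; \<open>U_carrier\<close> identifies the two descriptions.\<close>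

definition iso_set :: "family \<Rightarrow> nat \<Rightarrow> 'a :: field mat set" where
  "iso_set t n = {x \<in> Um (dimn t n). x * form_mat t n * transpose_mat x = form_mat t n}"

lemma form_mat_carrier [simp]: "form_mat t n \<in> carrier_mat (dimn t n) (dimn t n)"
  by (simp add: form_mat_def)

lemma form_index:
  assumes "x \<in> carrier_mat (dimn t n) (dimn t n)" and "a < dimn t n" and "b < dimn t n"
  shows "(x * form_mat t n * transpose_mat x) $$ (a, b) =
    (\<Sum>k<dimn t n. x $$ (a, k) * form_sign t n k * x $$ (b, dimn t n - 1 - k))"
proof -
  let ?m = "dimn t n"
  have "(x * form_mat t n) $$ (a, l) = x $$ (a, ?m - 1 - l) * form_sign t n (?m - 1 - l)"
    if "l < ?m" for l
  proof -
    have "(x * form_mat t n) $$ (a, l) =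
        (\<Sum>k<?m. if k = ?m - 1 - l then x $$ (a, ?m - 1 - l) * form_sign t n (?m - 1 - l) else 0)"
      unfolding mat_mult_index[OF assms(1) form_mat_carrier assms(2) that]
      by (rule sum.cong) (use that in \<open>auto simp: form_mat_def\<close>)
    then show ?thesis using that by simp
  qed
  then have "(x * form_mat t n * transpose_mat x) $$ (a, b) =
    (\<Sum>k<?m. x $$ (a, ?m - 1 - k) * form_sign t n (?m - 1 - k) * x $$ (b, k))"
    using assms by (subst mat_mult_index[of _ ?m ?m _ ?m]) (auto intro!: sum.cong)
  also have "\<dots> = (\<Sum>k<?m. x $$ (a, k) * form_sign t n k * x $$ (b, ?m - 1 - k))"
    by (subst sum_reflect) (rule sum.cong, auto)
  finally show ?thesis .
qed

lemma iso_set_iff: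
  "x \<in> iso_set t n \<longleftrightarrow> x \<in> Um (dimn t n) \<and> (\<forall>a<dimn t n. \<forall>b<dimn t n.
     (\<Sum>k<dimn t n. x $$ (a, k) * form_sign t n k * x $$ (b, dimn t n - 1 - k)) =
     (if a + b + 1 = dimn t n then form_sign t n a else 0))"
proof (cases "x \<in> Um (dimn t n)")
  case True
  then have x: "x \<in> carrier_mat (dimn t n) (dimn t n)" by (rule Um_carrier)
  have "x * form_mat t n * transpose_mat x = form_mat t n \<longleftrightarrow>
      (\<forall>a<dimn t n. \<forall>b<dimn t n.
        (x * form_mat t n * transpose_mat x) $$ (a, b) = form_mat t n $$ (a, b))"
    using x by (auto simp: mat_eq_iff form_mat_def simp del: index_mult_mat(1))
  also have "\<dots> \<longleftrightarrow> (\<forall>a<dimn t n. \<forall>b<dimn t n.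
     (\<Sum>k<dimn t n. x $$ (a, k) * form_sign t n k * x $$ (b, dimn t n - 1 - k)) =
     (if a + b + 1 = dimn t n then form_sign t n a else 0))"
    by (intro arg_cong[of _ _ All] ext imp_cong refl)
       (simp only: form_index[OF x], simp only: form_mat_def index_mat case_prod_conv)
  finally show ?thesis
    using True by (simp add: iso_set_def)
qed (simp add: iso_set_def)

lemma iso_set_mult:
  assumes "x \<in> iso_set t n" and "y \<in> iso_set t n"
  shows "x * y \<in> iso_set t n"
proof -
  let ?m = "dimn t n" and ?F = "form_mat t n"
  have c: "x \<in> carrier_mat ?m ?m" "y \<in> carrier_mat ?m ?m" "?F \<in> carrier_mat ?m ?m"
    "transpose_mat x \<in> carrier_mat ?m ?m" "transpose_mat y \<in> carrier_mat ?m ?m"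
    using assms by (auto simp: iso_set_def dest: Um_carrier)
  have "x * y * ?F * transpose_mat (x * y) = x * (y * ?F * transpose_mat y) * transpose_mat x"
  proof -
    have 1: "transpose_mat (x * y) = transpose_mat y * transpose_mat x"
      using c by (simp only: transpose_mult)
    have 2: "x * y * ?F * (transpose_mat y * transpose_mat x) = x * y * ?F * transpose_mat y * transpose_mat x"
      by (rule assoc_mult_mat[symmetric, of _ ?m ?m _ ?m _ ?m])
         (use c in \<open>auto intro!: mult_carrier_mat[of _ ?m ?m _ ?m]\<close>)
    have 3: "x * y * ?F = x * (y * ?F)"
      by (rule assoc_mult_mat[of _ ?m ?m _ ?m _ ?m]) (use c in auto)
    have 4: "x * (y * ?F) * transpose_mat y = x * (y * ?F * transpose_mat y)"
      by (rule assoc_mult_mat[of _ ?m ?m _ ?m _ ?m])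
         (use c in \<open>auto intro!: mult_carrier_mat[of _ ?m ?m _ ?m]\<close>)
    show ?thesis unfolding 1 unfolding 2 unfolding 3 unfolding 4 ..
  qed
  then show ?thesis
    using assms by (simp add: iso_set_def Um_mult)
qed

lemma iso_set_one: "1\<^sub>m (dimn t n) \<in> iso_set t n"
  by (simp add: iso_set_def Um_one right_mult_one_mat[of _ "dimn t n" "dimn t n"]
      left_mult_one_mat[of _ "dimn t n" "dimn t n"])

lemma iso_set_group:
  "group \<lparr>carrier = iso_set t n :: 'a :: {field, finite} mat set, mult = (*), one = 1\<^sub>m (dimn t n)\<rparr>"
proof (rule finite_matrix_group)
  show "finite (iso_set t n :: 'a mat set)"
    by (rule finite_subset[OF _ finite_carrier_mat]) (auto simp: iso_set_def dest: Um_carrier)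
qed (auto intro: iso_set_mult iso_set_one, auto simp: iso_set_def Um_carrier Um_det)

section \<open>Block matrices and the form\<close>

lemma sum_lessThan_add: "(\<Sum>k<a + b. f k) = (\<Sum>k<a. f k) + (\<Sum>k<b. f (a + k))" for a b :: nat
  by (induction b) (simp_all add: add.assoc)

lemma sum_three_blocks:
  "(\<Sum>k<n + r + n. f k) = (\<Sum>k<n. f k) + (\<Sum>k<r. f (n + k)) + (\<Sum>k<n. f (n + r + k))" for n r :: nat
  by (simp only: sum_lessThan_add)

lemma dimn_blocks: "dimn t n = n + middle t + n"
  by (simp add: dimn_def)

lemma antidiag_carrier [simp]: "antidiag_mat n \<in> carrier_mat n n"
  by (simp add: antidiag_mat_def)

lemma antidiag_mult_left:
  assumes "x \<in> carrier_mat n p" and "i < n" and "j < p"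
  shows "(antidiag_mat n * x) $$ (i, j) = x $$ (n - 1 - i, j)"
proof -
  have "(antidiag_mat n * x) $$ (i, j) = (\<Sum>k<n. if k = n - 1 - i then x $$ (n - 1 - i, j) else 0)"
    unfolding mat_mult_index[OF antidiag_carrier assms]
    by (rule sum.cong) (use assms in \<open>auto simp: antidiag_mat_def\<close>)
  then show ?thesis using assms by simp
qed

lemma antidiag_mult_right:
  assumes "x \<in> carrier_mat p n" and "i < p" and "j < n"
  shows "(x * antidiag_mat n) $$ (i, j) = x $$ (i, n - 1 - j)"
proof -
  have "(x * antidiag_mat n) $$ (i, j) = (\<Sum>k<n. if k = n - 1 - j then x $$ (i, n - 1 - j) else 0)"
    unfolding mat_mult_index[OF assms(1) antidiag_carrier assms(2,3)]
    by (rule sum.cong) (use assms in \<open>auto simp: antidiag_mat_def\<close>)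
  then show ?thesis using assms by simp
qed

context
  fixes n r :: nat and a u z :: "'a :: {field, finite} mat"
  assumes a: "a \<in> Um n" and u: "u \<in> carrier_mat n r" and z: "z \<in> carrier_mat n n"
begin

abbreviation (input) "ai \<equiv> inv\<^bsub>unitriangular_group n\<^esub> a"
abbreviation (input) "blk \<equiv> U_block n r a u z"

lemma U_block_carrier: "blk \<in> carrier_mat (n + r + n) (n + r + n)"
  unfolding U_block_def
  by (intro four_block_carrier_mat mult_carrier_mat[of _ _ n] antidiag_carrier one_carrier_mat)
     (use a Um_inv(1)[OF a] in \<open>auto dest: Um_carrier\<close>)

lemma U_block_index:
  assumes "i < n + r + n" and "j < n + r + n"
  shows "blk $$ (i, j) =
    (if i < n then (if j < n then a $$ (i, j) else if j < n + r then (a * u) $$ (i, j - n)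
        else (a * z) $$ (i, j - n - r))
     else if i < n + r then (if j < n + r then (if i = j then 1 else 0)
        else - u $$ (n - 1 - (j - n - r), i - n))
     else if j < n + r then 0 else ai $$ (n - 1 - (j - n - r), n - 1 - (i - n - r)))"
proof -
  have ac: "a \<in> carrier_mat n n" and aic: "ai \<in> carrier_mat n n"
    using a Um_inv(1)[OF a] by (auto dest: Um_carrier)
  have 1: "(antidiag_mat n * transpose_mat ai * antidiag_mat n) $$ (p, q) = ai $$ (n - 1 - q, n - 1 - p)"
    if "p < n" "q < n" for p q
    using that aic
    by (subst antidiag_mult_right[of _ n]; (subst antidiag_mult_left[of _ n n])?)
       (auto intro!: mult_carrier_mat[of _ n n])
  have 2: "(transpose_mat u * antidiag_mat n) $$ (p, q) = u $$ (n - 1 - q, p)"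
    if "p < r" "q < n" for p q
    using that u by (subst antidiag_mult_right[of _ r]) auto
  have c: "a * u \<in> carrier_mat n r" "a * z \<in> carrier_mat n n"
    "transpose_mat u * antidiag_mat n \<in> carrier_mat r n"
    "antidiag_mat n * transpose_mat ai * antidiag_mat n \<in> carrier_mat n n"
    using ac u z aic by (auto intro!: mult_carrier_mat[of _ _ n])
  show ?thesis
    using assms c ac
    by (simp add: U_block_def index_mat_four_block 1 2 carrier_matD[OF c(1)] carrier_matD[OF c(2)]
        carrier_matD[OF c(3)] carrier_matD[OF c(4)] carrier_matD[OF ac]
        del: index_mult_mat) auto
qed

lemma U_block_Um: "blk \<in> Um (n + r + n)"
proof -
  have aiU: "ai \<in> Um n" by (rule Um_inv(1)[OF a])
  show ?thesis
    unfolding Um_iff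
  proof (intro conjI allI impI)
    show "blk \<in> carrier_mat (n + r + n) (n + r + n)" by (rule U_block_carrier)
    fix i assume i: "i < n + r + n"
    show "blk $$ (i, i) = 1"
      using i a aiU by (auto simp: U_block_index Um_iff simp del: index_mult_mat)
    fix j assume "j < i"
    then show "blk $$ (i, j) = 0"
      using i a aiU by (auto simp: U_block_index Um_iff simp del: index_mult_mat)
  qed
qed

end

lemma form_sign_reflect:
  assumes "k < dimn t n"
  shows "form_sign t n (dimn t n - Suc k) = (if t = Symplectic then - 1 else 1) * form_sign t n k"
  using assms by (auto simp: form_sign_def dimn_def middle_def)

lemma form_symmetric:
  "(\<Sum>k<dimn t n. v k * form_sign t n k * w (dimn t n - 1 - k)) =
   (if t = Symplectic then - 1 else 1) * (\<Sum>k<dimn t n. w k * form_sign t n k * v (dimn t n - 1 - k))"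
proof -
  have "(\<Sum>k<dimn t n. v k * form_sign t n k * w (dimn t n - 1 - k)) =
      (\<Sum>k<dimn t n. (if t = Symplectic then - 1 else 1) * (w k * form_sign t n k * v (dimn t n - 1 - k)))"
    by (subst sum_reflect, rule sum.cong)
       (auto simp: form_sign_reflect)
  then show ?thesis by (simp only: sum_distrib_left)
qed

text \<open>\<open>U_cond\<close> in all three families at once; the summand \<open>u u\<^sup>T\<close> vanishes if \<open>u\<close> has no columns.\<close>

lemma U_cond_iff:
  assumes u: "u \<in> carrier_mat n (middle t)" and z: "z \<in> carrier_mat n n"
  shows "U_cond t n u z \<longleftrightarrow> (\<forall>i<n. \<forall>j<n.
    z $$ (j, n - 1 - i) + (if t = Symplectic then - 1 else 1) * z $$ (i, n - 1 - j) +
      (\<Sum>k<middle t. u $$ (i, k) * u $$ (j, k)) = 0)"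
proof -
  have l: "(antidiag_mat n * transpose_mat z) $$ (i, j) = z $$ (j, n - 1 - i)" if "i < n" "j < n" for i j
    using that z by (subst antidiag_mult_left[of _ n n]) auto
  have r: "(z * antidiag_mat n) $$ (i, j) = z $$ (i, n - 1 - j)" if "i < n" "j < n" for i j
    using that z by (subst antidiag_mult_right[of _ n]) auto
  have uu: "(u * transpose_mat u) $$ (i, j) = (\<Sum>k<middle t. u $$ (i, k) * u $$ (j, k))"
    if "i < n" "j < n" for i j
    using that u by (subst mat_mult_index[of _ n "middle t" _ n]) (auto intro!: sum.cong)
  have c: "antidiag_mat n * transpose_mat z \<in> carrier_mat n n" "z * antidiag_mat n \<in> carrier_mat n n"
    "u * transpose_mat u \<in> carrier_mat n n"
    using u z by (auto intro: mult_carrier_mat[of _ n n] mult_carrier_mat[of _ n "middle t"])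
  have eq: "A = B \<longleftrightarrow> (\<forall>i<n. \<forall>j<n. A $$ (i, j) = B $$ (i, j))"
    if "A \<in> carrier_mat n n" "B \<in> carrier_mat n n" for A B :: "'a mat"
    using that by (auto simp: mat_eq_iff)
  have sub: "(A - B) $$ (i, j) = A $$ (i, j) - B $$ (i, j)"
    and add: "(A + B) $$ (i, j) = A $$ (i, j) + B $$ (i, j)"
    and neg: "(- A) $$ (i, j) = - A $$ (i, j)"
    if "A \<in> carrier_mat n n" "B \<in> carrier_mat n n" "i < n" "j < n" for A B :: "'a mat" and i j
    using that by auto
  note entries = sub[OF c(1,2)] add[OF c(1,2)] neg[OF c(3,3)] l r uu
  show ?thesis
  proof (cases t)
    case Symplectic
    then have "U_cond t n u z \<longleftrightarrow> antidiag_mat n * transpose_mat z - z * antidiag_mat n = 0\<^sub>m n n"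
      by (simp add: U_cond_def Let_def)
    also have "\<dots> \<longleftrightarrow> (\<forall>i<n. \<forall>j<n. z $$ (j, n - 1 - i) - z $$ (i, n - 1 - j) = 0)"
      using c by (subst eq) (auto simp: entries minus_carrier_mat simp del: index_mult_mat(1) index_minus_mat(1))
    finally show ?thesis using Symplectic by (simp add: middle_def)
  next
    case Even_Orthogonal
    then have "U_cond t n u z \<longleftrightarrow> antidiag_mat n * transpose_mat z + z * antidiag_mat n = 0\<^sub>m n n"
      by (simp add: U_cond_def Let_def)
    also have "\<dots> \<longleftrightarrow> (\<forall>i<n. \<forall>j<n. z $$ (j, n - 1 - i) + z $$ (i, n - 1 - j) = 0)"
      using c by (subst eq) (auto simp: entries simp del: index_mult_mat(1) index_add_mat(1))
    finally show ?thesis using Even_Orthogonal by (simp add: middle_def)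
  next
    case Odd_Orthogonal
    then have "U_cond t n u z \<longleftrightarrow>
        antidiag_mat n * transpose_mat z + z * antidiag_mat n = - (u * transpose_mat u)"
      by (simp add: U_cond_def Let_def)
    also have "\<dots> \<longleftrightarrow> (\<forall>i<n. \<forall>j<n. z $$ (j, n - 1 - i) + z $$ (i, n - 1 - j) =
        - (\<Sum>k<middle t. u $$ (i, k) * u $$ (j, k)))"
      using c
      by (subst eq) (auto simp: entries simp del: index_mult_mat(1) index_add_mat(1) index_uminus_mat(1))
    finally show ?thesis using Odd_Orthogonal by (simp add: eq_neg_iff_add_eq_0)
  qed
qed

lemma Um_mult_inv_index:
  fixes a :: "'a :: {field, finite} mat"
  assumes "a \<in> Um n" and "i < n" and "j < n"
  shows "(\<Sum>k<n. a $$ (i, k) * (inv\<^bsub>unitriangular_group n\<^esub> a) $$ (k, j)) = (if i = j then 1 else 0)"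
    and "(\<Sum>k<n. (inv\<^bsub>unitriangular_group n\<^esub> a) $$ (i, k) * a $$ (k, j)) = (if i = j then 1 else 0)"
  using assms Um_inv[OF assms(1)]
    mat_mult_index[of a n n "inv\<^bsub>unitriangular_group n\<^esub> a" n i j]
    mat_mult_index[of "inv\<^bsub>unitriangular_group n\<^esub> a" n n a n i j]
  by (auto dest!: Um_carrier)

text \<open>The top left block of X F X^T is a M a^T, where M is the matrix whose vanishing is
  \<open>U_cond\<close>. Only the first \<open>n\<close> rows of \<open>x\<close> enter, so the
  identity serves both for block matrices and for isometries not yet known to be of that
  form.\<close>

lemma form_top_block:
  fixes a u z :: "'a :: {field, finite} mat"
  assumes x: "x \<in> carrier_mat (dimn t n) (dimn t n)"
    and a: "a \<in> carrier_mat n n" and u: "u \<in> carrier_mat n (middle t)" and z: "z \<in> carrier_mat n n"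
    and xa: "\<And>i k. i < n \<Longrightarrow> k < n \<Longrightarrow> x $$ (i, k) = a $$ (i, k)"
    and xu: "\<And>i k. i < n \<Longrightarrow> k < middle t \<Longrightarrow> x $$ (i, n + k) = (a * u) $$ (i, k)"
    and xz: "\<And>i k. i < n \<Longrightarrow> k < n \<Longrightarrow> x $$ (i, n + middle t + k) = (a * z) $$ (i, k)"
    and p: "p < n" and q: "q < n"
  shows "(\<Sum>k<dimn t n. x $$ (p, k) * form_sign t n k * x $$ (q, dimn t n - 1 - k)) =
    (\<Sum>i<n. \<Sum>j<n. a $$ (p, i) * a $$ (q, j) *
      (z $$ (j, n - 1 - i) + (if t = Symplectic then - 1 else 1) * z $$ (i, n - 1 - j) +
        (\<Sum>k<middle t. u $$ (i, k) * u $$ (j, k))))"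
proof -
  let ?r = "middle t" and ?\<sigma> = "(if t = Symplectic then - 1 else 1) :: 'a"
  have xz': "x $$ (i, dimn t n - 1 - k) = (\<Sum>j<n. a $$ (i, j) * z $$ (j, n - 1 - k))"
    if "i < n" "k < n" for i k
  proof -
    have "dimn t n - 1 - k = n + ?r + (n - 1 - k)"
      using that unfolding dimn_def by linarith
    moreover have "n - 1 - k < n" using that by simp
    ultimately show ?thesis
      using that(1) by (simp only: xz mat_mult_index[OF a z])
  qed
  have "(\<Sum>k<n. x $$ (p, k) * form_sign t n k * x $$ (q, dimn t n - 1 - k)) =
      (\<Sum>i<n. \<Sum>j<n. a $$ (p, i) * a $$ (q, j) * z $$ (j, n - 1 - i))"
  proof (rule sum.cong[OF refl])
    fix k assume "k \<in> {..<n}"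
    then show "x $$ (p, k) * form_sign t n k * x $$ (q, dimn t n - 1 - k) =
        (\<Sum>j<n. a $$ (p, k) * a $$ (q, j) * z $$ (j, n - 1 - k))"
      using xz'[OF q, of k] p by (simp add: xa form_sign_def sum_distrib_left mult.assoc)
  qed
  moreover have "(\<Sum>k<?r. x $$ (p, n + k) * form_sign t n (n + k) * x $$ (q, dimn t n - 1 - (n + k))) =
      (\<Sum>i<n. \<Sum>j<n. a $$ (p, i) * a $$ (q, j) * (\<Sum>k<?r. u $$ (i, k) * u $$ (j, k)))"
  proof -
    have "(\<Sum>k<?r. x $$ (p, n + k) * form_sign t n (n + k) * x $$ (q, dimn t n - 1 - (n + k))) =
        (\<Sum>k<?r. (\<Sum>i<n. a $$ (p, i) * u $$ (i, k)) * (\<Sum>j<n. a $$ (q, j) * u $$ (j, k)))"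
    proof (rule sum.cong[OF refl])
      fix k assume "k \<in> {..<?r}"
      then have k: "k < ?r" "dimn t n - 1 - (n + k) = n + k" "t = Odd_Orthogonal"
        by (auto simp: middle_def dimn_def split: if_splits)
      have "x $$ (i, n + k) = (\<Sum>j<n. a $$ (i, j) * u $$ (j, k))" if "i < n" for i
        using that k(1) by (simp only: xu mat_mult_index[OF a u])
      then show "x $$ (p, n + k) * form_sign t n (n + k) * x $$ (q, dimn t n - 1 - (n + k)) =
          (\<Sum>i<n. a $$ (p, i) * u $$ (i, k)) * (\<Sum>j<n. a $$ (q, j) * u $$ (j, k))"
        using p q unfolding k(2) by (simp add: k(3) form_sign_def)
    qed
    also have "\<dots> = (\<Sum>k<?r. \<Sum>i<n. \<Sum>j<n. a $$ (p, i) * a $$ (q, j) * (u $$ (i, k) * u $$ (j, k)))"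
      by (simp add: sum_product mult_ac)
    also have "\<dots> = (\<Sum>i<n. \<Sum>j<n. \<Sum>k<?r. a $$ (p, i) * a $$ (q, j) * (u $$ (i, k) * u $$ (j, k)))"
      by (rule trans[OF sum.swap], rule sum.cong[OF refl], rule sum.swap)
    finally show ?thesis by (simp only: sum_distrib_left)
  qed
  moreover have "(\<Sum>k<n. x $$ (p, n + ?r + k) * form_sign t n (n + ?r + k) *
        x $$ (q, dimn t n - 1 - (n + ?r + k))) =
      (\<Sum>i<n. \<Sum>j<n. a $$ (p, i) * a $$ (q, j) * (?\<sigma> * z $$ (i, n - 1 - j)))"
  proof -
    have "(\<Sum>k<n. x $$ (p, n + ?r + k) * form_sign t n (n + ?r + k) *
        x $$ (q, dimn t n - 1 - (n + ?r + k))) =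
      (\<Sum>k<n. x $$ (p, n + ?r + k) * ?\<sigma> * a $$ (q, n - 1 - k))"
      using q by (intro sum.cong refl) (auto simp: dimn_def form_sign_def xa mult_2)
    also have "\<dots> = (\<Sum>k<n. x $$ (p, n + ?r + (n - 1 - k)) * ?\<sigma> * a $$ (q, n - 1 - (n - 1 - k)))"
      by (rule sum_reflect)
    also have "\<dots> = (\<Sum>k<n. \<Sum>i<n. a $$ (p, i) * a $$ (q, k) * (?\<sigma> * z $$ (i, n - 1 - k)))"
    proof (rule sum.cong[OF refl])
      fix k assume k: "k \<in> {..<n}"
      have "x $$ (p, n + ?r + (n - 1 - k)) = (\<Sum>i<n. a $$ (p, i) * z $$ (i, n - 1 - k))"
        using p k xz[of p "n - 1 - k"] mat_mult_index[OF a z, of p "n - 1 - k"] by simp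
      moreover have "n - 1 - (n - 1 - k) = k" using k by auto
      ultimately show "x $$ (p, n + ?r + (n - 1 - k)) * ?\<sigma> * a $$ (q, n - 1 - (n - 1 - k)) =
          (\<Sum>i<n. a $$ (p, i) * a $$ (q, k) * (?\<sigma> * z $$ (i, n - 1 - k)))"
        by (simp only: sum_distrib_right sum_distrib_left) (rule sum.cong, auto simp: mult_ac)
    qed
    also have "\<dots> = (\<Sum>i<n. \<Sum>j<n. a $$ (p, i) * a $$ (q, j) * (?\<sigma> * z $$ (i, n - 1 - j)))"
      by (rule sum.swap)
    finally show ?thesis .
  qed
  moreover have "(\<Sum>k<dimn t n. x $$ (p, k) * form_sign t n k * x $$ (q, dimn t n - 1 - k)) =
      (\<Sum>k<n. x $$ (p, k) * form_sign t n k * x $$ (q, dimn t n - 1 - k)) +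
      (\<Sum>k<?r. x $$ (p, n + k) * form_sign t n (n + k) * x $$ (q, dimn t n - 1 - (n + k))) +
      (\<Sum>k<n. x $$ (p, n + ?r + k) * form_sign t n (n + ?r + k) * x $$ (q, dimn t n - 1 - (n + ?r + k)))"
    by (subst dimn_blocks[of t n], subst sum_three_blocks) simp
  ultimately show ?thesis
    by (simp only: distrib_left sum.distrib add_ac)
qed

text \<open>Since the form is symmetric or alternating, pairs of rows \<open>p \<le> q\<close>
  suffice. \<open>U_cond\<close> settles two rows of the top block. A top row against a lower one
  gives an entry of a a^-1, and against the middle row the terms a u and - a u cancel. The remaining
  pairs are immediate from the zero blocks and the middle 1.\<close>

lemma U_block_form:
  fixes a u z :: "'a :: {field, finite} mat"
  assumes a: "a \<in> Um n" and u: "u \<in> carrier_mat n (middle t)" and z: "z \<in> carrier_mat n n"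
    and cond: "U_cond t n u z"
  shows "U_block n (middle t) a u z \<in> iso_set t n"
proof -
  let ?r = "middle t" and ?m = "dimn t n"
  let ?x = "U_block n ?r a u z" and ?b = "inv\<^bsub>unitriangular_group n\<^esub> a"
  note idx = U_block_index[OF a u z, folded dimn_blocks]
  have xU: "?x \<in> Um ?m"
    using U_block_Um[OF a u z] by (simp add: dimn_blocks)
  have m: "?m = n + ?r + n" by (rule dimn_blocks)
  define f where "f p q = (\<Sum>k<?m. ?x $$ (p, k) * form_sign t n k * ?x $$ (q, ?m - 1 - k))" for p q
  have split: "f p q = (\<Sum>k<n. ?x $$ (p, k) * form_sign t n k * ?x $$ (q, ?m - 1 - k)) +
      (\<Sum>k<?r. ?x $$ (p, n + k) * form_sign t n (n + k) * ?x $$ (q, ?m - 1 - (n + k))) +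
      (\<Sum>k<n. ?x $$ (p, n + ?r + k) * form_sign t n (n + ?r + k) * ?x $$ (q, ?m - 1 - (n + ?r + k)))"
    for p q
    unfolding f_def by (subst m, subst sum_three_blocks) simp
  have top: "f p q = 0" if "p < n" "q < n" for p q
  proof -
    have "f p q = (\<Sum>i<n. \<Sum>j<n. a $$ (p, i) * a $$ (q, j) *
      (z $$ (j, n - 1 - i) + (if t = Symplectic then - 1 else 1) * z $$ (i, n - 1 - j) +
        (\<Sum>k<middle t. u $$ (i, k) * u $$ (j, k))))"
      unfolding f_def
      by (rule form_top_block)
         (use that a u z xU in \<open>auto simp: idx m Um_carrier simp del: index_mult_mat dest: Um_carrier\<close>)
    also have "\<dots> = 0"
      using cond[unfolded U_cond_iff[OF u z]] by (intro sum.neutral ballI) auto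
    finally show ?thesis .
  qed
  have sgn1: "form_sign t n k = 1" if "k < n + ?r" for k
    using that by (auto simp: form_sign_def middle_def split: if_splits)
  have x_aa: "?x $$ (p, k) = a $$ (p, k)" if "p < n" "k < n" for p k
    using that by (simp add: idx m)
  have x_zero: "?x $$ (p, k) = 0" if "n \<le> p" "p < ?m" "k < n" for p k
    using that by (simp add: idx m)
  have x_zero': "?x $$ (p, k) = 0" if "n + ?r \<le> p" "p < ?m" "k < n + ?r" for p k
    using that by (simp add: idx m)
  have mid: "f p q = 0" if p: "p < n" and q: "n \<le> q" "q < n + ?r" for p q
  proof -
    have t: "t = Odd_Orthogonal" using q by (auto simp: middle_def split: if_splits)
    then have r: "{..<?r} = {0}" and q: "q = n" and m': "?m - 1 - (n + 0) = n" and r0: "0 < ?r"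
      using q by (auto simp: middle_def dimn_def)
    have "(\<Sum>k<n. ?x $$ (p, k) * form_sign t n k * ?x $$ (q, ?m - 1 - k)) = (\<Sum>k<n. - (a $$ (p, k) * u $$ (k, 0)))"
    proof (rule sum.cong[OF refl])
      fix k assume k: "k \<in> {..<n}"
      then have "?x $$ (n, ?m - 1 - k) = - u $$ (k, 0)"
        using r0 by (subst idx) (auto simp: m)
      then show "?x $$ (p, k) * form_sign t n k * ?x $$ (q, ?m - 1 - k) = - (a $$ (p, k) * u $$ (k, 0))"
        using p k by (simp add: x_aa sgn1 q)
    qed
    moreover have "?x $$ (n, n) = 1"
      using r0 by (subst idx) (auto simp: m)
    moreover have "?x $$ (p, n) = (\<Sum>k<n. a $$ (p, k) * u $$ (k, 0))"
      using p r0 by (subst idx) (auto simp: m mat_mult_index[OF Um_carrier[OF a] u] simp del: index_mult_mat)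
    moreover have "(\<Sum>k<n. ?x $$ (p, n + ?r + k) * form_sign t n (n + ?r + k) * ?x $$ (q, ?m - 1 - (n + ?r + k))) = 0"
      using r0 by (intro sum.neutral ballI) (auto simp: q m intro!: x_zero)
    ultimately show ?thesis
      unfolding split r by (simp add: sum_negf m'[simplified] sgn1 r0 q)
  qed
  have low: "f p q = (if p + q + 1 = ?m then form_sign t n p else 0)"
    if p: "p < n" and q: "n + ?r \<le> q" "q < ?m" for p q
  proof -
    define q' where "q' = n - 1 - (q - n - ?r)"
    have q': "q' < n" using q by (auto simp: q'_def m)
    have "(\<Sum>k<n. ?x $$ (p, k) * form_sign t n k * ?x $$ (q, ?m - 1 - k)) = (\<Sum>k<n. a $$ (p, k) * ?b $$ (k, q'))"
    proof (rule sum.cong[OF refl])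
      fix k assume k: "k \<in> {..<n}"
      then have "?x $$ (q, ?m - 1 - k) = ?b $$ (k, q')"
        using q by (subst idx) (auto simp: m q'_def)
      then show "?x $$ (p, k) * form_sign t n k * ?x $$ (q, ?m - 1 - k) = a $$ (p, k) * ?b $$ (k, q')"
        using p k by (simp add: x_aa sgn1)
    qed
    moreover have "(\<Sum>k<?r. ?x $$ (p, n + k) * form_sign t n (n + k) * ?x $$ (q, ?m - 1 - (n + k))) = 0"
      using q by (intro sum.neutral ballI) (simp add: x_zero' m)
    moreover have "(\<Sum>k<n. ?x $$ (p, n + ?r + k) * form_sign t n (n + ?r + k) * ?x $$ (q, ?m - 1 - (n + ?r + k))) = 0"
      using q by (intro sum.neutral ballI) (simp add: x_zero' m)
    moreover have "p = q' \<longleftrightarrow> p + q + 1 = ?m" using p q by (auto simp: q'_def m)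
    ultimately show ?thesis
      using Um_mult_inv_index(1)[OF a p q'] p by (simp add: split sgn1)
  qed
  have midmid: "f p q = (if p + q + 1 = ?m then form_sign t n p else 0)"
    if p: "n \<le> p" "p < n + ?r" and q: "n \<le> q" "q < n + ?r" for p q
  proof -
    have t: "t = Odd_Orthogonal" using q by (auto simp: middle_def split: if_splits)
    then have r: "{..<?r} = {0}" and pq: "p = n" "q = n" and m': "?m - 1 - (n + 0) = n" "n + n + 1 = ?m"
      and r0: "0 < ?r"
      using p q by (auto simp: middle_def dimn_def)
    have "(\<Sum>k<n. ?x $$ (p, k) * form_sign t n k * ?x $$ (q, ?m - 1 - k)) = 0"
      using r0 by (intro sum.neutral ballI) (simp add: x_zero m pq)
    moreover have "?x $$ (n, n) = 1"
      using r0 by (subst idx) (auto simp: m)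
    moreover have "(\<Sum>k<n. ?x $$ (p, n + ?r + k) * form_sign t n (n + ?r + k) * ?x $$ (q, ?m - 1 - (n + ?r + k))) = 0"
      using r0 by (intro sum.neutral ballI) (simp add: x_zero m pq)
    ultimately show ?thesis
      unfolding split r using m' r0 by (simp add: sgn1 pq)
  qed
  have lowlow: "f p q = 0" if p: "n \<le> p" "p < ?m" and q: "n + ?r \<le> q" "q < ?m" for p q
  proof -
    have "(\<Sum>k<n. ?x $$ (p, k) * form_sign t n k * ?x $$ (q, ?m - 1 - k)) = 0"
      using p by (intro sum.neutral ballI) (simp add: x_zero)
    moreover have "(\<Sum>k<?r. ?x $$ (p, n + k) * form_sign t n (n + k) * ?x $$ (q, ?m - 1 - (n + k))) = 0"
      using p q by (intro sum.neutral ballI) (simp add: x_zero' m)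
    moreover have "(\<Sum>k<n. ?x $$ (p, n + ?r + k) * form_sign t n (n + ?r + k) * ?x $$ (q, ?m - 1 - (n + ?r + k))) = 0"
      using q by (intro sum.neutral ballI) (simp add: x_zero' m)
    ultimately show ?thesis by (simp add: split)
  qed
  have main: "f p q = (if p + q + 1 = ?m then form_sign t n p else 0)" if "p \<le> q" "q < ?m" for p q
  proof -
    have ne: "p + q + 1 \<noteq> ?m" if "q < n + ?r \<and> p < n \<or> n + ?r \<le> q \<and> n \<le> p"
      using that by (auto simp: m)
    show ?thesis
    proof (cases "n + ?r \<le> q")
      case True
      then show ?thesis
        using that ne low[of p q] lowlow[of p q] by (cases "p < n") auto
    next
      case False
      then show ?thesis
        using that ne top[of p q] mid[of p q] midmid[of p q] by (cases "p < n"; cases "q < n") auto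
    qed
  qed
  have sym: "f p q = (if t = Symplectic then - 1 else 1) * f q p" for p q
    unfolding f_def by (rule form_symmetric)
  have "f p q = (if p + q + 1 = ?m then form_sign t n p else 0)" if "p < ?m" "q < ?m" for p q
  proof (cases "p \<le> q")
    case False
    then have "f p q = (if t = Symplectic then - 1 else 1) * (if q + p + 1 = ?m then form_sign t n q else 0)"
      using main[of q p] that sym[of p q] by simp
    moreover have "q = ?m - Suc p" if "q + p + 1 = ?m" using that by simp
    ultimately show ?thesis
      using form_sign_reflect[OF that(1)] by (auto simp: add.commute)
  qed (use main that in auto)
  then show ?thesis
    unfolding iso_set_iff f_def using xU by blast
qed

lemma Um_rows_cancel:
  fixes a :: "'a :: {field, finite} mat"
  assumes a: "a \<in> Um n" and zero: "\<And>p. p < n \<Longrightarrow> (\<Sum>i<n. a $$ (p, i) * N i) = 0" and i: "i < n"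
  shows "N i = 0"
proof -
  let ?b = "inv\<^bsub>unitriangular_group n\<^esub> a"
  have "0 = (\<Sum>p<n. ?b $$ (i, p) * (\<Sum>j<n. a $$ (p, j) * N j))"
    by (simp add: zero)
  also have "\<dots> = (\<Sum>j<n. (\<Sum>p<n. ?b $$ (i, p) * a $$ (p, j)) * N j)"
    unfolding sum_distrib_left sum_distrib_right by (subst sum.swap) (simp add: mult.assoc)
  also have "\<dots> = (\<Sum>j<n. if i = j then N j else 0)"
    by (intro sum.cong refl) (use i in \<open>simp add: Um_mult_inv_index[OF a]\<close>)
  also have "\<dots> = N i" using i by simp
  finally show ?thesis by simp
qed

text \<open>Pairing row \<open>p < n\<close>, a unit vector, with row \<open>b\<close> reads off the
  entry of \<open>g\<close> in row \<open>b\<close> and column \<open>m - 1 - p\<close>, so the last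
  \<open>n\<close> columns are forced. What triangularity then leaves open lies strictly above the
  diagonal of the middle block, which has size at most 1.\<close>

lemma iso_set_top_identity:
  assumes g: "g \<in> iso_set t n"
    and top: "\<And>p k. p < n \<Longrightarrow> k < dimn t n \<Longrightarrow> g $$ (p, k) = (if p = k then 1 else 0)"
  shows "g = 1\<^sub>m (dimn t n)"
proof -
  let ?m = "dimn t n"
  have gU: "g \<in> Um ?m" using g by (simp add: iso_set_def)
  have last: "g $$ (b, c) = (if b = c then 1 else 0)" if b: "b < ?m" and c: "n + middle t \<le> c" "c < ?m" for b c
  proof -
    define p where "p = ?m - 1 - c"
    have p: "p < n" "p < ?m" "?m - 1 - p = c" using c by (auto simp: p_def dimn_def)
    have "(\<Sum>k<?m. g $$ (p, k) * form_sign t n k * g $$ (b, ?m - 1 - k)) =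
        (\<Sum>k<?m. if k = p then g $$ (b, c) else 0)"
      using p by (intro sum.cong refl) (auto simp: top form_sign_def)
    also have "\<dots> = g $$ (b, c)" using p by simp
    finally have "g $$ (b, c) = (if p + b + 1 = ?m then form_sign t n p else 0)"
      using g p b by (auto simp: iso_set_iff)
    moreover have "p + b + 1 = ?m \<longleftrightarrow> b = c" using p b c by (auto simp: p_def)
    ultimately show ?thesis using p by (simp add: form_sign_def)
  qed
  have "g $$ (b, c) = (if b = c then 1 else 0)" if b: "b < ?m" and c: "c < ?m" for b c
  proof -
    consider "b < n" | "n + middle t \<le> c" | "c \<le> b" | "n \<le> b" "b < c" "c < n + middle t"
      by linarith
    then show ?thesis
    proof cases
      case 3
      then show ?thesis using gU b by (auto simp: Um_iff)
    next
      case 4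
      then show ?thesis by (auto simp: middle_def split: if_splits)
    qed (use top last b c in auto)
  qed
  then show ?thesis
    using gU by (intro eq_matI) (auto simp: Um_iff)
qed

lemma iso_set_determined:
  fixes x y :: "'a :: {field, finite} mat"
  assumes x: "x \<in> iso_set t n" and y: "y \<in> iso_set t n"
    and top: "\<And>p k. p < n \<Longrightarrow> k < dimn t n \<Longrightarrow> x $$ (p, k) = y $$ (p, k)"
  shows "x = y"
proof -
  let ?m = "dimn t n"
  interpret group "\<lparr>carrier = iso_set t n :: 'a mat set, mult = (*), one = 1\<^sub>m ?m\<rparr>"
    by (rule iso_set_group)
  have carrier: "w \<in> carrier_mat ?m ?m" if "w \<in> iso_set t n" for w :: "'a mat"
    using that by (auto simp: iso_set_def dest: Um_carrier)
  obtain y' where y': "y' \<in> iso_set t n" "y * y' = 1\<^sub>m ?m" "y' * y = 1\<^sub>m ?m"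
    using inv_closed[of y] r_inv[of y] l_inv[of y] y by auto
  have "x * y' = 1\<^sub>m ?m"
  proof (rule iso_set_top_identity)
    show "x * y' \<in> iso_set t n" by (rule iso_set_mult[OF x y'(1)])
    fix p k assume p: "p < n" and k: "k < ?m"
    then have p': "p < ?m" by (simp add: dimn_def)
    have "(x * y') $$ (p, k) = (y * y') $$ (p, k)"
      unfolding mat_mult_index[OF carrier[OF x] carrier[OF y'(1)] p' k]
        mat_mult_index[OF carrier[OF y] carrier[OF y'(1)] p' k]
      using top[OF p] by simp
    then show "(x * y') $$ (p, k) = (if p = k then 1 else 0)"
      using p' k by (simp only: y'(2) index_one_mat)
  qed
  then have "y = x * y' * y"
    using carrier[OF y] by simp
  also have "\<dots> = x"
    using carrier[OF x] carrier[OF y] carrier[OF y'(1)] y'(3) by (simp add: assoc_mult_mat[of _ ?m ?m _ ?m _ ?m])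
  finally show ?thesis by simp
qed

text \<open>For the hard inclusion \<open>a\<close>, \<open>u\<close> and \<open>z\<close> are read
  off the first \<open>n\<close> rows of an isometry. Its top block gives a M a^T = 0, so M = 0
  after cancelling \<open>a\<close> on both sides, which is \<open>U_cond\<close>. The block matrix
  with these data is an isometry with the same first \<open>n\<close> rows, hence equal to
  \<open>x\<close>.\<close>

lemma U_carrier: "carrier (U_group t n :: 'a :: {field, finite} mat monoid) = iso_set t n"
proof
  show "carrier (U_group t n :: 'a mat monoid) \<subseteq> iso_set t n"
    by (auto simp: U_group_def intro!: U_block_form)
  show "iso_set t n \<subseteq> carrier (U_group t n :: 'a mat monoid)"
  proof
    fix x :: "'a mat" assume x: "x \<in> iso_set t n"
    let ?m = "dimn t n" and ?r = "middle t"
    have xU: "x \<in> Um ?m" using x by (simp add: iso_set_def)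
    define a b c where "a = mat n n (\<lambda>p. x $$ p)"
      and "b = mat n ?r (\<lambda>(i, k). x $$ (i, n + k))"
      and "c = mat n n (\<lambda>(i, k). x $$ (i, n + ?r + k))"
    have a: "a \<in> Um n"
      using xU by (auto simp: a_def Um_iff dimn_def)
    let ?a' = "inv\<^bsub>unitriangular_group n\<^esub> a"
    define u z where "u = ?a' * b" and "z = ?a' * c"
    have bc: "b \<in> carrier_mat n ?r" "c \<in> carrier_mat n n" by (auto simp: b_def c_def)
    have a': "?a' \<in> carrier_mat n n" using Um_inv(1)[OF a] by (rule Um_carrier)
    have uz: "u \<in> carrier_mat n ?r" "z \<in> carrier_mat n n"
      using a' bc by (auto simp: u_def z_def intro!: mult_carrier_mat)
    have "a * u = a * ?a' * b" "a * z = a * ?a' * c"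
      using assoc_mult_mat[OF Um_carrier[OF a] a'] bc by (auto simp: u_def z_def)
    then have au: "a * u = b" and az: "a * z = c"
      using bc by (simp_all add: Um_inv(2)[OF a])
    let ?M = "\<lambda>i j. z $$ (j, n - 1 - i) + (if t = Symplectic then - 1 else 1) * z $$ (i, n - 1 - j) +
        (\<Sum>k<?r. u $$ (i, k) * u $$ (j, k))"
    have "(\<Sum>i<n. \<Sum>j<n. a $$ (p, i) * a $$ (q, j) * ?M i j) = 0" if pq: "p < n" "q < n" for p q
    proof -
      have "(\<Sum>i<n. \<Sum>j<n. a $$ (p, i) * a $$ (q, j) * ?M i j) =
          (\<Sum>k<?m. x $$ (p, k) * form_sign t n k * x $$ (q, ?m - 1 - k))"
        by (rule form_top_block[OF Um_carrier[OF xU] Um_carrier[OF a] uz, symmetric])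
           (use pq in \<open>auto simp: au az, auto simp: a_def b_def c_def\<close>)
      also have "\<dots> = 0"
        using x pq by (auto simp: iso_set_iff dimn_def)
      finally show ?thesis .
    qed
    then have "(\<Sum>i<n. a $$ (p, i) * (\<Sum>j<n. a $$ (q, j) * ?M i j)) = 0" if "p < n" "q < n" for p q
      using that by (simp only: sum_distrib_left mult.assoc)
    then have "(\<Sum>j<n. a $$ (q, j) * ?M i j) = 0" if "i < n" "q < n" for i q
      using Um_rows_cancel[OF a, of "\<lambda>i. \<Sum>j<n. a $$ (q, j) * ?M i j" i] that by blast
    then have "?M i j = 0" if "i < n" "j < n" for i j
      using Um_rows_cancel[OF a, of "?M i" j] that by blast
    then have cond: "U_cond t n u z"
      unfolding U_cond_iff[OF uz] by blast
    have "x = U_block n ?r a u z"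
    proof (rule iso_set_determined[OF x U_block_form[OF a uz cond]])
      fix p k assume "p < n" "k < ?m"
      then show "x $$ (p, k) = U_block n ?r a u z $$ (p, k)"
        by (subst U_block_index[OF a uz])
           (auto simp: au az dimn_blocks, auto simp: a_def b_def c_def)
    qed
    then show "x \<in> carrier (U_group t n)"
      using a uz cond by (auto simp: U_group_def)
  qed
qed

lemma U_group_eq:
  "U_group t n = \<lparr>carrier = iso_set t n :: 'a :: {field, finite} mat set, mult = (*), one = 1\<^sub>m (dimn t n)\<rparr>"
  using U_carrier[of t n, where 'a = 'a] by (simp add: U_group_def)

lemma U_group_group: "group (U_group t n :: 'a :: {field, finite} mat monoid)"
  unfolding U_group_eq by (rule iso_set_group)

lemma U_exists:
  fixes a b :: "'a :: {field, finite} mat"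
  assumes a: "a \<in> Um n" and b: "b \<in> carrier_mat n (middle t)" and two: "(2 :: 'a) \<noteq> 0"
  obtains y where "y \<in> carrier (U_group t n)"
    and "\<And>p k. p < n \<Longrightarrow> k < n \<Longrightarrow> y $$ (p, k) = a $$ (p, k)"
    and "\<And>p k. p < n \<Longrightarrow> k < middle t \<Longrightarrow> y $$ (p, n + k) = b $$ (p, k)"
proof -
  let ?a' = "inv\<^bsub>unitriangular_group n\<^esub> a"
  define u where "u = ?a' * b"
  \<comment> \<open>The required - u u^T is divided equally between the two summands of
    \<open>U_cond\<close>. Without a middle column the sum is empty and
    \<open>z = 0\<close>.\<close>
  define z where "z = mat n n (\<lambda>(i, j). - (1 / 2) * (\<Sum>k<middle t. u $$ (i, k) * u $$ (n - 1 - j, k)))"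
  have a': "?a' \<in> carrier_mat n n" using Um_inv(1)[OF a] by (rule Um_carrier)
  have uz: "u \<in> carrier_mat n (middle t)" "z \<in> carrier_mat n n"
    using a' b by (auto simp: u_def z_def intro!: mult_carrier_mat)
  have "a * u = a * ?a' * b"
    using assoc_mult_mat[OF Um_carrier[OF a] a' b] by (simp add: u_def)
  then have au: "a * u = b"
    using b by (simp add: Um_inv(2)[OF a])
  have half: "- (1 / 2) * s + - (1 / 2) * s + s = 0" for s :: 'a
    using two by (simp add: field_simps)
  have "z $$ (j, n - 1 - i) + (if t = Symplectic then - 1 else 1) * z $$ (i, n - 1 - j) +
      (\<Sum>k<middle t. u $$ (i, k) * u $$ (j, k)) = 0" if ij: "i < n" "j < n" for i j
  proof (cases "t = Odd_Orthogonal")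
    case True
    have "z $$ (j, n - 1 - i) = - (1 / 2) * (\<Sum>k<middle t. u $$ (i, k) * u $$ (j, k))"
      "z $$ (i, n - 1 - j) = - (1 / 2) * (\<Sum>k<middle t. u $$ (i, k) * u $$ (j, k))"
      using ij by (simp_all add: z_def mult.commute)
    then show ?thesis using True half by simp
  next
    case False
    then show ?thesis using ij by (simp add: z_def middle_def)
  qed
  then have cond: "U_cond t n u z"
    unfolding U_cond_iff[OF uz] by blast
  show ?thesis
  proof (rule that)
    show "U_block n (middle t) a u z \<in> carrier (U_group t n)"
      using a uz cond by (auto simp: U_group_def)
  qed (auto simp: U_block_index[OF a uz] au)
qed

section \<open>Induced characters\<close>

text \<open>The function \<open>f\<close> labels the cosets H y. Each label is taken
  \<open>card H\<close> times, which cancels the denominator and leaves one summand per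
  label.\<close>

lemma induced_char_fibers:
  fixes G (structure)
  assumes G: "group G" and fin: "finite (carrier G)" and H: "H \<subseteq> carrier G"
    and fib: "\<And>y y'. y \<in> carrier G \<Longrightarrow> y' \<in> carrier G \<Longrightarrow> f y = f y' \<longleftrightarrow> y \<otimes> inv y' \<in> H"
    and mem: "\<And>y. y \<in> carrier G \<Longrightarrow> y \<otimes> x \<otimes> inv y \<in> H \<longleftrightarrow> Q (f y)"
    and val: "\<And>y. y \<in> carrier G \<Longrightarrow> Q (f y) \<Longrightarrow> \<chi> (y \<otimes> x \<otimes> inv y) = V (f y)"
  shows "induced_char G H \<chi> x = (\<Sum>p\<in>{p \<in> f ` carrier G. Q p}. V p)"
proof -
  interpret group G by (rule G)
  let ?S = "{y \<in> carrier G. Q (f y)}"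
  have card_fib: "card {y \<in> ?S. f y = p} = card H" if p: "p \<in> f ` ?S" for p
  proof -
    obtain y where y: "y \<in> carrier G" "Q (f y)" "p = f y"
      using p by auto
    have "bij_betw (\<lambda>h. h \<otimes> y) H {y' \<in> ?S. f y' = p}"
    proof (rule bij_betw_byWitness[where f' = "\<lambda>y'. y' \<otimes> inv y"])
      show "\<forall>h\<in>H. h \<otimes> y \<otimes> inv y = h"
        using H y by (auto simp: m_assoc)
      show "\<forall>y'\<in>{y' \<in> ?S. f y' = p}. y' \<otimes> inv y \<otimes> y = y'"
        using y by (auto simp: m_assoc)
      show "(\<lambda>h. h \<otimes> y) ` H \<subseteq> {y' \<in> ?S. f y' = p}"
      proof
        fix y' assume "y' \<in> (\<lambda>h. h \<otimes> y) ` H"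
        then obtain h where h: "h \<in> H" "y' = h \<otimes> y" by auto
        then have "h \<in> carrier G" "y' \<otimes> inv y = h" using H y by (auto simp: m_assoc)
        then have "y' \<in> carrier G" "f y' = f y" using h y fib[of y' y] by auto
        then show "y' \<in> {y' \<in> ?S. f y' = p}" using y by auto
      qed
      show "(\<lambda>y'. y' \<otimes> inv y) ` {y' \<in> ?S. f y' = p} \<subseteq> H"
        using fib y by auto
    qed
    then show ?thesis by (simp add: bij_betw_same_card)
  qed
  have one: "\<one> \<in> H"
    using fib[of \<one> \<one>] by simp
  then have "card H \<noteq> 0"
    using finite_subset[OF H fin] by auto
  have "(\<Sum>y\<in>{y \<in> carrier G. y \<otimes> x \<otimes> inv y \<in> H}. \<chi> (y \<otimes> x \<otimes> inv y)) = (\<Sum>y\<in>?S. V (f y))"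
    by (rule sum.cong) (auto simp: mem val)
  also have "\<dots> = (\<Sum>p\<in>f ` ?S. \<Sum>y\<in>{y \<in> ?S. f y = p}. V (f y))"
    using fin by (subst sum.image_gen[of ?S _ f]) auto
  also have "\<dots> = (\<Sum>p\<in>f ` ?S. of_nat (card H) * V p)"
  proof (rule sum.cong[OF refl])
    fix p assume p: "p \<in> f ` ?S"
    have "(\<Sum>y\<in>{y \<in> ?S. f y = p}. V (f y)) = (\<Sum>y\<in>{y \<in> ?S. f y = p}. V p)"
      by (rule sum.cong) auto
    then show "(\<Sum>y\<in>{y \<in> ?S. f y = p}. V (f y)) = of_nat (card H) * V p"
      by (simp only: sum_constant card_fib[OF p])
  qed
  also have "\<dots> = of_nat (card H) * (\<Sum>p\<in>f ` ?S. V p)"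
    by (simp add: sum_distrib_left)
  also have "f ` ?S = {p \<in> f ` carrier G. Q p}" by auto
  finally show ?thesis
    using \<open>card H \<noteq> 0\<close> by (simp add: induced_char_def)
qed

text \<open>Row \<open>i\<close> of \<open>h * y\<close> is row \<open>i\<close> of \<open>y\<close>
  plus multiples of later rows. As \<open>y\<close> is unitriangular, the first such row with a
  nonzero coefficient changes the product in its own column, by exactly that coefficient.\<close>

lemma Um_row_agree:
  assumes h: "h \<in> Um m" and y: "y \<in> Um m" and i: "i < m" and c: "c \<le> m"
  shows "(\<forall>k. i < k \<and> k < c \<longrightarrow> h $$ (i, k) = 0) \<longleftrightarrow> (\<forall>k<c. (h * y) $$ (i, k) = y $$ (i, k))"
    and "(\<forall>k. i < k \<and> k < c \<longrightarrow> h $$ (i, k) = 0) \<Longrightarrow> i < c \<Longrightarrow> c < m \<Longrightarrow>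
      (h * y) $$ (i, c) = y $$ (i, c) + h $$ (i, c)"
proof -
  have step: "(h * y) $$ (i, k) = (if i < k then y $$ (i, k) + h $$ (i, k) else y $$ (i, k))"
    if k: "k < m" and zero: "\<forall>l. i < l \<and> l < k \<longrightarrow> h $$ (i, l) = 0" for k
  proof -
    have "(h * y) $$ (i, k) = (\<Sum>l<m. (if l = i then y $$ (i, k) else 0) +
        (if l = k then if i < k then h $$ (i, k) else 0 else 0))"
      unfolding mat_mult_index[OF Um_carrier[OF h] Um_carrier[OF y] i k]
    proof (rule sum.cong[OF refl])
      fix l assume "l \<in> {..<m}"
      then show "h $$ (i, l) * y $$ (l, k) = (if l = i then y $$ (i, k) else 0) +
        (if l = k then if i < k then h $$ (i, k) else 0 else 0)"
        using h y i k zero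
        by (cases "l < i"; cases "l = i"; cases "l < k"; cases "l = k") (auto simp: Um_iff)
    qed
    also have "\<dots> = (if i < k then y $$ (i, k) + h $$ (i, k) else y $$ (i, k))"
      using i k by (simp add: sum.distrib)
    finally show ?thesis .
  qed
  show "(\<forall>k. i < k \<and> k < c \<longrightarrow> h $$ (i, k) = 0) \<longleftrightarrow> (\<forall>k<c. (h * y) $$ (i, k) = y $$ (i, k))"
  proof
    assume zero: "\<forall>k. i < k \<and> k < c \<longrightarrow> h $$ (i, k) = 0"
    show "\<forall>k<c. (h * y) $$ (i, k) = y $$ (i, k)"
      using zero c by (auto simp: step simp del: index_mult_mat)
  next
    assume eq: "\<forall>k<c. (h * y) $$ (i, k) = y $$ (i, k)"
    have "i < k \<and> k < c \<longrightarrow> h $$ (i, k) = 0" for k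
    proof (induction k rule: less_induct)
      case (less k)
      show ?case
      proof
        assume k: "i < k \<and> k < c"
        then have "(h * y) $$ (i, k) = y $$ (i, k) + h $$ (i, k)"
          using less c by (subst step) auto
        then show "h $$ (i, k) = 0" using eq k by simp
      qed
    qed
    then show "\<forall>k. i < k \<and> k < c \<longrightarrow> h $$ (i, k) = 0" by blast
  qed
  show "(\<forall>k. i < k \<and> k < c \<longrightarrow> h $$ (i, k) = 0) \<Longrightarrow> i < c \<Longrightarrow> c < m \<Longrightarrow>
      (h * y) $$ (i, c) = y $$ (i, c) + h $$ (i, c)"
    by (simp add: step del: index_mult_mat)
qed

abbreviation (input) entries_of :: "'a mat \<Rightarrow> nat \<Rightarrow> nat \<Rightarrow> 'a" where
  "entries_of x \<equiv> \<lambda>k l. x $$ (k, l)"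

definition row_part :: "nat \<Rightarrow> nat \<Rightarrow> 'a :: zero mat \<Rightarrow> nat \<Rightarrow> 'a" where
  "row_part i c y = (\<lambda>k. if k < c then y $$ (i, k) else 0)"

lemma row_part_eq_iff: "row_part i c y = row_part i c y' \<longleftrightarrow> (\<forall>k<c. y $$ (i, k) = y' $$ (i, k))"
  by (auto simp: row_part_def fun_eq_iff)

lemma mult_eq_act:
  assumes "x \<in> carrier_mat m m" and "y \<in> carrier_mat m m" and "i < m" and "k < m"
  shows "(y * x) $$ (i, k) = act m (entries_of x) (\<lambda>l. y $$ (i, l)) k"
  using mat_mult_index[OF assms(2,1,3,4)] by (simp add: act_def)

locale matrix_subgroup = additive_char \<theta> for \<theta> :: "'a :: {field, finite} \<Rightarrow> complex" +
  fixes m :: nat and G :: "'a mat monoid" (structure)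
  assumes G: "group G" and mult: "mult G = (*)" and sub: "carrier G \<subseteq> Um m"
begin

lemma finite_carrier: "finite (carrier G)"
  using sub by (rule finite_subset[OF _ finite_subset[OF _ finite_carrier_mat[of m m]]])
    (auto dest: Um_carrier)

lemma unitri: "x \<in> carrier G \<Longrightarrow> unitri \<theta> m (entries_of x)"
  using sub by unfold_locales (auto simp: Um_iff)

lemma conj_mult:
  assumes "x \<in> carrier G" and "y \<in> carrier G"
  shows "(y \<otimes> x \<otimes> inv y) * y = y * x"
proof -
  interpret group G by (rule G)
  have "(y \<otimes> x \<otimes> inv y) \<otimes> y = y \<otimes> x"
    using assms by (simp add: m_assoc)
  then show ?thesis by (simp add: mult)
qed

lemma quot_mult:
  assumes "y \<in> carrier G" and "y' \<in> carrier G"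
  shows "(y \<otimes> inv y') * y' = y"
proof -
  interpret group G by (rule G)
  have "(y \<otimes> inv y') \<otimes> y' = y"
    using assms by (simp add: m_assoc)
  then show ?thesis by (simp add: mult)
qed

lemma closed:
  assumes "y \<in> carrier G" and "y' \<in> carrier G" and "x \<in> carrier G"
  shows "y \<otimes> inv y' \<in> carrier G" and "y \<otimes> x \<otimes> inv y \<in> carrier G"
proof -
  interpret group G by (rule G)
  show "y \<otimes> inv y' \<in> carrier G" and "y \<otimes> x \<otimes> inv y \<in> carrier G"
    using assms by auto
qed

lemma quot_row:
  assumes y: "y \<in> carrier G" and y': "y' \<in> carrier G" and "i < m" and "c \<le> m"
  shows "row_part i c y = row_part i c y' \<longleftrightarrow>
    (\<forall>k. i < k \<and> k < c \<longrightarrow> (y \<otimes> inv y') $$ (i, k) = 0)"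
  using Um_row_agree(1)[of "y \<otimes> inv y'" m y' i c] closed(1)[OF y y' y] assms sub
  by (auto simp: row_part_eq_iff quot_mult)

lemma conj_row:
  assumes x: "x \<in> carrier G" and y: "y \<in> carrier G" and "i < c" and "c \<le> m"
  shows "(\<forall>k. i < k \<and> k < c \<longrightarrow> (y \<otimes> x \<otimes> inv y) $$ (i, k) = 0) \<longleftrightarrow>
    row_part i c y \<in> leadr m (entries_of x) i 1 c"
proof -
  interpret unitri \<theta> m "entries_of x" by (rule unitri[OF x])
  have xy: "x \<in> carrier_mat m m" "y \<in> carrier_mat m m" "y \<in> Um m"
    using x y sub by (auto dest: Um_carrier)
  have "(\<forall>k. i < k \<and> k < c \<longrightarrow> (y \<otimes> x \<otimes> inv y) $$ (i, k) = 0) \<longleftrightarrow>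
      (\<forall>k<c. (y * x) $$ (i, k) = y $$ (i, k))"
    using Um_row_agree(1)[of "y \<otimes> x \<otimes> inv y" m y i c] closed(2)[OF y y x] assms sub
    by (auto simp: conj_mult)
  also have "\<dots> \<longleftrightarrow> (\<forall>k<c. A (\<lambda>l. y $$ (i, l)) k = y $$ (i, k))"
    using assms mult_eq_act[OF xy(1,2)] by (auto simp del: index_mult_mat)
  also have "\<dots> \<longleftrightarrow> (\<forall>k<c. A (row_part i c y) k = row_part i c y k)"
    using assms by (auto simp: row_part_def act_trunc)
  also have "\<dots> \<longleftrightarrow> row_part i c y \<in> leadr m (entries_of x) i 1 c"
    using assms xy(3) by (auto simp: leadr_def row_part_def Um_iff)
  finally show ?thesis .
qed

lemma conj_entry:
  assumes x: "x \<in> carrier G" and y: "y \<in> carrier G" and i: "i < c" and c: "c < m"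
    and zero: "\<forall>k. i < k \<and> k < c \<longrightarrow> (y \<otimes> x \<otimes> inv y) $$ (i, k) = 0"
  shows "(y \<otimes> x \<otimes> inv y) $$ (i, c) = act m (entries_of x) (row_part i c y) c"
proof -
  interpret unitri \<theta> m "entries_of x" by (rule unitri[OF x])
  have xy: "x \<in> carrier_mat m m" "y \<in> carrier_mat m m"
    using x y sub by (auto dest: Um_carrier)
  have "(y * x) $$ (i, c) = y $$ (i, c) + (y \<otimes> x \<otimes> inv y) $$ (i, c)"
    using Um_row_agree(2)[of "y \<otimes> x \<otimes> inv y" m y i c] closed(2)[OF y y x] y i c sub zero
    by (auto simp: conj_mult[OF x y] simp del: index_mult_mat)
  then show ?thesis
    using mult_eq_act[OF xy, of i c] i c by (simp add: row_part_def act_trunc_next)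
qed

text \<open>The label of a coset is row \<open>i\<close> of \<open>y\<close> cut at
  \<open>c\<close>, and (y x y^-1) y = y x turns membership of the conjugate into fixedness of the
  label. The assumption \<open>rich\<close> says that every candidate vector is a label.\<close>

lemma induced_row:
  assumes x: "x \<in> carrier G" and i: "i < c" and c: "c < m"
    and rich: "\<And>v. \<lbrakk>v i = 1; \<And>k. k < i \<or> c \<le> k \<Longrightarrow> v k = 0\<rbrakk> \<Longrightarrow> \<exists>y\<in>carrier G. row_part i c y = v"
  shows "induced_char G {g \<in> carrier G. \<forall>k. i < k \<and> k < c \<longrightarrow> g $$ (i, k) = 0}
      (\<lambda>g. \<theta> (r * g $$ (i, c))) x = Zs m \<theta> (entries_of x) i c r"
proof -
  let ?L = "leadr m (entries_of x) i 1 c"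
  have "induced_char G {g \<in> carrier G. \<forall>k. i < k \<and> k < c \<longrightarrow> g $$ (i, k) = 0}
      (\<lambda>g. \<theta> (r * g $$ (i, c))) x =
      (\<Sum>v\<in>{v \<in> row_part i c ` carrier G. v \<in> ?L}. \<theta> (r * act m (entries_of x) v c))"
  proof (rule induced_char_fibers[OF G finite_carrier])
    fix y y' assume "y \<in> carrier G" "y' \<in> carrier G"
    then show "row_part i c y = row_part i c y' \<longleftrightarrow>
        y \<otimes> inv y' \<in> {g \<in> carrier G. \<forall>k. i < k \<and> k < c \<longrightarrow> g $$ (i, k) = 0}"
      using quot_row[of y y' i c] closed(1)[of y y' y] i c by auto
  next
    fix y assume y: "y \<in> carrier G"
    show "y \<otimes> x \<otimes> inv y \<in> {g \<in> carrier G. \<forall>k. i < k \<and> k < c \<longrightarrow> g $$ (i, k) = 0} \<longleftrightarrow>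
        row_part i c y \<in> ?L"
      using conj_row[OF x y i] closed(2)[OF y y x] c by auto
    assume "row_part i c y \<in> ?L"
    then show "\<theta> (r * (y \<otimes> x \<otimes> inv y) $$ (i, c)) = \<theta> (r * act m (entries_of x) (row_part i c y) c)"
      using conj_row[OF x y i] conj_entry[OF x y i c] c by auto
  qed auto
  also have "{v \<in> row_part i c ` carrier G. v \<in> ?L} = ?L"
    using rich by (fastforce simp: leadr_def)
  finally show ?thesis by (simp add: Zs_def)
qed

end

text \<open>Only the truncations of the two rows are fixed, yet the discarded ends do not matter.
  The mixed terms of \<open>bf (A p) q\<close> equal those of \<open>bf p q\<close>, which is 0, and
  the two ends do not meet. What remains is the pairing of the truncations.\<close>

lemma (in isometry) bf_truncate:
  assumes m: "m = n + n'" and nn: "n \<le> n'" and \<sigma>: "\<And>k. n \<le> k \<Longrightarrow> k < m \<Longrightarrow> s k = \<sigma>"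
    and v: "v = (\<lambda>k. if k < n then p k else 0)" and w: "w = (\<lambda>k. if k < n' then q k else 0)"
    and fv: "\<And>k. k < n \<Longrightarrow> A v k = v k" and fw: "\<And>k. k < n' \<Longrightarrow> A w k = w k"
    and zero: "bf p q = 0"
  shows "bf (A p) q = \<sigma> * bq n v w"
proof -
  define v' w' where "v' = (\<lambda>k. p k - v k)" and "w' = (\<lambda>k. q k - w k)"
  have vanish: "bf f g = 0" if "\<And>k. k < n \<Longrightarrow> f k = 0" "\<And>k. k < n' \<Longrightarrow> g k = 0" for f g
    unfolding bf_def
  proof (intro sum.neutral ballI)
    fix k assume "k \<in> {..<m}"
    then have "k < n \<or> m - 1 - k < n'" by (auto simp: m)
    then show "f k * s k * g (m - 1 - k) = 0" using that by auto
  qed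
  have vanish': "bf f g = 0" if "\<And>k. n \<le> k \<Longrightarrow> f k = 0" "\<And>k. n' \<le> k \<Longrightarrow> g k = 0" for f g
    unfolding bf_def
  proof (intro sum.neutral ballI)
    fix k assume "k \<in> {..<m}"
    then have "n \<le> k \<or> n' \<le> m - 1 - k" by (auto simp: m)
    then show "f k * s k * g (m - 1 - k) = 0" using that by auto
  qed
  have p: "p = (\<lambda>k. v k + v' k)" and q: "q = (\<lambda>k. w k + w' k)"
    by (simp_all add: v'_def w'_def)
  have v'0: "v' k = 0" if "k < n" for k using that by (simp add: v'_def v)
  have w'0: "w' k = 0" if "k < n'" for k using that by (simp add: w'_def w)
  have add: "bf (\<lambda>k. f k + g k) h = bf f h + bf g h" for f g h
    by (simp add: bf_def sum.distrib distrib_right)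
  have sub: "bf (\<lambda>k. f k - g k) h = bf f h - bf g h" for f g h
    by (simp add: bf_def sum_subtractf left_diff_distrib)
  have Av': "A v' k = 0" if "k < n" for k
    unfolding act_def
    by (intro sum.neutral ballI) (use that low[of k] v'0 m in \<open>auto simp: not_less[symmetric]\<close>,
        metis le_less_trans linorder_not_less lessThan_iff mult_zero_left mult_zero_right)
  have "bf v w' + bf v' w = bf p q"
    unfolding p q bf_add_right add
    using vanish[of v' w'] v'0 w'0 vanish'[of v w] by (simp add: v w)
  moreover have "bf (A v) w' = bf v w'"
  proof -
    have "bf (\<lambda>k. A v k - v k) w' = 0"
      by (rule vanish) (simp_all add: fv w'0)
    then show ?thesis by (simp add: sub)
  qed
  moreover have "bf (A v') w = bf v' w"
  proof -
    have "bf (A v') (\<lambda>k. A w k - w k) = 0"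
      by (rule vanish) (simp_all add: fw Av')
    then show ?thesis by (simp add: bf_diff_right bf_act)
  qed
  moreover have "bf (A v') w' = 0"
    by (rule vanish) (simp_all add: Av' w'0)
  moreover have "bf (A v) w = \<sigma> * bq n v w"
  proof -
    have "bf (A v) w = (\<Sum>k\<in>{n..<m}. A v k * s k * w (m - 1 - k))"
      unfolding bf_def by (rule sum.mono_neutral_right) (auto simp: m w)
    also have "\<dots> = (\<Sum>k\<in>{n..<m}. \<sigma> * (A v k * w (m - 1 - k)))"
      by (rule sum.cong) (auto simp: \<sigma>)
    finally show ?thesis by (simp add: bq_def sum_distrib_left)
  qed
  ultimately show ?thesis
    unfolding zero unfolding p q act_add bf_add_right add by (simp add: add.commute)
qed

locale U_context = additive_char \<theta> for \<theta> :: "'a :: {field, finite} \<Rightarrow> complex" +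
  fixes t :: family and n :: nat
  assumes two: "(2 :: 'a) \<noteq> 0"
begin

abbreviation "m \<equiv> dimn t n"
abbreviation "U \<equiv> U_group t n :: 'a mat monoid"
abbreviation "Ze \<equiv> \<lambda>x :: 'a mat. Zs m \<theta> (\<lambda>k l. x $$ (k, l))"

lemma U_subgroup: "matrix_subgroup \<theta> m U"
proof (rule matrix_subgroup.intro[OF additive_char_axioms], rule matrix_subgroup_axioms.intro)
  show "carrier U \<subseteq> Um m" by (auto simp: U_carrier iso_set_def)
qed (rule U_group_group, simp_all add: U_group_def)

lemma Um_subgroup: "matrix_subgroup \<theta> m (unitriangular_group m)"
  by (rule matrix_subgroup.intro[OF additive_char_axioms], rule matrix_subgroup_axioms.intro)
     (rule Um_group, simp_all add: unitriangular_group_def)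

lemma U_iso:
  assumes "x \<in> carrier U"
  shows "isometry \<theta> m (\<lambda>k l. x $$ (k, l)) (form_sign t n)"
proof -
  interpret G: matrix_subgroup \<theta> m U by (rule U_subgroup)
  show ?thesis
    using assms unfolding U_carrier iso_set_iff
    by (intro isometry.intro[OF G.unitri[OF assms]] isometry_axioms.intro)
       (auto simp: form_sign_def split: if_splits)
qed

lemma U_symplectic:
  assumes "x \<in> carrier U" and "t = Symplectic"
  shows "symplectic_isometry \<theta> m (\<lambda>k l. x $$ (k, l)) (form_sign t n) n"
proof -
  show ?thesis
    using assms two
    by (intro symplectic_isometry.intro[OF U_iso[OF assms(1)]] symplectic_isometry_axioms.intro)
       (auto simp: form_sign_def dimn_def middle_def)
qed

text \<open>Covers the roots \<epsilon> + \<epsilon>' and, with \<open>i = j\<close>, also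
  2\<epsilon>. The label is a pair of truncated rows; on it the linear character takes the value of
  the pairing \<open>bq\<close>.\<close>

lemma induced_pair:
  assumes x: "x \<in> carrier U" and i: "i < n" and j: "j < n"
  defines "f \<equiv> \<lambda>y. (row_part i n y, row_part j (n + middle t) y)"
  shows "induced_char U
      {g \<in> carrier U. (\<forall>k. i < k \<and> k < n \<longrightarrow> g $$ (i, k) = 0) \<and>
         (\<forall>k. j < k \<and> k < n + middle t \<longrightarrow> g $$ (j, k) = 0)}
      (\<lambda>g. \<theta> (r * g $$ (i, m - 1 - j))) x =
    (\<Sum>p\<in>{p \<in> f ` carrier U. fst p \<in> leadr m (\<lambda>k l. x $$ (k, l)) i 1 n \<and>
        snd p \<in> leadr m (\<lambda>k l. x $$ (k, l)) j 1 (n + middle t)}.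
      \<theta> (r * isometry.bq m (\<lambda>k l. x $$ (k, l)) n (fst p) (snd p)))"
proof -
  interpret G: matrix_subgroup \<theta> m U by (rule U_subgroup)
  interpret isometry \<theta> m "\<lambda>k l. x $$ (k, l)" "form_sign t n" using x by (rule U_iso)
  let ?n' = "n + middle t"
  let ?H = "{g \<in> carrier U. (\<forall>k. i < k \<and> k < n \<longrightarrow> g $$ (i, k) = 0) \<and>
         (\<forall>k. j < k \<and> k < ?n' \<longrightarrow> g $$ (j, k) = 0)}"
  have dim: "n \<le> m" "?n' \<le> m" "i < m" "j < m" "j < ?n'" and m: "m = n + ?n'"
    and ne: "i + j + 1 \<noteq> m" and nj: "n \<le> m - 1 - j"
    using i j by (auto simp: dimn_def)
  show ?thesis
  proof (rule induced_char_fibers[OF G.G G.finite_carrier])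
    fix y y' assume y: "y \<in> carrier U" and y': "y' \<in> carrier U"
    show "f y = f y' \<longleftrightarrow> y \<otimes>\<^bsub>U\<^esub> inv\<^bsub>U\<^esub> y' \<in> ?H"
      using G.quot_row[OF y y'] G.closed(1)[OF y y' y] dim by (simp add: f_def)
  next
    fix y assume y: "y \<in> carrier U"
    let ?g = "y \<otimes>\<^bsub>U\<^esub> x \<otimes>\<^bsub>U\<^esub> inv\<^bsub>U\<^esub> y"
    have g: "?g \<in> carrier U" using G.closed(2)[OF y y x] .
    show "?g \<in> ?H \<longleftrightarrow> fst (f y) \<in> L i 1 n \<and> snd (f y) \<in> L j 1 ?n'"
      using G.conj_row[OF x y] g dim i by (simp add: f_def)
    assume fixed: "fst (f y) \<in> L i 1 n \<and> snd (f y) \<in> L j 1 ?n'"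
    let ?\<sigma> = "form_sign t n (m - 1 - j) :: 'a"
    have c: "x \<in> carrier_mat m m" "y \<in> carrier_mat m m" "?g \<in> carrier_mat m m"
      using x y g G.sub by (auto dest: Um_carrier)
    have y_form: "(\<Sum>k<m. y $$ (a, k) * form_sign t n k * y $$ (b, m - 1 - k)) =
        (if a + b + 1 = m then form_sign t n a else 0)" if "a < m" "b < m" for a b
      using y that unfolding U_carrier iso_set_iff by blast
    have sig: "?\<sigma> * ?\<sigma> = 1" "form_sign t n k = ?\<sigma>" if "n \<le> k" for k
      using that nj by (auto simp: form_sign_def)
    have "bf (A (\<lambda>l. y $$ (i, l))) (\<lambda>l. y $$ (j, l)) = ?\<sigma> * bq n (fst (f y)) (snd (f y))"
    proof (rule bf_truncate[where n' = ?n'])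
      show "m = n + ?n'" "n \<le> ?n'" using m by auto
      show "form_sign t n k = ?\<sigma>" if "n \<le> k" "k < m" for k using sig(2)[OF that(1)] .
      show "fst (f y) = (\<lambda>k. if k < n then y $$ (i, k) else 0)"
        "snd (f y) = (\<lambda>k. if k < ?n' then y $$ (j, k) else 0)"
        by (simp_all add: f_def row_part_def)
      show "A (fst (f y)) k = fst (f y) k" if "k < n" for k
        using fixed that by (auto simp: leadr_def)
      show "A (snd (f y)) k = snd (f y) k" if "k < ?n'" for k
        using fixed that by (auto simp: leadr_def)
      show "bf (\<lambda>l. y $$ (i, l)) (\<lambda>l. y $$ (j, l)) = 0"
        using y_form[OF dim(3,4)] ne by (simp add: bf_def)
    qed
    \<comment> \<open>Row \<open>i\<close> of \<open>?g * y = y * x\<close> is paired with row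
      \<open>j\<close> of \<open>y\<close>. Among the rows of the isometry \<open>y\<close> only the
      one at \<open>m - 1 - j\<close> is not orthogonal to row \<open>j\<close>, so a single entry
      of \<open>?g\<close> survives.\<close>
    moreover have "bf (A (\<lambda>l. y $$ (i, l))) (\<lambda>l. y $$ (j, l)) = ?g $$ (i, m - 1 - j) * ?\<sigma>"
    proof -
      have "bf (A (\<lambda>l. y $$ (i, l))) (\<lambda>l. y $$ (j, l)) =
          (\<Sum>k<m. (?g * y) $$ (i, k) * form_sign t n k * y $$ (j, m - 1 - k))"
        unfolding bf_def G.conj_mult[OF x y]
        by (rule sum.cong) (use mult_eq_act[OF c(1,2) dim(3)] in auto)
      also have "\<dots> = (\<Sum>k<m. \<Sum>l<m. ?g $$ (i, l) * (y $$ (l, k) * form_sign t n k * y $$ (j, m - 1 - k)))"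
        by (rule sum.cong) (auto simp: mat_mult_index[OF c(3,2) dim(3)] sum_distrib_right mult.assoc
            simp del: index_mult_mat)
      also have "\<dots> = (\<Sum>l<m. ?g $$ (i, l) * (\<Sum>k<m. y $$ (l, k) * form_sign t n k * y $$ (j, m - 1 - k)))"
        unfolding sum_distrib_left by (rule sum.swap)
      also have "\<dots> = (\<Sum>l<m. if l = m - 1 - j then ?g $$ (i, m - 1 - j) * ?\<sigma> else 0)"
        by (rule sum.cong[OF refl], subst y_form) (use dim in auto)
      finally show ?thesis using dim by simp
    qed
    ultimately have "?g $$ (i, m - 1 - j) * (?\<sigma> * ?\<sigma>) = bq n (fst (f y)) (snd (f y)) * (?\<sigma> * ?\<sigma>)"
      by (simp add: mult.commute mult.left_commute)
    then have "?g $$ (i, m - 1 - j) = bq n (fst (f y)) (snd (f y))"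
      by (simp only: sig(1)[OF order.refl] mult_1_right)
    then show "\<theta> (r * ?g $$ (i, m - 1 - j)) = \<theta> (r * bq n (fst (f y)) (snd (f y)))"
      by simp
  qed auto
qed

lemma U_rich:
  assumes i: "i < n" "v i = 1" "\<And>k. k < i \<or> n \<le> k \<Longrightarrow> v k = 0"
    and j: "j < n" "w j = 1" "\<And>k. k < j \<or> n + middle t \<le> k \<Longrightarrow> w k = (0 :: 'a)"
    and ij: "i \<noteq> j \<or> middle t = 0 \<and> v = w"
  obtains y where "y \<in> carrier U" and "row_part i n y = v" and "row_part j (n + middle t) y = w"
proof -
  define a where "a = mat n n (\<lambda>(p, k). if p = i then v k else if p = j then w k
    else if p = k then 1 else 0)"
  define b where "b = mat n (middle t) (\<lambda>(p, k). if p = j then w (n + k) else 0)"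
  have a: "a \<in> Um n" using i j by (auto simp: a_def Um_iff)
  have b: "b \<in> carrier_mat n (middle t)" by (simp add: b_def)
  obtain y where y: "y \<in> carrier U"
    and ya: "\<And>p k. p < n \<Longrightarrow> k < n \<Longrightarrow> y $$ (p, k) = a $$ (p, k)"
    and yb: "\<And>p k. p < n \<Longrightarrow> k < middle t \<Longrightarrow> y $$ (p, n + k) = b $$ (p, k)"
    using U_exists[OF a b two] by blast
  have "row_part i n y = v"
    using i by (auto simp: row_part_def fun_eq_iff ya a_def)
  moreover have "row_part j (n + middle t) y = w"
  proof
    fix k
    consider "k < n" | k' where "k = n + k'" "k' < middle t" | "n + middle t \<le> k"
      by (metis add_less_cancel_left le_Suc_ex linorder_not_less)
    then show "row_part j (n + middle t) y k = w k"
      using ij j by cases (auto simp: row_part_def ya yb a_def b_def)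
  qed
  ultimately show ?thesis using that y by blast
qed

end

section \<open>Roots and positions\<close>

lemma pos_less:
  assumes "k \<in> indices t n"
  shows "pos t n k < dimn t n"
  using assms by (auto simp: indices_def pos_def dimn_def middle_def split: if_splits)

lemma pos_less_iff:
  assumes "k \<in> indices t n" and "l \<in> indices t n"
  shows "pos t n k < pos t n l \<longleftrightarrow> k \<prec> l"
  using assms
  by (auto simp: indices_def pos_def dimn_def middle_def prec_def sgn_if split: if_splits)

lemma pos_inj:
  assumes "k \<in> indices t n" and "l \<in> indices t n" and "pos t n k = pos t n l"
  shows "k = l"
  using assms by (auto simp: indices_def pos_def dimn_def middle_def split: if_splits)

lemma pos_minus:
  assumes "k \<in> indices t n"
  shows "pos t n (- k) = dimn t n - 1 - pos t n k"
  using assms by (auto simp: indices_def pos_def dimn_def middle_def split: if_splits)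

lemma pos_surj:
  assumes "p < dimn t n"
  obtains k where "k \<in> indices t n" and "pos t n k = p"
proof -
  consider "p < n" | "p = n" "t = Odd_Orthogonal" | "n + middle t \<le> p"
  proof -
    have "p < n \<or> p = n \<and> t = Odd_Orthogonal \<or> n + middle t \<le> p"
      by (cases t) (auto simp: middle_def)
    then show thesis using that by blast
  qed
  then show ?thesis
  proof cases
    case 1
    then show ?thesis
      using that[of "int p + 1"] by (auto simp: indices_def pos_def nat_eq_iff)
  next
    case 2
    then show ?thesis
      using that[of 0] by (auto simp: indices_def pos_def)
  next
    case 3
    then show ?thesis
      using that[of "int p - int (dimn t n)"] assms by (auto simp: indices_def pos_def dimn_def)
  qed
qed

lemma ball_between_pos:
  assumes "i \<in> indices t n" and "j \<in> indices t n"
  shows "(\<forall>k\<in>indices t n. i \<prec> k \<and> k \<prec> j \<longrightarrow> P (pos t n k)) \<longleftrightarrow>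
    (\<forall>k. pos t n i < k \<and> k < pos t n j \<longrightarrow> P k)"
proof
  assume *: "\<forall>k\<in>indices t n. i \<prec> k \<and> k \<prec> j \<longrightarrow> P (pos t n k)"
  show "\<forall>k. pos t n i < k \<and> k < pos t n j \<longrightarrow> P k"
  proof (intro allI impI)
    fix k assume k: "pos t n i < k \<and> k < pos t n j"
    then have "k < dimn t n" using pos_less[OF assms(2)] by simp
    then obtain l where "l \<in> indices t n" "pos t n l = k" by (rule pos_surj)
    then show "P k" using * k pos_less_iff assms by blast
  qed
next
  assume *: "\<forall>k. pos t n i < k \<and> k < pos t n j \<longrightarrow> P k"
  show "\<forall>k\<in>indices t n. i \<prec> k \<and> k \<prec> j \<longrightarrow> P (pos t n k)"
  proof (intro ballI impI)
    fix k assume "k \<in> indices t n" "i \<prec> k \<and> k \<prec> j"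
    then show "P (pos t n k)"
      using * pos_less_iff[OF assms(1)] pos_less_iff[OF _ assms(2)] by blast
  qed
qed

text \<open>Summing over all entries makes the weight independent of the chosen entry; by
  \<open>weight_pair\<close> it is twice the height unless the root is \<open>Twice i\<close>, where
  it is the height itself.\<close>

definition weight :: "family \<Rightarrow> nat \<Rightarrow> root \<Rightarrow> nat" where
  "weight t n \<alpha> = (\<Sum>(a, b)\<in>root_entries \<alpha>. pos t n b - pos t n a)"

fun is_twice :: "root \<Rightarrow> bool" where
  "is_twice (Twice i) = True"
| "is_twice _ = False"

lemma root_entries_indices:
  assumes "\<alpha> \<in> roots t n" and "(a, b) \<in> root_entries \<alpha>"
  shows "a \<in> indices t n" and "b \<in> indices t n" and "a \<prec> b"
  using assms by (cases \<alpha>; auto simp: roots_def indices_def prec_def sgn_if split: family.splits if_splits)+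

lemma root_entries_swap:
  assumes "\<alpha> \<in> roots t n" and "(a, b) \<in> root_entries \<alpha>"
  shows "(- b, - a) \<in> root_entries \<alpha>" and "\<not> is_twice \<alpha> \<Longrightarrow> a \<noteq> - b"
    and "\<not> is_twice \<alpha> \<Longrightarrow> root_entries \<alpha> = {(a, b), (- b, - a)}"
  using assms by (cases \<alpha>; auto simp: roots_def split: family.splits)+

lemma root_entry_in: "root_entry \<alpha> \<in> root_entries \<alpha>"
  by (cases \<alpha>) auto

lemma weight_pair:
  assumes "\<alpha> \<in> roots t n" and "\<not> is_twice \<alpha>" and "(a, b) \<in> root_entries \<alpha>"
  shows "weight t n \<alpha> = 2 * (pos t n b - pos t n a)"
proof -
  have idx: "a \<in> indices t n" "b \<in> indices t n"
    using root_entries_indices[OF assms(1,3)] by auto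
  have "(a, b) \<noteq> (- b, - a)" using root_entries_swap(2)[OF assms(1,3,2)] by auto
  then have "weight t n \<alpha> = (pos t n b - pos t n a) + (pos t n (- a) - pos t n (- b))"
    by (simp add: weight_def root_entries_swap(3)[OF assms(1,3,2)])
  moreover have "pos t n (- a) - pos t n (- b) = pos t n b - pos t n a"
    unfolding pos_minus[OF idx(1)] pos_minus[OF idx(2)]
    using pos_less[OF idx(1)] pos_less[OF idx(2)] by simp
  ultimately show ?thesis by simp
qed

lemma root_through:
  assumes "a \<in> indices t n" and "b \<in> indices t n" and "a \<prec> b" and "a \<noteq> - b"
  obtains \<alpha> where "\<alpha> \<in> roots t n" and "\<not> is_twice \<alpha>" and "(a, b) \<in> root_entries \<alpha>"
proof -
  consider "0 < a" "0 < b" "a < b" | "0 < a" "b = 0" | "0 < a" "b < 0" "a < - b"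
    | "0 < a" "b < 0" "- b < a" | "a = 0" "b < 0" | "a < 0" "b < 0" "a < b"
  proof -
    have "0 < a \<and> 0 < b \<and> a < b \<or> 0 < a \<and> b = 0 \<or> 0 < a \<and> b < 0 \<and> a < - b \<or>
        0 < a \<and> b < 0 \<and> - b < a \<or> a = 0 \<and> b < 0 \<or> a < 0 \<and> b < 0 \<and> a < b"
      using assms(3,4) unfolding prec_def sgn_if by (simp split: if_splits) linarith+
    then show thesis using that by blast
  qed
  then show ?thesis
  proof cases
    case 1
    then show ?thesis using that[of "Minus a b"] assms by (auto simp: roots_def indices_def split: if_splits)
  next
    case 2
    then show ?thesis using that[of "Single a"] assms by (auto simp: roots_def indices_def split: if_splits)
  next
    case 3
    then show ?thesis using that[of "Plus a (- b)"] assms by (auto simp: roots_def indices_def split: if_splits)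
  next
    case 4
    then show ?thesis using that[of "Plus (- b) a"] assms by (auto simp: roots_def indices_def split: if_splits)
  next
    case 5
    then show ?thesis using that[of "Single (- b)"] assms by (auto simp: roots_def indices_def split: if_splits)
  next
    case 6
    then show ?thesis using that[of "Minus (- b) (- a)"] assms by (auto simp: roots_def indices_def split: if_splits)
  qed
qed

context U_context
begin

lemma zeta_eq:
  assumes "(i, j) \<in> entries t n" and x: "x \<in> Um m"
  shows "zeta t n \<theta> i j r x = Ze x (pos t n i) (pos t n j) r"
proof -
  interpret G: matrix_subgroup \<theta> m "unitriangular_group m" by (rule Um_subgroup)
  have ij: "i \<in> indices t n" "j \<in> indices t n" "i \<prec> j"
    using assms by (auto simp: entries_def)
  let ?p = "pos t n i" and ?q = "pos t n j"
  have U_entry: "U_entry t n i j = {g \<in> Um m. \<forall>k. ?p < k \<and> k < ?q \<longrightarrow> g $$ (?p, k) = 0}"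
    unfolding U_entry_def entry_def
    using ball_between_pos[OF ij(1,2), of "\<lambda>k. _ $$ (?p, k) = 0"] by auto
  have pq: "?p < ?q" "?q < m" using pos_less_iff[OF ij(1,2)] ij pos_less by auto
  show ?thesis
    unfolding zeta_def U_entry entry_def
  proof (rule G.induced_row[OF x pq])
    fix v :: "nat \<Rightarrow> 'a" assume v: "v ?p = 1" "\<And>k. k < ?p \<or> ?q \<le> k \<Longrightarrow> v k = 0"
    let ?y = "mat m m (\<lambda>(a, k). if a = ?p then v k else if a = k then 1 else 0)"
    have "?y \<in> Um m" using v by (auto simp: Um_iff)
    moreover have "row_part ?p ?q ?y = v"
      using v pq by (auto simp: row_part_def fun_eq_iff)
    ultimately show "\<exists>y\<in>Um m. row_part ?p ?q y = v" by blast
  qed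
qed

text \<open>The label uses only columns before \<open>c \<le> n\<close>, where rows of
  \<open>U\<close> can be prescribed freely, so the row formula holds on \<open>U\<close> unchanged.
  For \<epsilon> - \<epsilon>' one has \<open>c < n\<close>; for a single \<epsilon> it is the
  middle column, \<open>c = n\<close>.\<close>

lemma xi_short:
  assumes x: "x \<in> carrier U" and i: "1 \<le> i" "i \<le> int n" and c: "pos t n j = c" "pos t n i < c" "c \<le> n" "c < m"
    and \<alpha>: "root_entry \<alpha> = (i, j)"
    and U_root: "U_root t n \<alpha> = {g \<in> carrier U. \<forall>k. pos t n i < k \<and> k < c \<longrightarrow> g $$ (pos t n i, k) = 0}"
  shows "xi t n \<theta> \<alpha> r x = Ze x (pos t n i) c r"
proof -
  interpret G: matrix_subgroup \<theta> m U by (rule U_subgroup)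
  have "root_char t n \<theta> \<alpha> r = (\<lambda>g. \<theta> (r * g $$ (pos t n i, c)))"
    by (simp add: root_char_def[abs_def] \<alpha> c entry_def)
  moreover have "induced_char U {g \<in> carrier U. \<forall>k. pos t n i < k \<and> k < c \<longrightarrow> g $$ (pos t n i, k) = 0}
      (\<lambda>g. \<theta> (r * g $$ (pos t n i, c))) x = Ze x (pos t n i) c r"
  proof (rule G.induced_row[OF x c(2,4)])
    fix v :: "nat \<Rightarrow> 'a" assume v: "v (pos t n i) = 1" "\<And>k. k < pos t n i \<or> c \<le> k \<Longrightarrow> v k = 0"
    let ?a = "mat n n (\<lambda>(a, k). if a = pos t n i then v k else if a = k then 1 else 0)"
    have p: "pos t n i < n" using c by simp
    have a: "?a \<in> Um n" using v by (auto simp: Um_iff)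
    obtain y where y: "y \<in> carrier U" "\<And>p k. p < n \<Longrightarrow> k < n \<Longrightarrow> y $$ (p, k) = ?a $$ (p, k)"
      by (rule U_exists[OF a zero_carrier_mat two, where t = t]) (rule that)
    have "row_part (pos t n i) c y = v"
      using v c p by (auto simp: row_part_def fun_eq_iff y)
    then show "\<exists>y\<in>carrier U. row_part (pos t n i) c y = v" using y by blast
  qed
  ultimately show ?thesis
    unfolding xi_def U_root by (simp only:)
qed

lemma all_int_between:
  assumes "1 \<le> i"
  shows "(\<forall>k. i < k \<and> k < j \<longrightarrow> P (nat (k - 1))) \<longleftrightarrow> (\<forall>k. nat (i - 1) < k \<and> k < nat (j - 1) \<longrightarrow> P k)"
proof
  assume *: "\<forall>k. i < k \<and> k < j \<longrightarrow> P (nat (k - 1))"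
  show "\<forall>k. nat (i - 1) < k \<and> k < nat (j - 1) \<longrightarrow> P k"
  proof (intro allI impI)
    fix k assume "nat (i - 1) < k \<and> k < nat (j - 1)"
    then have "i < int k + 1 \<and> int k + 1 < j" using assms by arith
    then show "P k" using *[rule_format, of "int k + 1"] by simp
  qed
next
  assume *: "\<forall>k. nat (i - 1) < k \<and> k < nat (j - 1) \<longrightarrow> P k"
  show "\<forall>k. i < k \<and> k < j \<longrightarrow> P (nat (k - 1))"
  proof (intro allI impI)
    fix k assume "i < k \<and> k < j"
    then show "P (nat (k - 1))" using *[rule_format, of "nat (k - 1)"] assms by auto
  qed
qed

lemma row_zero_between:
  assumes i: "1 \<le> i"
  shows "(\<forall>k. i < k \<and> k < j \<longrightarrow> entry t n g i k = 0) \<longleftrightarrow>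
    (\<forall>k. pos t n i < k \<and> k < nat (j - 1) \<longrightarrow> g $$ (pos t n i, k) = 0)"
proof -
  have pos: "pos t n k = nat (k - 1)" if "1 \<le> k" for k using that by (simp add: pos_def)
  have "(\<forall>k. i < k \<and> k < j \<longrightarrow> entry t n g i k = 0) \<longleftrightarrow>
      (\<forall>k. i < k \<and> k < j \<longrightarrow> g $$ (pos t n i, nat (k - 1)) = 0)"
    using i by (intro arg_cong[of _ _ All] ext imp_cong refl) (simp add: entry_def pos)
  also have "\<dots> \<longleftrightarrow> (\<forall>k. nat (i - 1) < k \<and> k < nat (j - 1) \<longrightarrow> g $$ (pos t n i, k) = 0)"
    by (rule all_int_between[OF i])
  finally show ?thesis by (simp only: pos[OF i])
qed

lemma row_zero_iff:
  assumes i: "1 \<le> i"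
  shows "(\<forall>k. i < k \<and> k \<le> int n \<longrightarrow> entry t n g i k = 0) \<longleftrightarrow>
    (\<forall>k. pos t n i < k \<and> k < n \<longrightarrow> g $$ (pos t n i, k) = 0)"
  using row_zero_between[OF i, of "int n + 1" g] by (simp add: zle_add1_eq_le)

lemma xi_Minus:
  assumes x: "x \<in> carrier U" and ij: "1 \<le> i" "i < j" "j \<le> int n"
  shows "xi t n \<theta> (Minus i j) r x = Ze x (pos t n i) (pos t n j) r"
proof (rule xi_short[OF x ij(1)])
  have "pos t n j = nat (j - 1)" using ij by (simp add: pos_def)
  then show "U_root t n (Minus i j) =
      {g \<in> carrier U. \<forall>k. pos t n i < k \<and> k < pos t n j \<longrightarrow> g $$ (pos t n i, k) = 0}"
    unfolding U_root.simps row_zero_between[OF ij(1)] by simp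
qed (use ij in \<open>auto simp: pos_def dimn_def\<close>)

lemma xi_Single:
  assumes x: "x \<in> carrier U" and i: "1 \<le> i" "i \<le> int n" and t: "t = Odd_Orthogonal"
  shows "xi t n \<theta> (Single i) r x = Ze x (pos t n i) (pos t n 0) r"
proof (rule xi_short[OF x i])
  show "U_root t n (Single i) =
      {g \<in> carrier U. \<forall>k. pos t n i < k \<and> k < pos t n 0 \<longrightarrow> g $$ (pos t n i, k) = 0}"
    unfolding U_root.simps row_zero_iff[OF i(1)] by (simp add: pos_def)
qed (use i t in \<open>auto simp: pos_def dimn_def middle_def\<close>)

text \<open>As \<open>i < j\<close>, the two half rows are independent and all pairs of fixed
  vectors occur as labels, which is the double sum of \<open>Zs_pair\<close>. Row \<open>j\<close>
  is cut at \<open>n + middle t\<close>, that is at \<open>m - n\<close>, complementary to the cut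
  \<open>n\<close> of row \<open>i\<close>.\<close>

lemma xi_Plus:
  assumes x: "x \<in> carrier U" and ij: "1 \<le> i" "i < j" "j \<le> int n" and r: "r \<noteq> 0"
  shows "xi t n \<theta> (Plus i j) r x = Ze x (pos t n i) (pos t n (- j)) r"
proof -
  interpret isometry \<theta> m "\<lambda>k l. x $$ (k, l)" "form_sign t n" using x by (rule U_iso)
  let ?p = "pos t n i" and ?q = "pos t n j" and ?n' = "n + middle t"
  have pq: "?p < ?q" "?q < n" "?p < n" "pos t n (- j) = m - 1 - ?q"
    using ij by (auto simp: pos_def dimn_def)
  have n': "m - n = ?n'" "n \<le> m - 1 - ?q" "m - 1 - ?q < m" "m - 1 - (m - 1 - ?q) = ?q"
    using pq by (auto simp: dimn_def)
  have row_j: "(\<forall>l\<in>indices t n. j \<prec> l \<and> l \<preceq> 0 \<longrightarrow> entry t n g j l = 0) \<longleftrightarrow>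
      (\<forall>k. ?q < k \<and> k < ?n' \<longrightarrow> g $$ (?q, k) = 0)" for g :: "'a mat"
  proof
    assume *: "\<forall>l\<in>indices t n. j \<prec> l \<and> l \<preceq> 0 \<longrightarrow> entry t n g j l = 0"
    show "\<forall>k. ?q < k \<and> k < ?n' \<longrightarrow> g $$ (?q, k) = 0"
    proof (intro allI impI)
      fix k assume k: "?q < k \<and> k < ?n'"
      show "g $$ (?q, k) = 0"
      proof (cases "k < n")
        case True
        then show ?thesis
          using *[rule_format, of "int k + 1"] k ij
          by (auto simp: indices_def prec_def sgn_if entry_def pos_def)
      next
        case False
        then have "k = n" "t = Odd_Orthogonal"
          using k by (auto simp: middle_def split: if_splits)
        then show ?thesis
          using *[rule_format, of 0] ij by (auto simp: indices_def prec_def sgn_if entry_def pos_def)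
      qed
    qed
  next
    assume *: "\<forall>k. ?q < k \<and> k < ?n' \<longrightarrow> g $$ (?q, k) = 0"
    show "\<forall>l\<in>indices t n. j \<prec> l \<and> l \<preceq> 0 \<longrightarrow> entry t n g j l = 0"
    proof (intro ballI impI)
      fix l assume l: "l \<in> indices t n" "j \<prec> l \<and> l \<preceq> 0"
      then have "?q < pos t n l" "pos t n l < ?n'"
        using ij
        by (auto simp: indices_def prec_def sgn_if pos_def middle_def split: if_splits)
      then show "entry t n g j l = 0" using * by (simp add: entry_def)
    qed
  qed
  let ?f = "\<lambda>y. (row_part ?p n y, row_part ?q ?n' y)"
  have "xi t n \<theta> (Plus i j) r x =
      (\<Sum>p\<in>{p \<in> ?f ` carrier U. fst p \<in> L ?p 1 n \<and> snd p \<in> L ?q 1 ?n'}. \<theta> (r * bq n (fst p) (snd p)))"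
    using induced_pair[OF x pq(3,2), of r] ij
    by (simp add: xi_def root_char_def[abs_def] entry_def pq row_zero_iff[unfolded entry_def] row_j[unfolded entry_def])
  also have "{p \<in> ?f ` carrier U. fst p \<in> L ?p 1 n \<and> snd p \<in> L ?q 1 ?n'} = L ?p 1 n \<times> L ?q 1 ?n'"
  proof -
    have "(v, w) \<in> ?f ` carrier U" if v: "v \<in> L ?p 1 n" and w: "w \<in> L ?q 1 ?n'" for v w
    proof -
      obtain y where "y \<in> carrier U" "row_part ?p n y = v" "row_part ?q ?n' y = w"
        by (rule U_rich[of ?p v ?q w]) (use v w pq in \<open>auto simp: leadr_def\<close>)
      then show ?thesis by force
    qed
    then show ?thesis by auto
  qed
  also have "(\<Sum>p\<in>L ?p 1 n \<times> L ?q 1 ?n'. \<theta> (r * bq n (fst p) (snd p))) = Z ?p (m - 1 - ?q) r"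
  proof -
    have "form_sign t n k = (if t = Symplectic then - 1 else 1 :: 'a)" if "n \<le> k" for k
      using that by (simp add: form_sign_def)
    then show ?thesis
      using Zs_pair[OF pq(3) n'(2,3) r, of "if t = Symplectic then - 1 else 1"]
      unfolding n'(1,4) by (simp add: sum.cartesian_product case_prod_unfold)
  qed
  finally show ?thesis by (simp add: pq)
qed

lemma xi_Twice:
  assumes x: "x \<in> carrier U" and i: "1 \<le> i" "i \<le> int n" and t: "t = Symplectic"
  shows "xi t n \<theta> (Twice i) r x = symplectic_isometry.Q \<theta> m (\<lambda>k l. x $$ (k, l)) n (pos t n i) r"
proof -
  interpret symplectic_isometry \<theta> m "\<lambda>k l. x $$ (k, l)" "form_sign t n" n
    using x t by (rule U_symplectic)
  let ?p = "pos t n i"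
  have p: "?p < n" "pos t n (- i) = m - 1 - ?p"
    using i by (auto simp: pos_def dimn_def)
  have mid: "n + middle t = n" using t by (simp add: middle_def)
  let ?f = "\<lambda>y. (row_part ?p n y, row_part ?p n y)"
  have "xi t n \<theta> (Twice i) r x =
      (\<Sum>p\<in>{p \<in> ?f ` carrier U. fst p \<in> L ?p 1 n \<and> snd p \<in> L ?p 1 n}. \<theta> (r * \<beta> (fst p) (snd p)))"
    using induced_pair[OF x p(1) p(1), of r] i
    by (simp add: xi_def root_char_def[abs_def] entry_def p row_zero_iff[unfolded entry_def] mid)
  also have "{p \<in> ?f ` carrier U. fst p \<in> L ?p 1 n \<and> snd p \<in> L ?p 1 n} = (\<lambda>v. (v, v)) ` L ?p 1 n"
  proof -
    have "(v, v) \<in> ?f ` carrier U" if v: "v \<in> L ?p 1 n" for v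
    proof -
      obtain y where "y \<in> carrier U" "row_part ?p n y = v" "row_part ?p (n + middle t) y = v"
        by (rule U_rich[of ?p v ?p v]) (use v p mid in \<open>auto simp: leadr_def\<close>)
      then show ?thesis by force
    qed
    then show ?thesis by auto
  qed
  also have "(\<Sum>p\<in>(\<lambda>v. (v, v)) ` L ?p 1 n. \<theta> (r * \<beta> (fst p) (snd p))) = Q ?p r"
    by (subst sum.reindex) (auto simp: inj_on_def Q_def)
  finally show ?thesis .
qed

section \<open>Reduction of products\<close>

text \<open>Only the values on \<open>U\<close> matter (\<open>sop_cong\<close>); the number bounds the weight of the products.\<close>

inductive sum_of_products :: "nat \<Rightarrow> ('a mat \<Rightarrow> complex) \<Rightarrow> bool" where
  sop_zero: "sum_of_products N (\<lambda>_. 0)"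
| sop_one: "sum_of_products N (\<lambda>_. 1)"
| sop_letter: "\<alpha> \<in> roots t n \<Longrightarrow> r \<noteq> 0 \<Longrightarrow> weight t n \<alpha> \<le> N \<Longrightarrow> sum_of_products N (xi t n \<theta> \<alpha> r)"
| sop_add: "sum_of_products N f \<Longrightarrow> sum_of_products N g \<Longrightarrow> sum_of_products N (\<lambda>x. f x + g x)"
| sop_mult: "sum_of_products M f \<Longrightarrow> sum_of_products N g \<Longrightarrow> M + N \<le> K \<Longrightarrow> sum_of_products K (\<lambda>x. f x * g x)"
| sop_cong: "sum_of_products N f \<Longrightarrow> (\<And>x. x \<in> carrier U \<Longrightarrow> g x = f x) \<Longrightarrow> sum_of_products N g"

lemma sop_sum:
  assumes "\<And>a. a \<in> S \<Longrightarrow> sum_of_products N (f a)"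
  shows "sum_of_products N (\<lambda>x. \<Sum>a\<in>S. f a x)"
proof (cases "finite S")
  case True
  then show ?thesis
    using assms by (induction S) (auto intro: sop_zero sop_add)
qed (simp add: sop_zero)

lemma sop_one_plus_sums:
  assumes "\<And>l c. l \<in> S \<Longrightarrow> c \<noteq> 0 \<Longrightarrow> sum_of_products N (\<lambda>x. f l c x)"
  shows "sum_of_products N (\<lambda>x. 1 + (\<Sum>l\<in>S. \<Sum>c\<in>UNIV - {0 :: 'a}. f l c x))"
  by (intro sop_add sop_one sop_sum assms) auto

lemma xi_root_entry:
  assumes x: "x \<in> carrier U" and \<alpha>: "\<alpha> \<in> roots t n" "\<not> is_twice \<alpha>" and r: "r \<noteq> 0"
    and ij: "root_entry \<alpha> = (i, j)"
  shows "xi t n \<theta> \<alpha> r x = Ze x (pos t n i) (pos t n j) r"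
proof (cases \<alpha>)
  case (Minus a b)
  then show ?thesis using xi_Minus[OF x] \<alpha> ij by (auto simp: roots_def split: family.splits)
next
  case (Plus a b)
  then show ?thesis using xi_Plus[OF x _ _ _ r] \<alpha> ij by (auto simp: roots_def split: family.splits)
next
  case (Single a)
  then show ?thesis using xi_Single[OF x] \<alpha> ij by (auto simp: roots_def split: family.splits)
qed (use \<alpha> in auto)

text \<open>At the distinguished entry \<open>c\<close> is 1; at the mirrored one it is the sign in
  \<open>Zs_dual\<close>.\<close>

lemma xi_entry:
  assumes \<alpha>: "\<alpha> \<in> roots t n" "\<not> is_twice \<alpha>" and ab: "(a, b) \<in> root_entries \<alpha>"
  obtains c :: 'a where "c \<noteq> 0"
    and "\<And>r x. r \<noteq> 0 \<Longrightarrow> x \<in> carrier U \<Longrightarrow> xi t n \<theta> \<alpha> r x = Ze x (pos t n a) (pos t n b) (c * r)"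
proof -
  obtain i j where ij: "root_entry \<alpha> = (i, j)" by (cases "root_entry \<alpha>")
  then have ijE: "(i, j) \<in> root_entries \<alpha>" using root_entry_in[of \<alpha>] by simp
  have "(a, b) = (i, j) \<or> (a, b) = (- j, - i)"
    using root_entries_swap(3)[OF \<alpha>(1) ijE \<alpha>(2)] ab by auto
  then show ?thesis
  proof
    assume "(a, b) = (i, j)"
    then show ?thesis using that[of 1] xi_root_entry[OF _ \<alpha> _ ij] by auto
  next
    assume ab: "(a, b) = (- j, - i)"
    let ?p = "pos t n i" and ?q = "pos t n j"
    have idx: "i \<in> indices t n" "j \<in> indices t n" "i \<prec> j"
      using root_entries_indices[OF \<alpha>(1) ijE] by auto
    let ?c = "- (form_sign t n ?p * form_sign t n ?q) :: 'a"
    show ?thesis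
    proof (rule that[of ?c])
      show "?c \<noteq> 0" by (simp add: form_sign_def)
      fix r :: 'a and x assume r: "r \<noteq> 0" and x: "x \<in> carrier U"
      interpret isometry \<theta> m "\<lambda>k l. x $$ (k, l)" "form_sign t n" using x by (rule U_iso)
      have "xi t n \<theta> \<alpha> r x = Z ?p ?q r" by (rule xi_root_entry[OF x \<alpha> r ij])
      also have "\<dots> = Z (m - 1 - ?q) (m - 1 - ?p) (- (form_sign t n ?p * form_sign t n ?q * r))"
        using pos_less_iff[OF idx(1,2)] idx pos_less[OF idx(2)] r by (intro Zs_dual) auto
      also have "\<dots> = Z (pos t n a) (pos t n b) (?c * r)"
        using ab by (simp add: pos_minus[OF idx(1)] pos_minus[OF idx(2)])
      finally show "xi t n \<theta> \<alpha> r x = Z (pos t n a) (pos t n b) (?c * r)" .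
    qed
  qed
qed

abbreviation "Qe \<equiv> \<lambda>x :: 'a mat. symplectic_isometry.Q \<theta> m (\<lambda>k l. x $$ (k, l)) n"
abbreviation "Te \<equiv> \<lambda>x :: 'a mat. symplectic_isometry.T \<theta> m (\<lambda>k l. x $$ (k, l)) n"
abbreviation "Ee \<equiv> \<lambda>x :: 'a mat. unitri.Es \<theta> m (\<lambda>k l. x $$ (k, l))"

lemma sop_Z_off:
  assumes "p < q" and "q < m" and "p + q + 1 \<noteq> m" and r: "r \<noteq> 0" and N: "2 * (q - p) \<le> N"
  shows "sum_of_products N (\<lambda>x. Ze x p q r)"
proof -
  obtain a where a: "a \<in> indices t n" "pos t n a = p"
    by (rule pos_surj[OF order.strict_trans[OF assms(1,2)]])
  obtain b where b: "b \<in> indices t n" "pos t n b = q"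
    using assms(2) by (rule pos_surj)
  have "a \<prec> b" using pos_less_iff[OF a(1) b(1)] a b assms by simp
  moreover have "a \<noteq> - b" using pos_minus[OF b(1)] a b assms by auto
  ultimately obtain \<alpha> where \<alpha>: "\<alpha> \<in> roots t n" "\<not> is_twice \<alpha>" and ab: "(a, b) \<in> root_entries \<alpha>"
    using root_through[OF a(1) b(1)] by blast
  obtain c where c: "c \<noteq> 0"
    and xi: "\<And>r x. r \<noteq> 0 \<Longrightarrow> x \<in> carrier U \<Longrightarrow> xi t n \<theta> \<alpha> r x = Ze x (pos t n a) (pos t n b) (c * r)"
    using xi_entry[OF \<alpha> ab] by blast
  \<comment> \<open>Dividing by \<open>c\<close> compensates the change of parameter between the
    entry \<open>(a, b)\<close> and the distinguished one.\<close>
  have "sum_of_products N (xi t n \<theta> \<alpha> (r / c))"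
    using \<alpha> r c N by (intro sop_letter) (simp_all add: weight_pair[OF \<alpha> ab] a b)
  then show ?thesis
    by (rule sop_cong) (use xi[of "r / c"] r c a b in simp)
qed

text \<open>The condition \<open>p + c + 1 \<le> m\<close> keeps every column \<open>l < c\<close>
  before the antidiagonal, so ordinary roots suffice and the orthogonal case of \<open>sop_Z\<close>
  can rest on this. The longest entry that occurs has height \<open>c - 1 - p\<close>.\<close>

lemma sop_Z_zero:
  assumes "p < c" and "c < m" and "p + c + 1 \<le> m" and N: "2 * (c - 1 - p) \<le> N"
  shows "sum_of_products N (\<lambda>x. Ze x p c 0)"
proof -
  have "sum_of_products N (\<lambda>x. 1 + (\<Sum>l\<in>{p<..<c}. \<Sum>u\<in>UNIV - {0}. Ze x p l u))"
    using assms by (intro sop_one_plus_sums sop_Z_off) auto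
  then show ?thesis
  proof (rule sop_cong)
    fix x :: "'a mat" assume "x \<in> carrier U"
    then interpret isometry \<theta> m "\<lambda>k l. x $$ (k, l)" "form_sign t n" by (rule U_iso)
    show "Z p c 0 = 1 + (\<Sum>l\<in>{p<..<c}. \<Sum>u\<in>UNIV - {0}. Z p l u)"
      using assms by (intro Zs_zero_expand) auto
  qed
qed

lemma weight_Twice: "1 \<le> i \<Longrightarrow> i \<le> int n \<Longrightarrow> weight t n (Twice i) = m - 1 - 2 * pos t n i"
  by (simp add: weight_def pos_def dimn_def)

lemma sop_Q:
  assumes "p < n" and t: "t = Symplectic" and r: "r \<noteq> 0" and N: "m - 1 - 2 * p \<le> N"
  shows "sum_of_products N (\<lambda>x. Qe x p r)"
proof -
  have i: "1 \<le> int p + 1" "int p + 1 \<le> int n" and p: "pos t n (int p + 1) = p"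
    using assms by (auto simp: pos_def)
  have "Twice (int p + 1) \<in> roots t n" using i t by (auto simp: roots_def)
  then have "sum_of_products N (xi t n \<theta> (Twice (int p + 1)) r)"
    using r by (rule sop_letter) (simp only: weight_Twice[OF i] p N)
  then show ?thesis
    by (rule sop_cong) (use xi_Twice[OF _ i t] p in simp)
qed

lemma sop_T:
  assumes "p < n" and t: "t = Symplectic" and r: "r \<noteq> 0" and N: "m - 2 - 2 * p \<le> N"
  shows "sum_of_products N (\<lambda>x. Te x p r)"
proof -
  have "sum_of_products N (\<lambda>x. 1 + (\<Sum>l\<in>{p<..<n}. \<Sum>u\<in>UNIV - {0}. Qe x l (r * (u * u))))"
    using assms by (intro sop_one_plus_sums sop_Q) auto
  then show ?thesis
  proof (rule sop_cong)
    fix x :: "'a mat" assume "x \<in> carrier U"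
    then interpret symplectic_isometry \<theta> m "\<lambda>k l. x $$ (k, l)" "form_sign t n" n
      using t by (rule U_symplectic)
    show "T p r = 1 + (\<Sum>l\<in>{p<..<n}. \<Sum>u\<in>UNIV - {0}. Q l (r * (u * u)))"
      by (rule T_expand[OF assms(1)])
  qed
qed

text \<open>The bound is twice the height also on the antidiagonal. In the symplectic case
  \<open>Q\<close> takes up the height \<open>q - p\<close> and \<open>T\<close> at most one less;
  in the orthogonal cases the parameter is replaced by 0 and only shorter entries of the row
  appear.\<close>

lemma sop_Z:
  assumes "p < q" and "q < m" and r: "r \<noteq> 0" and N: "2 * (q - p) \<le> N"
  shows "sum_of_products N (\<lambda>x. Ze x p q r)"
proof (cases "p + q + 1 = m")
  case False
  then show ?thesis using assms by (intro sop_Z_off) auto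
next
  case True
  then have q: "q = m - 1 - p" by simp
  show ?thesis
  proof (cases "t = Symplectic")
    case t: True
    then have m: "m = 2 * n" by (simp add: dimn_def middle_def)
    then have p: "p < n" using True assms by simp
    have four: "(4 :: 'a) \<noteq> 0" using no_zero_divisors[OF two two] by simp
    have "sum_of_products N (\<lambda>x. Qe x p r * Te x p (- (r / 4)))"
      by (rule sop_mult[OF sop_Q[OF p t r order.refl] sop_T[OF p t _ order.refl]])
         (use r N q m p four in auto)
    then show ?thesis
    proof (rule sop_cong)
      fix x :: "'a mat" assume "x \<in> carrier U"
      then interpret symplectic_isometry \<theta> m "\<lambda>k l. x $$ (k, l)" "form_sign t n" n
        using t by (rule U_symplectic)
      show "Z p q r = Q p r * T p (- (r / 4))"
        unfolding q by (rule Zs_middle_symplectic[OF p r])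
    qed
  next
    case t: False
    have "sum_of_products N (\<lambda>x. Ze x p q 0)"
      using assms True by (intro sop_Z_zero) auto
    then show ?thesis
    proof (rule sop_cong)
      fix x :: "'a mat" assume "x \<in> carrier U"
      then interpret isometry \<theta> m "\<lambda>k l. x $$ (k, l)" "form_sign t n" by (rule U_iso)
      show "Z p q r = Z p q 0"
        unfolding q
        by (rule Zs_middle_orthogonal) (use t two q assms in \<open>auto simp: form_sign_def\<close>)
    qed
  qed
qed

lemma sop_E:
  assumes "p < q" and "q < m" and r: "r \<noteq> 0" and N: "2 * (q - p) - 2 \<le> N"
  shows "sum_of_products N (\<lambda>x. Ee x p q r)"
proof -
  have "sum_of_products N (\<lambda>x. 1 + (\<Sum>l\<in>{p<..<q}. \<Sum>u\<in>UNIV - {0}. Ze x l q (r * u)))"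
    using assms by (intro sop_one_plus_sums sop_Z) auto
  then show ?thesis
  proof (rule sop_cong)
    fix x :: "'a mat" assume "x \<in> carrier U"
    then interpret isometry \<theta> m "\<lambda>k l. x $$ (k, l)" "form_sign t n" by (rule U_iso)
    show "Es p q r = 1 + (\<Sum>l\<in>{p<..<q}. \<Sum>u\<in>UNIV - {0}. Z l q (r * u))"
      by (rule Es_expand[OF assms(1)])
  qed
qed

text \<open>The loss of weight comes from the factor \<open>Es\<close>: its entries lie in column
  \<open>q\<close> strictly below row \<open>p\<close>.\<close>

lemma sop_Z_mult_Z:
  assumes pq: "p < q" "q \<le> q'" "q' < m" and m: "p + q + 1 \<noteq> m" and r: "r \<noteq> 0" and s: "s \<noteq> 0"
  shows "sum_of_products (2 * (q - p) + 2 * (q' - p) - 1) (\<lambda>x. Ze x p q r * Ze x p q' s)"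
proof (cases "q = q'")
  case True
  have E: "sum_of_products (2 * (q - p) - 2) (\<lambda>x. Ee x p q r)"
    using pq r by (intro sop_E) auto
  have Z: "sum_of_products (2 * (q - p)) (\<lambda>x. Ze x p q (r + s))"
  proof (cases "r + s = 0")
    case False
    then show ?thesis using pq by (intro sop_Z) auto
  next
    case rs: True
    have "sum_of_products (2 * (q - p)) (\<lambda>x. 1 + (\<Sum>l\<in>{p<..<q}. \<Sum>u\<in>UNIV - {0}. Ze x p l u))"
      using pq by (intro sop_one_plus_sums sop_Z) auto
    then show ?thesis
    proof (rule sop_cong)
      fix x :: "'a mat" assume "x \<in> carrier U"
      then interpret isometry \<theta> m "\<lambda>k l. x $$ (k, l)" "form_sign t n" by (rule U_iso)
      show "Z p q (r + s) = 1 + (\<Sum>l\<in>{p<..<q}. \<Sum>u\<in>UNIV - {0}. Z p l u)"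
        unfolding rs using pq by (intro Zs_zero_expand) auto
    qed
  qed
  have "sum_of_products (2 * (q - p) + 2 * (q' - p) - 1) (\<lambda>x. Ze x p q (r + s) * Ee x p q r)"
    by (rule sop_mult[OF Z E]) (use pq True in auto)
  then show ?thesis
  proof (rule sop_cong)
    fix x :: "'a mat" assume "x \<in> carrier U"
    then interpret isometry \<theta> m "\<lambda>k l. x $$ (k, l)" "form_sign t n" by (rule U_iso)
    show "Z p q r * Z p q' s = Z p q (r + s) * Es p q r"
      using True by (simp add: Zs_mult_same)
  qed
next
  case False
  have "sum_of_products (2 * (q - p) + 2 * (q' - p) - 1) (\<lambda>x. Ze x p q' s * Ee x p q r)"
    by (rule sop_mult[OF sop_Z[OF _ _ _ order.refl] sop_E[OF _ _ _ order.refl]]) (use pq r s in auto)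
  then show ?thesis
  proof (rule sop_cong)
    fix x :: "'a mat" assume "x \<in> carrier U"
    then interpret isometry \<theta> m "\<lambda>k l. x $$ (k, l)" "form_sign t n" by (rule U_iso)
    show "Z p q r * Z p q' s = Z p q' s * Es p q r"
      using pq False by (intro Zs_mult_longer) auto
  qed
qed

lemma sop_Q_mult_Q:
  assumes p: "p < n" and t: "t = Symplectic" and r: "r \<noteq> 0" and s0: "s \<noteq> 0"
  shows "sum_of_products (2 * (m - 1 - 2 * p) - 1) (\<lambda>x. Qe x p r * Qe x p s)"
proof -
  have m: "m = 2 * n" using t by (simp add: dimn_def middle_def)
  show ?thesis
  proof (cases "r + s = 0")
    case False
    have "sum_of_products (2 * (m - 1 - 2 * p) - 1) (\<lambda>x. Qe x p (r + s) * Te x p (r * s / (r + s)))"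
      by (rule sop_mult[OF sop_Q[OF p t _ order.refl] sop_T[OF p t _ order.refl]])
         (use r s0 m p False in auto)
    then show ?thesis
    proof (rule sop_cong)
      fix x :: "'a mat" assume "x \<in> carrier U"
      then interpret symplectic_isometry \<theta> m "\<lambda>k l. x $$ (k, l)" "form_sign t n" n
        using t by (rule U_symplectic)
      show "Q p r * Q p s = Q p (r + s) * T p (r * s / (r + s))"
        by (rule Q_mult_same[OF False])
    qed
  next
    case True
    have neg: "s = - r" using True by (simp add: eq_neg_iff_add_eq_0 add.commute)
    have "sum_of_products (2 * (m - 1 - 2 * p) - 1)
        (\<lambda>x. Ze x p n 0 + (\<Sum>l\<in>{p<..<n}. \<Sum>u\<in>UNIV - {0}. Ze x l (m - 1 - p) (- (2 * r) * u)))"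
      by (intro sop_add sop_sum sop_Z_zero sop_Z) (use m p r two in auto)
    then show ?thesis
    proof (rule sop_cong)
      fix x :: "'a mat" assume "x \<in> carrier U"
      then interpret symplectic_isometry \<theta> m "\<lambda>k l. x $$ (k, l)" "form_sign t n" n
        using t by (rule U_symplectic)
      show "Q p r * Q p s = Z p n 0 + (\<Sum>l\<in>{p<..<n}. \<Sum>u\<in>UNIV - {0}. Z l (m - 1 - p) (- (2 * r) * u))"
        unfolding neg by (rule Q_mult_opposite[OF p r])
    qed
  qed
qed

text \<open>An entry in the second half has as its mirror image a row \<open>j\<close> with
  \<open>p < j\<close>, because \<open>q\<close> lies before the antidiagonal; this is the situation
  of \<open>Q_mult_Z_long\<close>.\<close>

lemma sop_Q_mult_Z_row:
  assumes p: "p < q" "q < m - 1 - p" and t: "t = Symplectic" and r: "r \<noteq> 0" and s0: "s \<noteq> 0"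
  shows "sum_of_products (m - 1 - 2 * p + 2 * (q - p) - 1) (\<lambda>x. Qe x p r * Ze x p q s)"
proof -
  have m: "m = 2 * n" using t by (simp add: dimn_def middle_def)
  have pn: "p < n" using p m by simp
  show ?thesis
  proof (cases "q < n")
    case True
    have "sum_of_products (m - 1 - 2 * p + 2 * (q - p) - 1) (\<lambda>x. Qe x p r * Ee x p q s)"
      by (rule sop_mult[OF sop_Q[OF pn t r order.refl] sop_E[OF p(1) _ s0 order.refl]])
         (use p m in auto)
    then show ?thesis
    proof (rule sop_cong)
      fix x :: "'a mat" assume "x \<in> carrier U"
      then interpret symplectic_isometry \<theta> m "\<lambda>k l. x $$ (k, l)" "form_sign t n" n
        using t by (rule U_symplectic)
      show "Q p r * Z p q s = Q p r * Es p q s"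
        by (rule Q_mult_Z_short[OF p(1) True])
    qed
  next
    case False
    define j where "j = m - 1 - q"
    have j: "p < j" "j < n" "q = m - 1 - j" using False p m by (auto simp: j_def)
    have "sum_of_products (m - 1 - 2 * p + 2 * (q - p) - 1) (\<lambda>x. Qe x p r * (Ze x j n 0 +
        (\<Sum>l\<in>{p<..<n}. \<Sum>u\<in>UNIV - {0}. Ze x l (m - 1 - j) (s * u))))"
    proof (rule sop_mult[OF sop_Q[OF pn t r order.refl]])
      show "sum_of_products (2 * (q - p) - 1) (\<lambda>x. Ze x j n 0 +
        (\<Sum>l\<in>{p<..<n}. \<Sum>u\<in>UNIV - {0}. Ze x l (m - 1 - j) (s * u)))"
        by (intro sop_add sop_sum sop_Z_zero sop_Z) (use m j s0 in auto)
    qed (use p m in auto)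
    then show ?thesis
    proof (rule sop_cong)
      fix x :: "'a mat" assume "x \<in> carrier U"
      then interpret symplectic_isometry \<theta> m "\<lambda>k l. x $$ (k, l)" "form_sign t n" n
        using t by (rule U_symplectic)
      show "Q p r * Z p q s = Q p r * (Z j n 0 +
        (\<Sum>l\<in>{p<..<n}. \<Sum>u\<in>UNIV - {0}. Z l (m - 1 - j) (s * u)))"
        unfolding j(3) by (rule Q_mult_Z_long[OF j(1,2) r s0])
    qed
  qed
qed

lemma sop_Q_mult_Z_column:
  assumes p: "j < p" "p < n" and t: "t = Symplectic" and r: "r \<noteq> 0" and s0: "s \<noteq> 0"
  shows "sum_of_products (m - 1 - 2 * p + 2 * (m - 1 - p - j) - 1) (\<lambda>x. Qe x p r * Ze x j (m - 1 - p) s)"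
proof -
  have m: "m = 2 * n" using t by (simp add: dimn_def middle_def)
  have "sum_of_products (m - 1 - 2 * p + 2 * (m - 1 - p - j) - 1) (\<lambda>x. Ze x j (m - 1 - p) s * Te x p r)"
    by (rule sop_mult[OF sop_Z[OF _ _ s0 order.refl] sop_T[OF p(2) t r order.refl]]) (use p m in auto)
  then show ?thesis
  proof (rule sop_cong)
    fix x :: "'a mat" assume "x \<in> carrier U"
    then interpret symplectic_isometry \<theta> m "\<lambda>k l. x $$ (k, l)" "form_sign t n" n
      using t by (rule U_symplectic)
    show "Q p r * Z j (m - 1 - p) s = Z j (m - 1 - p) s * T p r"
      by (rule Q_mult_Z_column[OF p s0])
  qed
qed

end

section \<open>Collisions of roots\<close>

definition sharing_row :: "root \<Rightarrow> root \<Rightarrow> bool" where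
  "sharing_row \<alpha> \<beta> \<longleftrightarrow> (\<exists>a b c. (a, b) \<in> root_entries \<alpha> \<and> (a, c) \<in> root_entries \<beta>)"

lemma root_entries_row:
  assumes "\<alpha> \<in> roots t n" and "(a, b) \<in> root_entries \<alpha>" and "(a, c) \<in> root_entries \<alpha>"
  shows "b = c"
  using assms by (cases \<alpha>; auto simp: roots_def split: family.splits)

text \<open>The map from \<open>(a, b)\<close> to \<open>(- b, - a)\<close> preserves the entries of
  each root and exchanges rows with columns, so a collision in a column is also one in a
  row.\<close>

lemma basic_roots_if_no_sharing_row:
  assumes D: "D \<subseteq> roots t n"
    and no: "\<And>\<alpha> \<beta>. \<alpha> \<in> D \<Longrightarrow> \<beta> \<in> D \<Longrightarrow> \<alpha> \<noteq> \<beta> \<Longrightarrow> \<not> sharing_row \<alpha> \<beta>"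
  shows "basic_roots D"
proof -
  let ?E = "\<Union>\<alpha>\<in>D. root_entries \<alpha>"
  have row: "b = c" if "(a, b) \<in> ?E" "(a, c) \<in> ?E" for a b c
  proof -
    from that obtain \<alpha> \<beta> where *: "\<alpha> \<in> D" "\<beta> \<in> D" "(a, b) \<in> root_entries \<alpha>" "(a, c) \<in> root_entries \<beta>"
      by blast
    then have "\<alpha> = \<beta>" using no[of \<alpha> \<beta>] by (auto simp: sharing_row_def)
    then show ?thesis using * D root_entries_row by blast
  qed
  have swap: "(- b, - a) \<in> ?E" if ab: "(a, b) \<in> ?E" for a b
  proof -
    from ab obtain \<alpha> where *: "\<alpha> \<in> D" "(a, b) \<in> root_entries \<alpha>" by (rule UN_E)
    then have "(- b, - a) \<in> root_entries \<alpha>" using D by (intro root_entries_swap(1)) auto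
    with *(1) show ?thesis by (rule UN_I)
  qed
  have column: "a = c" if "(a, b) \<in> ?E" "(c, b) \<in> ?E" for a b c
    using row[OF swap[OF that(1)] swap[OF that(2)]] by simp
  show ?thesis
    unfolding basic_roots_def basic_def
  proof (intro conjI inj_onI)
    fix x y assume xy: "x \<in> ?E" "y \<in> ?E" "fst x = fst y"
    obtain a b c where "x = (a, b)" "y = (a, c)" using xy(3) by (metis prod.collapse)
    with row[of a b c] xy(1,2) show "x = y" by (simp only:)
  next
    fix x y assume xy: "x \<in> ?E" "y \<in> ?E" "snd x = snd y"
    obtain a b c where "x = (a, b)" "y = (c, b)" using xy(3) by (metis prod.collapse)
    with column[of a b c] xy(1,2) show "x = y" by (simp only:)
  qed
qed

context U_context
begin

text \<open>The strict inequality makes the rewriting terminate. Of two ordinary roots, the one with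
  the shorter entry in the common row is the one replaced.\<close>

lemma sop_sharing_row:
  assumes \<alpha>: "\<alpha> \<in> roots t n" and \<beta>: "\<beta> \<in> roots t n" and share: "sharing_row \<alpha> \<beta>"
    and r: "r \<noteq> 0" and s: "s \<noteq> 0"
  obtains N where "N < weight t n \<alpha> + weight t n \<beta>"
    and "sum_of_products N (\<lambda>x. xi t n \<theta> \<alpha> r x * xi t n \<theta> \<beta> s x)"
proof -
  obtain a b c where ab: "(a, b) \<in> root_entries \<alpha>" and ac: "(a, c) \<in> root_entries \<beta>"
    using share by (auto simp: sharing_row_def)
  have ordinary: "\<exists>N. N < weight t n \<alpha> + weight t n \<beta> \<and> sum_of_products N (\<lambda>x. xi t n \<theta> \<alpha> r x * xi t n \<theta> \<beta> s x)"
    if \<alpha>: "\<alpha> \<in> roots t n" "\<not> is_twice \<alpha>" "(a, b) \<in> root_entries \<alpha>"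
      and \<beta>: "\<beta> \<in> roots t n" "\<not> is_twice \<beta>" "(a, c) \<in> root_entries \<beta>"
      and le: "pos t n b \<le> pos t n c" and r: "r \<noteq> 0" and s: "s \<noteq> 0" for \<alpha> \<beta> b c r s
  proof -
    have idx: "a \<in> indices t n" "b \<in> indices t n" "c \<in> indices t n" "a \<prec> b"
      using root_entries_indices[OF \<alpha>(1,3)] root_entries_indices[OF \<beta>(1,3)] by auto
    have lt: "pos t n a < pos t n b" using pos_less_iff[OF idx(1,2)] idx(4) by simp
    have ne: "pos t n a + pos t n b + 1 \<noteq> m"
    proof
      assume "pos t n a + pos t n b + 1 = m"
      then have "pos t n (- b) = pos t n a" unfolding pos_minus[OF idx(2)] by simp
      moreover have "- b \<in> indices t n" using idx(2) by (auto simp: indices_def)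
      ultimately show False using pos_inj idx(1) root_entries_swap(2)[OF \<alpha>(1,3,2)] by blast
    qed
    obtain u where u: "u \<noteq> 0" and xi\<alpha>: "\<And>r x. r \<noteq> 0 \<Longrightarrow> x \<in> carrier U \<Longrightarrow>
        xi t n \<theta> \<alpha> r x = Ze x (pos t n a) (pos t n b) (u * r)"
      using xi_entry[OF \<alpha>] by blast
    obtain v where v: "v \<noteq> 0" and xi\<beta>: "\<And>r x. r \<noteq> 0 \<Longrightarrow> x \<in> carrier U \<Longrightarrow>
        xi t n \<theta> \<beta> r x = Ze x (pos t n a) (pos t n c) (v * r)"
      using xi_entry[OF \<beta>] by blast
    let ?N = "2 * (pos t n b - pos t n a) + 2 * (pos t n c - pos t n a)"
    have "sum_of_products (?N - 1) (\<lambda>x. Ze x (pos t n a) (pos t n b) (u * r) * Ze x (pos t n a) (pos t n c) (v * s))"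
      using lt le ne u v r s pos_less[OF idx(3)] by (intro sop_Z_mult_Z) auto
    then have "sum_of_products (?N - 1) (\<lambda>x. xi t n \<theta> \<alpha> r x * xi t n \<theta> \<beta> s x)"
      by (rule sop_cong) (simp add: xi\<alpha> xi\<beta> r s)
    moreover have "?N - 1 < weight t n \<alpha> + weight t n \<beta>"
      unfolding weight_pair[OF \<alpha>] weight_pair[OF \<beta>] using lt by simp
    ultimately show ?thesis by blast
  qed
  have twice: "\<exists>N. N < weight t n (Twice a) + weight t n \<beta> \<and>
      sum_of_products N (\<lambda>x. xi t n \<theta> (Twice a) r x * xi t n \<theta> \<beta> s x)"
    if a: "Twice a \<in> roots t n" and \<beta>: "\<beta> \<in> roots t n" and ac: "(a, c) \<in> root_entries \<beta>"
      and r: "r \<noteq> 0" and s: "s \<noteq> 0" for \<beta> a c r s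
  proof -
    have t: "t = Symplectic" and i: "1 \<le> a" "a \<le> int n"
      using a by (auto simp: roots_def split: family.splits)
    let ?p = "pos t n a"
    have p: "?p < n" using i by (auto simp: pos_def)
    have m: "m = 2 * n" using t by (simp add: dimn_def middle_def)
    note xi_a = xi_Twice[OF _ i t]
    show ?thesis
    proof (cases "is_twice \<beta>")
      case True
      then obtain i' where "\<beta> = Twice i'" by (cases \<beta>) auto
      then have \<beta>: "\<beta> = Twice a" using ac by simp
      have "sum_of_products (2 * (m - 1 - 2 * ?p) - 1) (\<lambda>x. xi t n \<theta> (Twice a) r x * xi t n \<theta> (Twice a) s x)"
        by (rule sop_cong[OF sop_Q_mult_Q[OF p t r s]]) (simp add: xi_a)
      then show ?thesis
        unfolding \<beta> weight_Twice[OF i] using p m by (intro exI[of _ "2 * (m - 1 - 2 * ?p) - 1"]) auto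
    next
      case False
      have idx: "a \<in> indices t n" "c \<in> indices t n" "a \<prec> c"
        using root_entries_indices[OF \<beta> ac] by auto
      let ?q = "pos t n c"
      have pq: "?p < ?q" "?q < m"
        using pos_less_iff[OF idx(1,2)] idx(3) pos_less[OF idx(2)] by auto
      have "?q \<noteq> m - 1 - ?p"
      proof
        assume "?q = m - 1 - ?p"
        then have "pos t n (- c) = ?p" unfolding pos_minus[OF idx(2)] using p m by simp
        moreover have "- c \<in> indices t n" using idx(2) by (auto simp: indices_def)
        ultimately show False
          using pos_inj idx(1) root_entries_swap(2)[OF \<beta> ac False] by blast
      qed
      then consider "?q < m - 1 - ?p" | "m - 1 - ?p < ?q" by linarith
      then show ?thesis
      proof cases
        case 1
        obtain v where v: "v \<noteq> 0" and xi\<beta>: "\<And>r x. r \<noteq> 0 \<Longrightarrow> x \<in> carrier U \<Longrightarrow>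
            xi t n \<theta> \<beta> r x = Ze x ?p ?q (v * r)"
          using xi_entry[OF \<beta> False ac] by blast
        let ?N = "m - 1 - 2 * ?p + 2 * (?q - ?p)"
        have vs: "v * s \<noteq> 0" using v s by simp
        have "sum_of_products (?N - 1) (\<lambda>x. xi t n \<theta> (Twice a) r x * xi t n \<theta> \<beta> s x)"
          by (rule sop_cong[OF sop_Q_mult_Z_row[OF pq(1) 1 t r vs]]) (simp add: xi_a xi\<beta> s)
        moreover have "?N - 1 < weight t n (Twice a) + weight t n \<beta>"
          unfolding weight_Twice[OF i] weight_pair[OF \<beta> False ac] using pq by simp
        ultimately show ?thesis by blast
      next
        \<comment> \<open>The entry \<open>(a, c)\<close> lies beyond \<open>(a, - a)\<close>. Its
          mirror image \<open>(- c, - a)\<close> lies above \<open>(a, - a)\<close> in the same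
          column, which is the situation of \<open>Q_mult_Z_column\<close>.\<close>
        case 2
        note ca = root_entries_swap(1)[OF \<beta> ac]
        let ?j = "m - 1 - ?q"
        have j: "?j < ?p" using 2 p m pq by simp
        have pos: "pos t n (- c) = ?j" "pos t n (- a) = m - 1 - ?p"
          using pos_minus[OF idx(1)] pos_minus[OF idx(2)] by auto
        obtain v where v: "v \<noteq> 0" and xi\<beta>: "\<And>r x. r \<noteq> 0 \<Longrightarrow> x \<in> carrier U \<Longrightarrow>
            xi t n \<theta> \<beta> r x = Ze x ?j (m - 1 - ?p) (v * r)"
          using xi_entry[OF \<beta> False ca] unfolding pos by blast
        let ?N = "m - 1 - 2 * ?p + 2 * (m - 1 - ?p - ?j)"
        have vs: "v * s \<noteq> 0" using v s by simp
        have "sum_of_products (?N - 1) (\<lambda>x. xi t n \<theta> (Twice a) r x * xi t n \<theta> \<beta> s x)"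
          by (rule sop_cong[OF sop_Q_mult_Z_column[OF j p t r vs]]) (simp add: xi_a xi\<beta> s)
        moreover have "?N - 1 < weight t n (Twice a) + weight t n \<beta>"
          unfolding weight_Twice[OF i] weight_pair[OF \<beta> False ca] pos using p m by simp
        ultimately show ?thesis by blast
      qed
    qed
  qed
  have "\<exists>N. N < weight t n \<alpha> + weight t n \<beta> \<and> sum_of_products N (\<lambda>x. xi t n \<theta> \<alpha> r x * xi t n \<theta> \<beta> s x)"
  proof (cases "is_twice \<alpha>")
    case True
    then have "\<alpha> = Twice a" using ab by (cases \<alpha>) auto
    then show ?thesis using twice[of a \<beta> c r s] \<alpha> \<beta> ac r s by blast
  next
    case \<alpha>': False
    show ?thesis
    proof (cases "is_twice \<beta>")
      case True
      then have "\<beta> = Twice a" using ac by (cases \<beta>) auto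
      then show ?thesis using twice[of a \<alpha> b s r] \<alpha> \<beta> ab r s by (simp add: mult.commute add.commute)
    next
      case \<beta>': False
      show ?thesis
      proof (cases "pos t n b \<le> pos t n c")
        case True
        then show ?thesis using ordinary[OF \<alpha> \<alpha>' ab \<beta> \<beta>' ac _ r s] by blast
      next
        case False
        then show ?thesis
          using ordinary[OF \<beta> \<beta>' ac \<alpha> \<alpha>' ab _ s r] by (simp add: mult.commute add.commute)
      qed
    qed
  qed
  then show ?thesis using that by blast
qed

section \<open>Nonnegative combinations of supercharacters\<close>

abbreviation "isum \<equiv> is_sum_of_supercharacters t n \<theta>"

lemma isum_zero: "isum (\<lambda>_. 0)"
  unfolding is_sum_of_supercharacters_def by (rule exI[of _ "\<lambda>_. 0"]) simp

lemma isum_add: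
  assumes "isum f" and "isum g"
  shows "isum (\<lambda>x. f x + g x)"
proof -
  obtain c d :: "('a mat \<Rightarrow> complex) \<Rightarrow> nat"
    where "\<forall>x\<in>carrier U. f x = (\<Sum>\<chi>\<in>supercharacters_U t n \<theta>. of_nat (c \<chi>) * \<chi> x)"
      and "\<forall>x\<in>carrier U. g x = (\<Sum>\<chi>\<in>supercharacters_U t n \<theta>. of_nat (d \<chi>) * \<chi> x)"
    using assms unfolding is_sum_of_supercharacters_def by blast
  then show ?thesis
    unfolding is_sum_of_supercharacters_def
    by (intro exI[of _ "\<lambda>\<chi>. c \<chi> + d \<chi>"]) (simp add: sum.distrib distrib_right)
qed

lemma isum_cong:
  assumes "isum f" and "\<And>x. x \<in> carrier U \<Longrightarrow> g x = f x"
  shows "isum g"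
  using assms by (simp add: is_sum_of_supercharacters_def)

lemma isum_supercharacter:
  assumes "f \<in> supercharacters_U t n \<theta>"
  shows "isum f"
  unfolding is_sum_of_supercharacters_def
proof (intro exI[of _ "\<lambda>\<chi>. if \<chi> = f then 1 else 0"] ballI)
  fix x
  have "(\<Sum>\<chi>\<in>supercharacters_U t n \<theta>. of_nat (if \<chi> = f then 1 else 0) * \<chi> x) =
      (\<Sum>\<chi>\<in>supercharacters_U t n \<theta>. if \<chi> = f then f x else 0)"
    by (rule sum.cong) auto
  then show "f x = (\<Sum>\<chi>\<in>supercharacters_U t n \<theta>. of_nat (if \<chi> = f then 1 else 0) * \<chi> x)"
    using assms finite_supercharacters_U[of t n \<theta>] by simp
qed

text \<open>Words are multisets because before the reduction a root can occur repeatedly, with equal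
  or different parameters.\<close>

definition word_value :: "(root \<times> 'a) multiset \<Rightarrow> 'a mat \<Rightarrow> complex" where
  "word_value W x = (\<Prod>(\<alpha>, r)\<in>#W. xi t n \<theta> \<alpha> r x)"

definition word_weight :: "(root \<times> 'a) multiset \<Rightarrow> nat" where
  "word_weight W = (\<Sum>(\<alpha>, r)\<in>#W. weight t n \<alpha>)"

definition is_word :: "(root \<times> 'a) multiset \<Rightarrow> bool" where
  "is_word W \<longleftrightarrow> (\<forall>(\<alpha>, r)\<in>#W. \<alpha> \<in> roots t n \<and> r \<noteq> 0)"

lemma sop_word:
  assumes "is_word W"
  shows "sum_of_products (word_weight W) (word_value W)"
  using assms
proof (induction W)
  case empty
  have "word_value {#} = (\<lambda>_. 1)" by (simp add: word_value_def fun_eq_iff)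
  then show ?case by (simp add: sop_one)
next
  case (add p W)
  obtain \<alpha> r where p: "p = (\<alpha>, r)" by (cases p)
  have "sum_of_products (word_weight (add_mset p W)) (\<lambda>x. xi t n \<theta> \<alpha> r x * word_value W x)"
    by (rule sop_mult[OF sop_letter[OF _ _ order.refl]])
       (use add p in \<open>auto simp: is_word_def word_weight_def\<close>)
  then show ?case
    by (rule sop_cong) (simp add: word_value_def p)
qed

text \<open>Expanding sums of products.  The multiplier \<open>h\<close> stands for the factors that are already
  expanded, so that the induction passes through products.\<close>

lemma sop_expand:
  assumes "sum_of_products N f"
    and "\<And>W. is_word W \<Longrightarrow> word_weight W + B \<le> K \<Longrightarrow> isum (\<lambda>x. h x * word_value W x)"
    and "is_word W" and "word_weight W + (B + N) \<le> K"
  shows "isum (\<lambda>x. f x * h x * word_value W x)"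
  using assms
proof (induction arbitrary: h B W rule: sum_of_products.induct)
  case (sop_zero N)
  then show ?case by (simp add: isum_zero)
next
  case (sop_one N)
  then show ?case by simp
next
  case (sop_letter \<alpha> r N)
  have "isum (\<lambda>x. h x * word_value (add_mset (\<alpha>, r) W) x)"
    using sop_letter by (intro sop_letter.prems(1)) (auto simp: is_word_def word_weight_def)
  then show ?case
    by (rule isum_cong) (simp add: word_value_def mult_ac)
next
  case (sop_add N f g)
  have "isum (\<lambda>x. f x * h x * word_value W x + g x * h x * word_value W x)"
    using sop_add.IH[OF sop_add.prems] by (intro isum_add) auto
  then show ?case
    by (rule isum_cong) (simp add: distrib_right)
next
  case (sop_mult M f N g K')
  have "isum (\<lambda>x. f x * (g x * h x) * word_value W x)"
  proof (rule sop_mult.IH(1))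
    show "isum (\<lambda>x. g x * h x * word_value V x)" if "is_word V" "word_weight V + (B + N) \<le> K" for V
      using sop_mult.IH(2)[OF sop_mult.prems(1) that] .
  qed (use sop_mult in auto)
  then show ?case by (simp add: mult.assoc)
next
  case (sop_cong N f g)
  have "isum (\<lambda>x. f x * h x * word_value W x)"
    by (rule sop_cong.IH[OF sop_cong.prems])
  then show ?case
    by (rule isum_cong) (simp add: sop_cong.hyps)
qed

text \<open>Every root shares a row with itself, so in such a word it occurs only once and its
  parameter becomes a function of the root.\<close>

lemma word_without_sharing:
  assumes "is_word W"
    and "\<And>\<alpha> r \<beta> s V. W = add_mset (\<alpha>, r) (add_mset (\<beta>, s) V) \<Longrightarrow> \<not> sharing_row \<alpha> \<beta>"
  shows "\<exists>\<phi>. (\<forall>\<alpha>\<in>fst ` set_mset W. \<phi> \<alpha> \<noteq> 0) \<and>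
    (\<forall>x. word_value W x = (\<Prod>\<alpha>\<in>fst ` set_mset W. xi t n \<theta> \<alpha> (\<phi> \<alpha>) x))"
  using assms
proof (induction W)
  case empty
  then show ?case by (simp add: word_value_def)
next
  case (add p W)
  obtain \<alpha> r where p: "p = (\<alpha>, r)" by (cases p)
  have "\<not> sharing_row \<beta> \<gamma>" if "W = add_mset (\<beta>, s) (add_mset (\<gamma>, u) V)" for \<beta> s \<gamma> u V
    by (rule add.prems(2)[of \<beta> s \<gamma> u "add_mset p V"]) (simp add: that add_mset_commute)
  moreover have "is_word W" using add.prems(1) by (simp add: is_word_def)
  ultimately obtain \<phi> where \<phi>: "\<forall>\<alpha>\<in>fst ` set_mset W. \<phi> \<alpha> \<noteq> 0"
    "\<And>x. word_value W x = (\<Prod>\<alpha>\<in>fst ` set_mset W. xi t n \<theta> \<alpha> (\<phi> \<alpha>) x)"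
    using add.IH by blast
  have new: "\<alpha> \<notin> fst ` set_mset W"
  proof
    assume "\<alpha> \<in> fst ` set_mset W"
    then obtain s where "(\<alpha>, s) \<in># W" by auto
    then obtain V where "W = add_mset (\<alpha>, s) V" by (rule mset_add)
    then have "\<not> sharing_row \<alpha> \<alpha>"
      by (intro add.prems(2)[of \<alpha> r \<alpha> s V]) (simp add: p)
    then show False using root_entry_in[of \<alpha>] by (cases "root_entry \<alpha>") (auto simp: sharing_row_def)
  qed
  have "(\<Prod>\<beta>\<in>fst ` set_mset W. xi t n \<theta> \<beta> ((\<phi>(\<alpha> := r)) \<beta>) x) = (\<Prod>\<beta>\<in>fst ` set_mset W. xi t n \<theta> \<beta> (\<phi> \<beta>) x)"
    for x
    using new by (intro prod.cong) auto
  then have "word_value (add_mset p W) x =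
      (\<Prod>\<beta>\<in>fst ` set_mset (add_mset p W). xi t n \<theta> \<beta> ((\<phi>(\<alpha> := r)) \<beta>) x)" for x
    using new \<phi>(2)[of x] by (simp add: p word_value_def)
  moreover have "\<forall>\<beta>\<in>fst ` set_mset (add_mset p W). (\<phi>(\<alpha> := r)) \<beta> \<noteq> 0"
    using \<phi>(1) add.prems(1) by (auto simp: p is_word_def)
  ultimately show ?case by blast
qed

text \<open>Induction on the weight: a colliding pair is replaced by a sum of products of smaller
  weight, and a word without collisions is itself a supercharacter.\<close>

lemma isum_word:
  assumes "is_word W"
  shows "isum (word_value W)"
  using assms
proof (induction "word_weight W" arbitrary: W rule: less_induct)
  case less
  show ?case
  proof (cases "\<exists>\<alpha> r \<beta> s V. W = add_mset (\<alpha>, r) (add_mset (\<beta>, s) V) \<and> sharing_row \<alpha> \<beta>")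
    case True
    then obtain \<alpha> r \<beta> s V where W: "W = add_mset (\<alpha>, r) (add_mset (\<beta>, s) V)" and share: "sharing_row \<alpha> \<beta>"
      by blast
    then have *: "\<alpha> \<in> roots t n" "\<beta> \<in> roots t n" "r \<noteq> 0" "s \<noteq> 0" "is_word V"
      using less.prems by (auto simp: is_word_def)
    obtain N where N: "N < weight t n \<alpha> + weight t n \<beta>"
      and reduced: "sum_of_products N (\<lambda>x. xi t n \<theta> \<alpha> r x * xi t n \<theta> \<beta> s x)"
      using sop_sharing_row[OF *(1,2) share *(3,4)] by blast
    let ?f = "\<lambda>x. xi t n \<theta> \<alpha> r x * xi t n \<theta> \<beta> s x * word_value V x"
    have less_weight: "N + word_weight V < word_weight W"
      using N by (simp add: W word_weight_def)
    \<comment> \<open>The expansion starts with multiplier 1 and the empty word. All words it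
      reaches have weight at most \<open>N + word_weight V\<close>, so the induction hypothesis
      covers them.\<close>
    have "isum (\<lambda>x. ?f x * 1 * word_value {#} x)"
    proof (rule sop_expand[OF sop_mult[OF reduced sop_word[OF *(5)] order.refl],
          where B = 0 and K = "N + word_weight V"])
      fix W' assume "is_word W'" "word_weight W' + 0 \<le> N + word_weight V"
      then show "isum (\<lambda>x. 1 * word_value W' x)"
        using less.hyps[of W'] less_weight by simp
    qed (auto simp: is_word_def word_weight_def)
    then show ?thesis
      by (rule isum_cong) (simp add: W word_value_def mult.assoc)
  next
    case False
    let ?D = "fst ` set_mset W"
    obtain \<phi> where \<phi>: "\<forall>\<alpha>\<in>?D. \<phi> \<alpha> \<noteq> 0"
      "\<And>x. word_value W x = (\<Prod>\<alpha>\<in>?D. xi t n \<theta> \<alpha> (\<phi> \<alpha>) x)"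
      using word_without_sharing[OF less.prems] False by blast
    have D: "?D \<subseteq> roots t n" using less.prems by (auto simp: is_word_def)
    have "basic_roots ?D"
    proof (rule basic_roots_if_no_sharing_row[OF D])
      fix \<alpha> \<beta> assume "\<alpha> \<in> ?D" "\<beta> \<in> ?D" "\<alpha> \<noteq> \<beta>"
      then obtain r s where rs: "(\<alpha>, r) \<in># W" "(\<beta>, s) \<in># W" by auto
      then obtain V where V: "W = add_mset (\<alpha>, r) V" by (auto elim: mset_add)
      then have "(\<beta>, s) \<in># V" using rs \<open>\<alpha> \<noteq> \<beta>\<close> by auto
      then obtain V' where "V = add_mset (\<beta>, s) V'" by (rule mset_add)
      then show "\<not> sharing_row \<alpha> \<beta>" using False V by blast
    qed
    \<comment> \<open>Supercharacters are indexed by extensional functions, hence the restriction of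
      \<open>\<phi>\<close>.\<close>
    moreover have "word_value W = xi_prod t n \<theta> ?D (restrict \<phi> ?D)"
      unfolding xi_prod_def[abs_def] by (rule ext, subst \<phi>(2)) (rule prod.cong, auto)
    moreover have "restrict \<phi> ?D \<in> ?D \<rightarrow>\<^sub>E - {0}" using \<phi>(1) by auto
    ultimately have "word_value W \<in> supercharacters_U t n \<theta>"
      unfolding supercharacters_U_def using D by (intro CollectI exI conjI)
    then show ?thesis by (rule isum_supercharacter)
  qed
qed

lemma isum_SP:
  assumes "sum_of_products N f"
  shows "isum f"
proof -
  have "isum (\<lambda>x. f x * 1 * word_value {#} x)"
    by (rule sop_expand[OF assms, where B = 0 and K = N])
       (use isum_word in \<open>auto simp: is_word_def word_weight_def\<close>)
  then show ?thesis
    by (rule isum_cong) (simp add: word_value_def)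
qed

lemma sop_zeta_prod:
  assumes "finite D" and "D \<subseteq> entries t n" and "\<And>p. p \<in> D \<Longrightarrow> \<phi> p \<noteq> 0"
  shows "\<exists>N. sum_of_products N (zeta_prod t n \<theta> D \<phi>)"
  using assms
proof (induction D)
  case empty
  have "zeta_prod t n \<theta> {} \<phi> = (\<lambda>_. 1)" by (simp add: zeta_prod_def fun_eq_iff)
  then show ?case using sop_one[of 0] by auto
next
  case (insert p D)
  then obtain N where N: "sum_of_products N (zeta_prod t n \<theta> D \<phi>)" by auto
  obtain i j where p: "p = (i, j)" by (cases p)
  have ij: "(i, j) \<in> entries t n" using insert.prems p by auto
  then have idx: "i \<in> indices t n" "j \<in> indices t n" "i \<prec> j" by (auto simp: entries_def)
  let ?w = "2 * (pos t n j - pos t n i)"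
  have "sum_of_products ?w (\<lambda>x. Ze x (pos t n i) (pos t n j) (\<phi> p))"
    using pos_less_iff[OF idx(1,2)] idx pos_less[OF idx(2)] insert.prems(2)[of p]
    by (intro sop_Z) auto
  then have "sum_of_products ?w (zeta t n \<theta> i j (\<phi> p))"
    by (rule sop_cong) (rule zeta_eq[OF ij], auto simp: U_carrier iso_set_def)
  then have "sum_of_products (?w + N) (\<lambda>x. zeta t n \<theta> i j (\<phi> p) x * zeta_prod t n \<theta> D \<phi> x)"
    using N by (rule sop_mult) simp
  then have "sum_of_products (?w + N) (zeta_prod t n \<theta> (insert p D) \<phi>)"
    by (rule sop_cong) (use insert.hyps p in \<open>simp add: zeta_prod_def\<close>)
  then show ?case by blast
qed

end

lemma two_nonzero:
  assumes "prime p" and "p \<ge> 3" and "card (UNIV :: 'a :: {field, finite} set) = p ^ e"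
  shows "(2 :: 'a) \<noteq> 0"
proof
  assume "(2 :: 'a) = 0"
  then have "of_nat 2 = (0 :: 'a)" by simp
  then have "CHAR('a) dvd 2" by (simp only: of_nat_eq_0_iff_char_dvd)
  moreover have "CHAR('a) \<noteq> 1" by simp
  ultimately have "CHAR('a) = 2"
    using two_is_prime_nat prime_nat_iff by blast
  moreover have "CHAR('a) dvd p ^ e"
    using CHAR_dvd_CARD[where 'a = 'a] assms(3) by simp
  ultimately have "2 dvd p" using two_is_prime_nat prime_dvd_power by metis
  then have "2 = p" by (rule primes_dvd_imp_eq[OF two_is_prime_nat assms(1)])
  then show False using assms(2) by simp
qed

theorem corollary4p4:
  fixes p e n :: nat
    and t :: family
    and \<theta> :: "'a :: {field, finite} \<Rightarrow> complex"
    and \<zeta> :: "'a mat \<Rightarrow> complex"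
  assumes "prime p" and "p \<ge> 3" and "e \<ge> 1" and "card (UNIV :: 'a set) = p ^ e"
    and "n \<ge> 1"
    and "nontrivial_additive_char \<theta>"
    and "\<zeta> \<in> supercharacters_unitriangular t n \<theta>"
  shows "is_sum_of_supercharacters t n \<theta> (restrict \<zeta> (carrier (U_group t n)))"
proof -
  interpret U_context \<theta> t n
    by unfold_locales (use assms(6) two_nonzero[OF assms(1,2,4)] in auto)
  obtain D \<phi> where \<zeta>: "\<zeta> = zeta_prod t n \<theta> D \<phi>" and D: "D \<subseteq> entries t n" and \<phi>: "\<phi> \<in> D \<rightarrow>\<^sub>E - {0}"
    using assms(7) by (auto simp: supercharacters_unitriangular_def)
  have "finite D"
  proof (rule finite_subset[OF D])
    have "entries t n \<subseteq> {- int n..int n} \<times> {- int n..int n}"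
      by (auto simp: entries_def indices_def split: if_splits)
    then show "finite (entries t n)" by (rule finite_subset) auto
  qed
  then obtain N where "sum_of_products N \<zeta>"
    using sop_zeta_prod[OF _ D, of \<phi>] \<phi> by (auto simp: \<zeta>)
  then have "isum \<zeta>" by (rule isum_SP)
  then show ?thesis by (rule isum_cong) simp
qed

end
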